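(* Let $(\mathcal X,\mathcal X^\Omega)$, $(\mathcal Y,\mathcal Y^\Omega)$ and $(\mathcal Z,\mathcal Z^\Omega)$ be quasi-universal spaces. Assume one of the following: 1. $(\mathcal Y,\mathcal Y^\Omega)$ is countably separated and $(\mathcal X,\mathcal X^\Omega)$ is a standard quasi-universal space; or 2. $(\mathcal Y,\mathcal Y^\Omega)$ is countably separated and $(\mathcal Z,\mathcal Z^\Omega)$ is a standard quasi-universal space; or 3. $(\mathcal Y,\mathcal Y^\Omega)$ is discrete, i.e. $\mathcal Y$ is countable and $\mathcal Y^\Omega$ is the set of all measurable maps $(\Omega,\mathcal B_\Omega)\to(\mathcal Y,2^{\mathcal Y})$, with $(\mathcal X,\mathcal X^\Omega)$ and $(\mathcal Z,\mathcal Z^\Omega)$ arbitrary. Then $(\mathcal X,\mathcal Y,\mathcal Z)$ is a disintegration triple, i.e. the product of Markov kernels $$\otimes:\ \mathsf P(\mathcal X)^{\mathcal Y\times\mathcal Z}\times\mathsf P(\mathcal Y)^{\mathcal Z}\to\mathsf P(\mathcal X\times\mathcal Y)^{\mathcal Z}$$ is surjective, and it is even a quotient map.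
   Context: Fix the sample space: $\Omega=[0,1]^{\mathbb N}$, $\mathcal B_\Omega$ the $\sigma$-algebra of all universally measurable subsets of $\Omega$, $\Omega^\Omega$ the set of all measurable maps $(\Omega,\mathcal B_\Omega)\to(\Omega,\mathcal B_\Omega)$. A quasi-universal space is a pair $(\mathcal X,\mathcal X^\Omega)$ of a set and a set $\mathcal X^\Omega$ of maps $\Omega\to\mathcal X$ (admissible random variables) containing all constants and closed under $X\mapsto X\circ\Phi$, $\Phi\in\Omega^\Omega$; $g:\mathcal X\to\mathcal Y$ is quasi-measurable if $g\circ\mathcal X^\Omega\subseteq\mathcal Y^\Omega$; products carry componentwise structure. The function space $\mathcal Y^{\mathcal X}$ is the set of quasi-measurable maps $\mathcal X\to\mathcal Y$, with admissible random variables the maps $Y:\Omega\to\mathcal Y^{\mathcal X}$ such that $(\omega,x)\mapsto Y(\omega)(x)$ is quasi-measurable. A quotient map is a surjective quasi-measurable map $f:\mathcal X\to\mathcal Y$ with $\mathcal Y^\Omega=f\circ\mathcal X^\Omega$. The induced $\sigma$-algebra is $\mathcal B_{\mathcal X}=\{A\subseteq\mathcal X\mid X^{-1}(A)\in\mathcal B_\Omega\ \forall X\in\mathcal X^\Omega\}$; $\mathcal B_{\mathcal X\times\mathcal Y}$ is that of the product. A quasi-universal space is countably separated if some countable subset of its induced $\sigma$-algebra separates its points; it is standard if it is empty or a retract of $(\Omega,\Omega^\Omega)$, i.e. there are quasi-measurable $i:\mathcal X\to\Omega$, $r:\Omega\to\mathcal X$ with $r\circ i=\mathrm{id}$. $\mathsf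 P(\mathcal X)$ is the quasi-universal space of push-forward measures $X_*P$ on $\mathcal B_{\mathcal X}$, with $X\in\mathcal X^\Omega$ and $P$ a probability measure on $(\Omega,\mathcal B_\Omega)$; its admissible random variables are the maps $\omega\mapsto X(\omega)_*P$ with $X\in(\mathcal X^\Omega)^\Omega$, $P$ a probability measure on $(\Omega,\mathcal B_\Omega)$. Elements of $\mathsf P(\mathcal X)^{\mathcal Z}$ are Markov kernels. The product of Markov kernels is $(K(X|Y,Z)\otimes Q(Y|Z))(D|z)=\int K(X\in D^y|Y=y,Z=z)\,Q(Y\in dy|Z=z)$, $D\in\mathcal B_{\mathcal X\times\mathcal Y}$, $D^y=\{x\mid(x,y)\in D\}$. $(\mathcal X,\mathcal Y,\mathcal Z)$ is a disintegration triple if every $K(X,Y|Z)\in\mathsf P(\mathcal X\times\mathcal Y)^{\mathcal Z}$ admits some $K(X|Y,Z)\in\mathsf P(\mathcal X)^{\mathcal Y\times\mathcal Z}$ with $K(X,Y|Z)=K(X|Y,Z)\otimes K(Y|Z)$, where $K(Y|Z)$ is the marginal Markov kernel; equivalently, $\otimes$ above is surjective. *)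

theory Defs
  imports "HOL-Probability.Probability"
begin

section \<open>The sample space\<close>

typedef hcube = "(UNIV :: nat set) \<rightarrow> {0..1 :: real}"
  morphisms hcube_nth Abs_hcube
  by (rule exI[of _ "\<lambda>_. 0"]) auto

definition hcube_borel :: "hcube measure" where
  "hcube_borel = vimage_algebra UNIV hcube_nth (borel :: (nat \<Rightarrow> real) measure)"

definition universally_measurable :: "hcube set \<Rightarrow> bool" where
  "universally_measurable A \<longleftrightarrow>
     (\<forall>\<mu>. prob_space \<mu> \<and> sets \<mu> = sets hcube_borel \<longrightarrow> A \<in> sets (completion \<mu>))"

text \<open>Used only as a measurable space; the measure component of \<open>sigma\<close> is irrelevant.\<close>

definition B_Omega :: "hcube measure" where
  "B_Omega = sigma UNIV {A. universally_measurable A}"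

lemma space_B_Omega [simp]: "space B_Omega = UNIV"
  by (simp add: B_Omega_def)

lemma sets_B_Omega: "sets B_Omega = {A. universally_measurable A}"
proof -
  have sp: "space \<mu> = UNIV" if "sets \<mu> = sets hcube_borel" for \<mu> :: "hcube measure"
    using sets_eq_imp_space_eq[OF that] by (simp add: hcube_borel_def)
  have "sigma_algebra UNIV {A. universally_measurable A}"
  proof (rule sigma_algebra_iff2[THEN iffD2], intro conjI)
    show "{} \<in> {A. universally_measurable A}" by (simp add: universally_measurable_def)
    show "\<forall>s\<in>{A. universally_measurable A}. UNIV - s \<in> {A. universally_measurable A}"
    proof (clarsimp simp: universally_measurable_def)
      fix s :: "hcube set" and \<mu> :: "hcube measure"
      assume "\<forall>\<mu>. prob_space \<mu> \<and> sets \<mu> = sets hcube_borel \<longrightarrow> s \<in> sets (completion \<mu>)"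
        and "prob_space \<mu>" and b: "sets \<mu> = sets hcube_borel"
      then have "s \<in> sets (completion \<mu>)" by blast
      then have "space (completion \<mu>) - s \<in> sets (completion \<mu>)" by (rule sets.compl_sets)
      then show "UNIV - s \<in> sets (completion \<mu>)" by (simp add: sp[OF b])
    qed
    show "\<forall>A::nat \<Rightarrow> hcube set. range A \<subseteq> {A. universally_measurable A} \<longrightarrow>
        (\<Union>i. A i) \<in> {A. universally_measurable A}"
    proof (intro allI impI)
      fix A :: "nat \<Rightarrow> hcube set" assume "range A \<subseteq> {A. universally_measurable A}"
      then have A: "universally_measurable (A i)" for i by blast
      show "(\<Union>i. A i) \<in> {A. universally_measurable A}"
        unfolding mem_Collect_eq universally_measurable_def
      proof (intro allI impI)
        fix \<mu> :: "hcube measure" assume "prob_space \<mu> \<and> sets \<mu> = sets hcube_borel"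
        then have "A i \<in> sets (completion \<mu>)" for i
          using A unfolding universally_measurable_def by blast
        then show "(\<Union>i. A i) \<in> sets (completion \<mu>)" by (intro sets.countable_UN) blast
      qed
    qed
  qed auto
  then show ?thesis
    by (simp add: B_Omega_def sigma_algebra.sigma_sets_eq)
qed


section \<open>Quasi-universal spaces\<close>

record 'a qus =
  points :: "'a set"
  rvs :: "(hcube \<Rightarrow> 'a) set"

definition quasi_universal :: "'a qus \<Rightarrow> bool" where
  "quasi_universal X \<longleftrightarrow>
     rvs X \<subseteq> UNIV \<rightarrow> points X \<and>
     (\<forall>x\<in>points X. (\<lambda>_. x) \<in> rvs X) \<and>
     (\<forall>\<alpha>\<in>rvs X. \<forall>\<Phi>\<in>measurable B_Omega B_Omega. \<alpha> \<circ> \<Phi> \<in> rvs X)"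

lemma quasi_universal_range: "quasi_universal X \<Longrightarrow> \<alpha> \<in> rvs X \<Longrightarrow> \<alpha> \<omega> \<in> points X"
  unfolding quasi_universal_def by blast

definition Omega :: "hcube qus" where
  "Omega = \<lparr>points = UNIV, rvs = measurable B_Omega B_Omega\<rparr>"

text \<open>Maps between carriers are extensional functions, so that equality of maps is equality in HOL.\<close>

definition qmeas :: "'a qus \<Rightarrow> 'b qus \<Rightarrow> ('a \<Rightarrow> 'b) set" where
  "qmeas X Y = {g \<in> points X \<rightarrow>\<^sub>E points Y. \<forall>\<alpha>\<in>rvs X. g \<circ> \<alpha> \<in> rvs Y}"

definition qprod :: "'a qus \<Rightarrow> 'b qus \<Rightarrow> ('a \<times> 'b) qus" (infixr "\<times>\<^sub>Q" 80) where
  "X \<times>\<^sub>Q Y = \<lparr>points = points X \<times> points Y,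
             rvs = {\<alpha>. fst \<circ> \<alpha> \<in> rvs X \<and> snd \<circ> \<alpha> \<in> rvs Y}\<rparr>"

definition qfun :: "'a qus \<Rightarrow> 'b qus \<Rightarrow> ('a \<Rightarrow> 'b) qus" (infixr "\<Rightarrow>\<^sub>Q" 60) where
  "X \<Rightarrow>\<^sub>Q Y = \<lparr>points = qmeas X Y,
             rvs = {F. (\<forall>\<omega>. F \<omega> \<in> qmeas X Y) \<and>
                       (\<lambda>(\<omega>, x)\<in>points (Omega \<times>\<^sub>Q X). F \<omega> x) \<in> qmeas (Omega \<times>\<^sub>Q X) Y}\<rparr>"

lemma quasi_universal_Omega: "quasi_universal Omega"
  by (auto simp: quasi_universal_def Omega_def)

lemma quasi_universal_qprod:
  assumes "quasi_universal X" and "quasi_universal Y"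
  shows "quasi_universal (X \<times>\<^sub>Q Y)"
  using assms unfolding quasi_universal_def qprod_def
  by (fastforce simp: o_def mem_Times_iff)

lemma quasi_universal_qfun:
  assumes X: "quasi_universal X" and Y: "quasi_universal Y"
  shows "quasi_universal (X \<Rightarrow>\<^sub>Q Y)"
proof -
  have uncurry: "(\<lambda>(\<omega>, x)\<in>points (Omega \<times>\<^sub>Q X). F \<omega> x) \<in> qmeas (Omega \<times>\<^sub>Q X) Y \<longleftrightarrow>
      (\<forall>\<omega>. \<forall>x\<in>points X. F \<omega> x \<in> points Y) \<and>
      (\<forall>\<Phi>\<in>measurable B_Omega B_Omega. \<forall>\<alpha>\<in>rvs X. (\<lambda>\<omega>. F (\<Phi> \<omega>) (\<alpha> \<omega>)) \<in> rvs Y)"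
    (is "?L \<longleftrightarrow> ?A \<and> ?B") for F
  proof -
    let ?G = "\<lambda>(\<omega>, x)\<in>points (Omega \<times>\<^sub>Q X). F \<omega> x"
    have *: "?G \<circ> \<beta> = (\<lambda>\<omega>. F (fst (\<beta> \<omega>)) (snd (\<beta> \<omega>)))" if "\<beta> \<in> rvs (Omega \<times>\<^sub>Q X)" for \<beta>
    proof
      fix \<omega>
      have "\<beta> \<omega> \<in> points (Omega \<times>\<^sub>Q X)"
        using quasi_universal_range[OF quasi_universal_qprod[OF quasi_universal_Omega X] that] .
      then show "(?G \<circ> \<beta>) \<omega> = F (fst (\<beta> \<omega>)) (snd (\<beta> \<omega>))" by (simp add: case_prod_beta)
    qed
    have "?G \<in> points (Omega \<times>\<^sub>Q X) \<rightarrow>\<^sub>E points Y \<longleftrightarrow> ?A"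
      by (auto simp: PiE_iff qprod_def Omega_def)
    moreover have "(\<forall>\<beta>\<in>rvs (Omega \<times>\<^sub>Q X). ?G \<circ> \<beta> \<in> rvs Y) \<longleftrightarrow> ?B"
    proof
      assume L: "\<forall>\<beta>\<in>rvs (Omega \<times>\<^sub>Q X). ?G \<circ> \<beta> \<in> rvs Y"
      show ?B
      proof (intro ballI)
        fix \<Phi> \<alpha> assume "\<Phi> \<in> measurable B_Omega B_Omega" "\<alpha> \<in> rvs X"
        then have "(\<lambda>\<omega>. (\<Phi> \<omega>, \<alpha> \<omega>)) \<in> rvs (Omega \<times>\<^sub>Q X)"
          by (simp add: qprod_def Omega_def o_def)
        with L *[OF this] show "(\<lambda>\<omega>. F (\<Phi> \<omega>) (\<alpha> \<omega>)) \<in> rvs Y" by fastforce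
      qed
    next
      assume ?B
      then show "\<forall>\<beta>\<in>rvs (Omega \<times>\<^sub>Q X). ?G \<circ> \<beta> \<in> rvs Y"
        by (intro ballI, subst *) (auto simp: qprod_def Omega_def o_def)
    qed
    ultimately show ?thesis by (simp add: qmeas_def)
  qed
  show ?thesis
    unfolding quasi_universal_def
  proof (intro conjI ballI)
    show "rvs (X \<Rightarrow>\<^sub>Q Y) \<subseteq> UNIV \<rightarrow> points (X \<Rightarrow>\<^sub>Q Y)" by (auto simp: qfun_def)
  next
    fix g assume "g \<in> points (X \<Rightarrow>\<^sub>Q Y)"
    then have "g \<in> qmeas X Y" by (simp add: qfun_def)
    then show "(\<lambda>_. g) \<in> rvs (X \<Rightarrow>\<^sub>Q Y)"
      unfolding qfun_def qus.simps mem_Collect_eq uncurry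
      by (auto simp: qmeas_def o_def)
  next
    fix F \<Phi> assume "F \<in> rvs (X \<Rightarrow>\<^sub>Q Y)" and \<Phi>: "\<Phi> \<in> measurable B_Omega B_Omega"
    then have F: "\<forall>\<omega>. F \<omega> \<in> qmeas X Y" and
      B: "\<forall>\<Phi>\<in>measurable B_Omega B_Omega. \<forall>\<alpha>\<in>rvs X. (\<lambda>\<omega>. F (\<Phi> \<omega>) (\<alpha> \<omega>)) \<in> rvs Y"
      unfolding qfun_def qus.simps mem_Collect_eq uncurry by auto
    have "\<forall>\<Psi>\<in>measurable B_Omega B_Omega. \<forall>\<alpha>\<in>rvs X. (\<lambda>\<omega>. F (\<Phi> (\<Psi> \<omega>)) (\<alpha> \<omega>)) \<in> rvs Y"
    proof (intro ballI)
      fix \<Psi> \<alpha> assume \<Psi>: "\<Psi> \<in> measurable B_Omega B_Omega" and \<alpha>: "\<alpha> \<in> rvs X"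
      from B measurable_comp[OF \<Psi> \<Phi>] \<alpha> show "(\<lambda>\<omega>. F (\<Phi> (\<Psi> \<omega>)) (\<alpha> \<omega>)) \<in> rvs Y"
        by (fastforce simp: o_def)
    qed
    with F show "F \<circ> \<Phi> \<in> rvs (X \<Rightarrow>\<^sub>Q Y)"
      unfolding qfun_def qus.simps mem_Collect_eq uncurry by (auto simp: qmeas_def)
  qed
qed

definition qus_quotient_map :: "'a qus \<Rightarrow> 'b qus \<Rightarrow> ('a \<Rightarrow> 'b) \<Rightarrow> bool" where
  "qus_quotient_map X Y f \<longleftrightarrow>
     f \<in> qmeas X Y \<and> f ` points X = points Y \<and> rvs Y = (\<lambda>\<alpha>. f \<circ> \<alpha>) ` rvs X"

definition induced_algebra :: "'a qus \<Rightarrow> 'a measure" where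
  "induced_algebra X =
     sigma (points X) {A. A \<subseteq> points X \<and> (\<forall>\<alpha>\<in>rvs X. \<alpha> -` A \<in> sets B_Omega)}"

lemma space_induced_algebra [simp]: "space (induced_algebra X) = points X"
  by (subst induced_algebra_def, rule space_measure_of) blast

lemma sets_induced_algebra:
  assumes "quasi_universal X"
  shows "sets (induced_algebra X) =
    {A. A \<subseteq> points X \<and> (\<forall>\<alpha>\<in>rvs X. \<alpha> -` A \<in> sets B_Omega)}" (is "_ = ?S")
proof -
  have "sigma_algebra (points X) ?S"
  proof (rule sigma_algebra_iff2[THEN iffD2], intro conjI)
    show "\<forall>s\<in>?S. points X - s \<in> ?S"
    proof clarsimp
      fix s \<alpha> assume s: "\<forall>\<alpha>\<in>rvs X. \<alpha> -` s \<in> sets B_Omega" and \<alpha>: "\<alpha> \<in> rvs X"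
      have "\<alpha> -` (points X - s) = space B_Omega - \<alpha> -` s"
        using quasi_universal_range[OF assms \<alpha>] by auto
      then show "\<alpha> -` (points X - s) \<in> sets B_Omega"
        using s \<alpha> by (simp only: sets.compl_sets)
    qed
    show "\<forall>A::nat \<Rightarrow> _. range A \<subseteq> ?S \<longrightarrow> (\<Union>i. A i) \<in> ?S"
    proof (intro allI impI)
      fix A :: "nat \<Rightarrow> 'a set" assume "range A \<subseteq> ?S"
      then have A: "A i \<in> ?S" for i by blast
      have "\<alpha> -` (\<Union>i. A i) \<in> sets B_Omega" if "\<alpha> \<in> rvs X" for \<alpha>
        unfolding vimage_UN by (rule sets.countable_UN) (use A that in blast)
      then show "(\<Union>i. A i) \<in> ?S" using A by blast
    qed
  qed auto
  moreover have "?S \<subseteq> Pow (points X)" by blast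
  ultimately show ?thesis
    by (simp add: induced_algebra_def sets_measure_of sigma_algebra.sigma_sets_eq)
qed

definition countably_separated :: "'a qus \<Rightarrow> bool" where
  "countably_separated X \<longleftrightarrow>
     (\<exists>\<E>. countable \<E> \<and> \<E> \<subseteq> sets (induced_algebra X) \<and>
        (\<forall>x\<in>points X. \<forall>y\<in>points X. x \<noteq> y \<longrightarrow> (\<exists>A\<in>\<E>. (x \<in> A) \<noteq> (y \<in> A))))"

definition standard_qus :: "'a qus \<Rightarrow> bool" where
  "standard_qus X \<longleftrightarrow> points X = {} \<or>
     (\<exists>i\<in>qmeas X Omega. \<exists>r\<in>qmeas Omega X. \<forall>x\<in>points X. r (i x) = x)"

definition discrete_qus :: "'a qus \<Rightarrow> bool" where
  "discrete_qus X \<longleftrightarrow>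
     countable (points X) \<and> rvs X = measurable B_Omega (count_space (points X))"


section \<open>Probability measures and Markov kernels\<close>

definition probs_Omega :: "hcube measure set" where
  "probs_Omega = {P. prob_space P \<and> sets P = sets B_Omega}"

definition qprob :: "'a qus \<Rightarrow> 'a measure qus" where
  "qprob X =
     \<lparr>points = {distr P (induced_algebra X) \<alpha> | P \<alpha>. P \<in> probs_Omega \<and> \<alpha> \<in> rvs X},
      rvs = {(\<lambda>\<omega>. distr P (induced_algebra X) (F \<omega>)) | P F.
               P \<in> probs_Omega \<and> F \<in> rvs (Omega \<Rightarrow>\<^sub>Q X)}\<rparr>"

lemma quasi_universal_qprob:
  assumes X: "quasi_universal X"
  shows "quasi_universal (qprob X)"
  unfolding quasi_universal_def
proof (intro conjI ballI)
  have qf: "quasi_universal (Omega \<Rightarrow>\<^sub>Q X)"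
    by (intro quasi_universal_qfun quasi_universal_Omega X)
  have pts: "points (Omega \<Rightarrow>\<^sub>Q X) = rvs X"
  proof (intro set_eqI iffI)
    fix g assume "g \<in> points (Omega \<Rightarrow>\<^sub>Q X)"
    then have "\<forall>\<alpha>\<in>measurable B_Omega B_Omega. g \<circ> \<alpha> \<in> rvs X"
      by (auto simp: qfun_def qmeas_def Omega_def)
    from bspec[OF this, of "\<lambda>x. x"] show "g \<in> rvs X" by (simp add: o_def)
  next
    fix g assume "g \<in> rvs X"
    then show "g \<in> points (Omega \<Rightarrow>\<^sub>Q X)"
      using X quasi_universal_range[OF X]
      by (auto simp: qfun_def qmeas_def Omega_def quasi_universal_def)
  qed
  show "rvs (qprob X) \<subseteq> UNIV \<rightarrow> points (qprob X)"
    using quasi_universal_range[OF qf] by (auto simp: qprob_def pts)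
  show "(\<lambda>_. \<mu>) \<in> rvs (qprob X)" if \<mu>: "\<mu> \<in> points (qprob X)" for \<mu>
  proof -
    obtain P \<alpha> where P: "P \<in> probs_Omega" and "\<alpha> \<in> rvs X"
      and eq: "\<mu> = distr P (induced_algebra X) \<alpha>"
      using \<mu> by (auto simp: qprob_def)
    then have "(\<lambda>_. \<alpha>) \<in> rvs (Omega \<Rightarrow>\<^sub>Q X)"
      using qf pts by (auto simp: quasi_universal_def)
    with P show ?thesis by (auto simp: qprob_def eq)
  qed
  show "K \<circ> \<Phi> \<in> rvs (qprob X)"
    if K: "K \<in> rvs (qprob X)" and \<Phi>: "\<Phi> \<in> measurable B_Omega B_Omega" for K \<Phi>
  proof -
    obtain P F where P: "P \<in> probs_Omega" and F: "F \<in> rvs (Omega \<Rightarrow>\<^sub>Q X)"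
      and eq: "K = (\<lambda>\<omega>. distr P (induced_algebra X) (F \<omega>))"
      using K by (auto simp: qprob_def)
    have "F \<circ> \<Phi> \<in> rvs (Omega \<Rightarrow>\<^sub>Q X)" using qf F \<Phi> by (auto simp: quasi_universal_def)
    moreover have "K \<circ> \<Phi> = (\<lambda>\<omega>. distr P (induced_algebra X) ((F \<circ> \<Phi>) \<omega>))"
      by (auto simp: eq o_def)
    ultimately show ?thesis using P unfolding qprob_def qus.simps by blast
  qed
qed

abbreviation markov_kernels :: "'z qus \<Rightarrow> 'a qus \<Rightarrow> ('z \<Rightarrow> 'a measure) qus" where
  "markov_kernels Z X \<equiv> Z \<Rightarrow>\<^sub>Q qprob X"

text \<open>
  Value at \<open>z\<close>: the measure \<open>D \<mapsto> \<integral> K({x. (x, y) \<in> D} | y, z) Q(dy | z)\<close>. Note that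
  \<open>measure_of\<close> yields the null measure where the given set function is not a measure.
\<close>

definition kernel_prod ::
  "'a qus \<Rightarrow> 'b qus \<Rightarrow> 'c qus \<Rightarrow>
    (('b \<times> 'c \<Rightarrow> 'a measure) \<times> ('c \<Rightarrow> 'b measure)) \<Rightarrow> ('c \<Rightarrow> ('a \<times> 'b) measure)" where
  "kernel_prod X Y Z =
     (\<lambda>(K, Q)\<in>points (markov_kernels (Y \<times>\<^sub>Q Z) X \<times>\<^sub>Q markov_kernels Z Y).
        \<lambda>z\<in>points Z.
          measure_of (points (X \<times>\<^sub>Q Y)) (sets (induced_algebra (X \<times>\<^sub>Q Y)))
            (\<lambda>D. \<integral>\<^sup>+ y. emeasure (K (y, z)) {x. (x, y) \<in> D} \<partial>Q z))"

definition kernel_marginal ::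
  "'b qus \<Rightarrow> 'c qus \<Rightarrow> ('c \<Rightarrow> ('a \<times> 'b) measure) \<Rightarrow> ('c \<Rightarrow> 'b measure)" where
  "kernel_marginal Y Z K = (\<lambda>z\<in>points Z. distr (K z) (induced_algebra Y) snd)"

definition disintegration_triple :: "'a qus \<Rightarrow> 'b qus \<Rightarrow> 'c qus \<Rightarrow> bool" where
  "disintegration_triple X Y Z \<longleftrightarrow>
     (\<forall>K\<in>points (markov_kernels Z (X \<times>\<^sub>Q Y)).
        \<exists>L\<in>points (markov_kernels (Y \<times>\<^sub>Q Z) X).
          K = kernel_prod X Y Z (L, kernel_marginal Y Z K))"

end

(*
  A random variable with values in P(X) has the form t |-> law of F(t, u) under a fixed law of u, and
  Omega x Omega is isomorphic to Omega, so every kernel question becomes one about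
  universally measurable maps on Omega.

  If X is standard it is a retract of [0,1], so take X = [0,1]. With a sequence separating the points of Y, generating
  finite partitions B_n(y), the conditional distribution function is
    f_q(y, z) = lim_n K(X <= q, Y in B_n(y) | z) / K(Y in B_n(y) | z),
  a formula that depends measurably on (y, z); the limit exists almost surely by martingale
  convergence. The quantile transform of f(y, z) turns it into a Markov kernel. It reproduces K on the
  sigma-algebra generated by the separating sequence; since probability measures on Omega are perfect
  (Lusin), it then does so on the whole induced sigma-algebra of X x Y, which may be much larger.

  If Z is standard, K(z) is the law of (F(z, u), G(z, u)) with F and G globally defined; disintegrate
  the law of (u, G(z, u)) and push forward along F. If Y is discrete, the conditional law given Y = y is
  elementary wherever {y} has positive mass, and the marginal on X serves elsewhere: gluing in an
  arbitrary constant may leave the admissible random variables.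

  Random variables of kernels on Z are kernels on Omega x Z, which satisfies the same hypotheses as Z;
  disintegrating them gives the quotient property.
*)

theory Submission
  imports Defs
begin

section \<open>The sample space\<close>

text \<open>Two sigma-algebras compete: random variables are measurable for \<open>B_Omega\<close>,
  while product measures, codings and compactness speak about \<open>hcube_borel\<close>. The bridge
  is a sandwich between Borel sets with null difference; it depends on the measure, so a measure is
  always fixed before passing from one to the other. A kernel must be admissible along every random
  variable of its arguments, so conditional laws picked for each z separately do not suffice. Each
  case starts from one expression valid for all z: a limit of ratios, a representation of K carried
  by all of Omega, or an elementary conditional law. In the discrete case Z may have no global
  parametrisation, and the elementary law must still be shown to be an admissible random measure on
  X. This comes from conditioning the randomness instead of X: the first case, with Omega in the
  place of X and Z, gives a kernel for u given y, and its push-forward agrees with the elementary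
  law wherever y has positive mass. Thus the other two cases both rest on the first.\<close>

lemma space_hcube_borel [simp]: "space hcube_borel = UNIV"
  by (simp add: hcube_borel_def)

lemma hcube_nth_mem: "hcube_nth x i \<in> {0..1}"
  using hcube_nth[of x] by auto

lemma hcube_eqI: "(\<And>i. hcube_nth x i = hcube_nth y i) \<Longrightarrow> x = y"
  by (simp add: hcube_nth_inject[symmetric] fun_eq_iff)

lemma hcube_nth_Abs: "(\<And>i. f i \<in> {0..1}) \<Longrightarrow> hcube_nth (Abs_hcube f) i = f i"
  by (subst Abs_hcube_inverse) auto

lemma measurable_hcube_nth: "hcube_nth \<in> hcube_borel \<rightarrow>\<^sub>M borel"
  unfolding hcube_borel_def by (rule measurable_vimage_algebra1) auto

lemma measurable_hcube_nth_coord: "(\<lambda>x. hcube_nth x i) \<in> borel_measurable hcube_borel"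
  by (rule measurable_product_then_coordinatewise[OF measurable_hcube_nth])

lemma measurable_into_hcube_borel:
  assumes "\<And>i. (\<lambda>x. hcube_nth (f x) i) \<in> borel_measurable M"
  shows "f \<in> M \<rightarrow>\<^sub>M hcube_borel"
  unfolding hcube_borel_def
  by (rule measurable_vimage_algebra2)
    (auto intro!: measurable_coordinatewise_then_product assms)

lemma sets_hcube_borel_le: "A \<in> sets hcube_borel \<Longrightarrow> A \<in> sets B_Omega"
  by (auto simp: sets_B_Omega universally_measurable_def)

lemma measurable_id_B_Omega_borel: "(\<lambda>x. x) \<in> B_Omega \<rightarrow>\<^sub>M hcube_borel"
  by (rule measurableI) (auto intro: sets_hcube_borel_le)

lemma measurable_hcube_borel_imp_B_Omega:
  "f \<in> hcube_borel \<rightarrow>\<^sub>M N \<Longrightarrow> f \<in> B_Omega \<rightarrow>\<^sub>M N"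
  using measurable_comp[OF measurable_id_B_Omega_borel] by (simp add: o_def)

section \<open>Universally measurable sets between Borel bounds\<close>

lemma probs_OmegaD:
  assumes "P \<in> probs_Omega"
  shows "prob_space P" "sets P = sets B_Omega" "space P = UNIV"
  using assms sets_eq_imp_space_eq[of P B_Omega] by (auto simp: probs_Omega_def)

lemma measurable_probs_Omega: "P \<in> probs_Omega \<Longrightarrow> measurable P N = measurable B_Omega N"
  by (rule measurable_cong_sets) (simp_all add: probs_OmegaD)

text \<open>Universal measurability is applied to the restriction of P to the Borel sets: A lies in
  its completion, hence differs from a Borel set inside a Borel null set. The bounds depend on
  P.\<close>

lemma probs_Omega_sandwich:
  assumes P: "P \<in> probs_Omega" and A: "A \<in> sets B_Omega"
  obtains B1 B2 where "B1 \<in> sets hcube_borel" "B2 \<in> sets hcube_borel" "B1 \<subseteq> A" "A \<subseteq> B2"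
    "emeasure P (B2 - B1) = 0"
proof -
  note [simp] = probs_OmegaD[OF P]
  have m: "(\<lambda>x. x) \<in> P \<rightarrow>\<^sub>M hcube_borel"
    by (simp add: measurable_probs_Omega[OF P] measurable_id_B_Omega_borel)
  define \<mu> where "\<mu> = distr P hcube_borel (\<lambda>x. x)"
  have "prob_space \<mu>" "sets \<mu> = sets hcube_borel"
    unfolding \<mu>_def by (auto intro!: prob_space.prob_space_distr m)
  with A have "A \<in> sets (completion \<mu>)"
    by (auto simp: sets_B_Omega universally_measurable_def)
  then obtain S N N' where N: "A = S \<union> N" "N \<subseteq> N'" "N' \<in> null_sets \<mu>" "S \<in> sets \<mu>"
    by (rule sets_completionE)
  have "emeasure P N' = 0"
    using N(3) by (auto simp: \<mu>_def null_sets_def emeasure_distr[OF m])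
  moreover have "S \<in> sets hcube_borel" "N' \<in> sets hcube_borel"
    using N by (auto simp: \<mu>_def)
  moreover have "emeasure P (S \<union> N' - S) \<le> emeasure P N'"
    by (rule emeasure_mono) (auto simp: \<open>N' \<in> sets hcube_borel\<close> sets_hcube_borel_le)
  ultimately show ?thesis
    using N that[of S "S \<union> N'"] by auto
qed

text \<open>The extension is the completion of \<mu> restricted to \<open>B_Omega\<close>. The
  comparison with the completion belongs to the conclusion because it carries null sets of P back to
  \<mu>, as \<open>sets_B_Omega_sandwichI\<close> requires.\<close>

lemma probs_Omega_completion:
  assumes \<mu>: "prob_space \<mu>" "sets \<mu> = sets hcube_borel"
  obtains P where "P \<in> probs_Omega" "\<forall>B\<in>sets hcube_borel. emeasure P B = emeasure \<mu> B"
    "\<forall>A\<in>sets B_Omega. A \<in> sets (completion \<mu>) \<and> emeasure P A = emeasure (completion \<mu>) A"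
proof -
  interpret prob_space \<mu> by fact
  have sp: "space \<mu> = UNIV" using sets_eq_imp_space_eq[OF \<mu>(2)] by simp
  have A: "A \<in> sets (completion \<mu>)" if "A \<in> sets B_Omega" for A
    using that \<mu> by (auto simp: sets_B_Omega universally_measurable_def)
  have m: "(\<lambda>x. x) \<in> completion \<mu> \<rightarrow>\<^sub>M B_Omega"
    by (rule measurableI) (auto simp: A sp)
  have c: "prob_space (completion \<mu>)" 
    by (rule prob_spaceI) (simp add: emeasure_space_1)
  define P where "P = distr (completion \<mu>) B_Omega (\<lambda>x. x)"
  have 1: "P \<in> probs_Omega"
    by (auto simp: P_def probs_Omega_def intro!: prob_space.prob_space_distr c m)
  have 2: "emeasure P A = emeasure (completion \<mu>) A" if "A \<in> sets B_Omega" for A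
    unfolding P_def using that by (subst emeasure_distr[OF m]) (auto simp: sp)
  show ?thesis
  proof (rule that[OF 1])
    show "\<forall>B\<in>sets hcube_borel. emeasure P B = emeasure \<mu> B"
      by (simp add: 2 sets_hcube_borel_le \<mu>)
    show "\<forall>A\<in>sets B_Omega. A \<in> sets (completion \<mu>) \<and> emeasure P A = emeasure (completion \<mu>) A"
      using A 2 by (intro ballI conjI)
  qed
qed

lemma probs_Omega_extension:
  assumes "prob_space \<mu>" "sets \<mu> = sets hcube_borel"
  obtains P where "P \<in> probs_Omega" "\<forall>B\<in>sets hcube_borel. emeasure P B = emeasure \<mu> B"
proof -
  obtain P where P: "P \<in> probs_Omega" "\<forall>B\<in>sets hcube_borel. emeasure P B = emeasure \<mu> B"
    "\<forall>A\<in>sets B_Omega. A \<in> sets (completion \<mu>) \<and> emeasure P A = emeasure (completion \<mu>) A"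
    by (rule probs_Omega_completion[OF assms])
  show ?thesis by (rule that[OF P(1,2)])
qed

text \<open>Converse of \<open>probs_Omega_sandwich\<close>. The bounds may be universally
  measurable instead of Borel, because a set caught between them differs from the lower one inside a
  null set of the completion.\<close>

lemma sets_B_Omega_sandwichI:
  assumes "\<And>P. P \<in> probs_Omega \<Longrightarrow>
    \<exists>B1\<in>sets B_Omega. \<exists>B2\<in>sets B_Omega. B1 \<subseteq> A \<and> A \<subseteq> B2 \<and> emeasure P (B2 - B1) = 0"
  shows "A \<in> sets B_Omega"
  unfolding sets_B_Omega universally_measurable_def mem_Collect_eq
proof (intro allI impI)
  fix \<mu> :: "hcube measure" assume "prob_space \<mu> \<and> sets \<mu> = sets hcube_borel"
  then obtain P where P: "P \<in> probs_Omega"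
    and e: "\<forall>A\<in>sets B_Omega. A \<in> sets (completion \<mu>) \<and> emeasure P A = emeasure (completion \<mu>) A"
    by (elim conjE) (rule probs_Omega_completion)
  from assms[OF P] obtain B1 B2 where B: "B1 \<in> sets B_Omega" "B2 \<in> sets B_Omega" "B1 \<subseteq> A" "A \<subseteq> B2"
    and n: "emeasure P (B2 - B1) = 0" by blast
  have "B2 - B1 \<in> null_sets (completion \<mu>)"
    using bspec[OF e sets.Diff[OF B(2,1)]] n by (intro null_setsI) (simp_all only:)
  then have "A - B1 \<in> sets (completion \<mu>)"
    using null_sets_completion_subset[of "A - B1" "B2 - B1" \<mu>] B unfolding null_sets_def by blast
  moreover have "A = B1 \<union> (A - B1)" using B by auto
  ultimately show "A \<in> sets (completion \<mu>)"
    using bspec[OF e B(1)] by (metis sets.Un)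
qed

text \<open>Testing on Borel sets suffices: A is sandwiched with respect to the law of f under P,
  and the preimages of the bounds sandwich the preimage of A with respect to P. Hence Borel
  constructions with universally measurable inputs stay inside \<open>rvs Omega\<close>.\<close>

lemma measurable_B_Omega_B_Omega:
  assumes f: "f \<in> B_Omega \<rightarrow>\<^sub>M hcube_borel"
  shows "f \<in> B_Omega \<rightarrow>\<^sub>M B_Omega"
proof (rule measurableI)
  fix A assume A: "A \<in> sets B_Omega"
  have "f -` A \<in> sets B_Omega"
  proof (rule sets_B_Omega_sandwichI)
    fix P assume P: "P \<in> probs_Omega"
    have fP: "f \<in> P \<rightarrow>\<^sub>M hcube_borel" using f by (simp add: measurable_probs_Omega[OF P])
    obtain R where R: "R \<in> probs_Omega"
      "\<forall>B\<in>sets hcube_borel. emeasure R B = emeasure (distr P hcube_borel f) B"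
      using prob_space.prob_space_distr[OF probs_OmegaD(1)[OF P] fP]
      by (rule probs_Omega_extension[of "distr P hcube_borel f"]) (rule sets_distr)
    obtain B1 B2 where B: "B1 \<in> sets hcube_borel" "B2 \<in> sets hcube_borel" "B1 \<subseteq> A" "A \<subseteq> B2"
      "emeasure R (B2 - B1) = 0" by (rule probs_Omega_sandwich[OF R(1) A])
    have "f -` B1 \<in> sets B_Omega" "f -` B2 \<in> sets B_Omega"
      using measurable_sets[OF f B(1)] measurable_sets[OF f B(2)] by auto
    moreover have "emeasure P (f -` B2 - f -` B1) = 0"
      using B(5) bspec[OF R(2), of "B2 - B1"] B(1,2)
      by (simp add: emeasure_distr[OF fP] probs_OmegaD[OF P] vimage_Diff)
    ultimately show "\<exists>B1\<in>sets B_Omega. \<exists>B2\<in>sets B_Omega.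
        B1 \<subseteq> f -` A \<and> f -` A \<subseteq> B2 \<and> emeasure P (B2 - B1) = 0"
      using B by (intro bexI[of _ "f -` B1"] bexI[of _ "f -` B2"]) auto
  qed
  then show "f -` A \<inter> space B_Omega \<in> sets B_Omega" by simp
qed simp

text \<open>The superlevel sets of g lie between those of \<open>g1\<close> and \<open>g2\<close>,
  which differ by a null set.\<close>

lemma borel_measurable_B_Omega_sandwichI:
  fixes g :: "hcube \<Rightarrow> ennreal"
  assumes "\<And>P. P \<in> probs_Omega \<Longrightarrow> \<exists>g1\<in>borel_measurable B_Omega. \<exists>g2\<in>borel_measurable B_Omega.
    (\<forall>x. g1 x \<le> g x \<and> g x \<le> g2 x) \<and> (AE x in P. g1 x = g2 x)"
  shows "g \<in> borel_measurable B_Omega"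
proof (rule borel_measurableI_greater)
  fix y
  have "{x. y < g x} \<in> sets B_Omega"
  proof (rule sets_B_Omega_sandwichI)
    fix P assume P: "P \<in> probs_Omega"
    obtain g1 g2 where g: "g1\<in>borel_measurable B_Omega" "g2\<in>borel_measurable B_Omega"
      "\<And>x. g1 x \<le> g x" "\<And>x. g x \<le> g2 x" "AE x in P. g1 x = g2 x" using assms[OF P] by blast
    have 1: "{x. y < g1 x} \<in> sets B_Omega" "{x. y < g2 x} \<in> sets B_Omega"
      using borel_measurable_less[OF borel_measurable_const g(1), of y]
        borel_measurable_less[OF borel_measurable_const g(2), of y] by auto
    then have "emeasure P ({x. y < g2 x} - {x. y < g1 x}) = 0"
      using g(5) by (subst AE_iff_measurable[symmetric, where P="\<lambda>x. \<not> (y < g2 x \<and> \<not> y < g1 x)"])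
        (auto simp: probs_OmegaD[OF P])
    then show "\<exists>B1\<in>sets B_Omega. \<exists>B2\<in>sets B_Omega.
        B1 \<subseteq> {x. y < g x} \<and> {x. y < g x} \<subseteq> B2 \<and> emeasure P (B2 - B1) = 0"
      using g(3,4) 1 by (intro bexI[of _ "{x. y < g1 x}"] bexI[of _ "{x. y < g2 x}"])
        (auto intro: less_le_trans)
  qed
  then show "{x \<in> space B_Omega. y < g x} \<in> sets B_Omega" by simp
qed

section \<open>Coding two sample points in one; sections and products of measures\<close>

definition hpair :: "hcube \<Rightarrow> hcube \<Rightarrow> hcube" where
  "hpair a b = Abs_hcube (\<lambda>i. if even i then hcube_nth a (i div 2) else hcube_nth b (i div 2))"

definition hfst :: "hcube \<Rightarrow> hcube" where
  "hfst w = Abs_hcube (\<lambda>i. hcube_nth w (2 * i))"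

definition hsnd :: "hcube \<Rightarrow> hcube" where
  "hsnd w = Abs_hcube (\<lambda>i. hcube_nth w (2 * i + 1))"

lemma hcube_nth_hpair:
  "hcube_nth (hpair a b) i = (if even i then hcube_nth a (i div 2) else hcube_nth b (i div 2))"
  unfolding hpair_def using hcube_nth_mem by (subst hcube_nth_Abs) auto

lemma hcube_nth_hfst: "hcube_nth (hfst w) i = hcube_nth w (2 * i)"
  unfolding hfst_def using hcube_nth_mem by (subst hcube_nth_Abs) auto

lemma hcube_nth_hsnd: "hcube_nth (hsnd w) i = hcube_nth w (2 * i + 1)"
  unfolding hsnd_def using hcube_nth_mem by (subst hcube_nth_Abs) auto

lemma hfst_hpair [simp]: "hfst (hpair a b) = a"
  by (rule hcube_eqI) (simp add: hcube_nth_hfst hcube_nth_hpair)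

lemma hsnd_hpair [simp]: "hsnd (hpair a b) = b"
  by (rule hcube_eqI) (simp add: hcube_nth_hsnd hcube_nth_hpair)

lemma hpair_hfst_hsnd [simp]: "hpair (hfst w) (hsnd w) = w"
  by (rule hcube_eqI) (auto simp: hcube_nth_hfst hcube_nth_hsnd hcube_nth_hpair)

lemma measurable_hpair_borel:
  assumes "f \<in> M \<rightarrow>\<^sub>M hcube_borel" "g \<in> M \<rightarrow>\<^sub>M hcube_borel"
  shows "(\<lambda>x. hpair (f x) (g x)) \<in> M \<rightarrow>\<^sub>M hcube_borel"
proof (rule measurable_into_hcube_borel)
  fix i
  show "(\<lambda>x. hcube_nth (hpair (f x) (g x)) i) \<in> borel_measurable M"
    using measurable_compose[OF assms(1) measurable_hcube_nth_coord]
      measurable_compose[OF assms(2) measurable_hcube_nth_coord]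
    by (cases "even i") (auto simp: hcube_nth_hpair)
qed

lemma measurable_B_Omega_imp_borel: "f \<in> M \<rightarrow>\<^sub>M B_Omega \<Longrightarrow> f \<in> M \<rightarrow>\<^sub>M hcube_borel"
  by (drule measurable_compose[OF _ measurable_id_B_Omega_borel]) simp

lemma measurable_hpair [measurable (raw)]:
  assumes "f \<in> B_Omega \<rightarrow>\<^sub>M B_Omega" "g \<in> B_Omega \<rightarrow>\<^sub>M B_Omega"
  shows "(\<lambda>x. hpair (f x) (g x)) \<in> B_Omega \<rightarrow>\<^sub>M B_Omega"
  by (rule measurable_B_Omega_B_Omega[OF measurable_hpair_borel[OF assms[THEN measurable_B_Omega_imp_borel]]])

lemma measurable_hfst [measurable]: "hfst \<in> B_Omega \<rightarrow>\<^sub>M B_Omega"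
  by (intro measurable_B_Omega_B_Omega measurable_hcube_borel_imp_B_Omega measurable_into_hcube_borel)
    (simp add: hcube_nth_hfst measurable_hcube_nth_coord)

lemma measurable_hsnd [measurable]: "hsnd \<in> B_Omega \<rightarrow>\<^sub>M B_Omega"
  by (intro measurable_B_Omega_B_Omega measurable_hcube_borel_imp_B_Omega measurable_into_hcube_borel)
    (simp add: hcube_nth_hsnd measurable_hcube_nth_coord)

lemma measurable_hpair_pair: "(\<lambda>(a, b). hpair a b) \<in> B_Omega \<Otimes>\<^sub>M B_Omega \<rightarrow>\<^sub>M hcube_borel"
  unfolding case_prod_beta
  by (intro measurable_hpair_borel measurable_compose[OF _ measurable_id_B_Omega_borel]
      measurable_fst measurable_snd)

text \<open>For Borel A this is the measurability part of Fubini's theorem. For general A and a law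
  P' of the parameter, A is sandwiched for the law of \<open>hpair\<close> under the product of P'
  and P; the section measures of the gap integrate to 0, so the sections of the two bounds have
  equal measure for P'-almost every a.\<close>

lemma measurable_emeasure_hpair:
  assumes P: "P \<in> probs_Omega" and A: "A \<in> sets B_Omega"
  shows "(\<lambda>a. emeasure P (hpair a -` A)) \<in> borel_measurable B_Omega"
proof -
  note [simp] = probs_OmegaD[OF P]
  interpret PP: prob_space P by (rule probs_OmegaD(1)[OF P])
  have hp: "(\<lambda>(a, b). hpair a b) \<in> M \<Otimes>\<^sub>M P \<rightarrow>\<^sub>M hcube_borel" if "sets M = sets B_Omega" for M
  proof -
    have "sets (M \<Otimes>\<^sub>M P) = sets (B_Omega \<Otimes>\<^sub>M B_Omega)"
      using that by (intro sets_pair_measure_cong) auto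
    then show ?thesis
      by (subst measurable_cong_sets[OF _ refl]) (auto intro: measurable_hpair_pair)
  qed
  have borel: "(\<lambda>a. emeasure P (hpair a -` B)) \<in> borel_measurable B_Omega"
    if "B \<in> sets hcube_borel" for B
  proof -
    have "(\<lambda>(a, b). hpair a b) -` B \<inter> space (B_Omega \<Otimes>\<^sub>M P) \<in> sets (B_Omega \<Otimes>\<^sub>M P)"
      using hp[OF refl] that by (rule measurable_sets)
    from PP.measurable_emeasure_Pair[OF this] show ?thesis
      by (simp add: vimage_def space_pair_measure)
  qed
  have m1: "hpair a -` B \<in> sets B_Omega" if "B \<in> sets B_Omega" for a B
    using measurable_sets[OF measurable_hpair[OF measurable_const measurable_ident] that, of a] by simp
  show ?thesis
  proof (rule borel_measurable_B_Omega_sandwichI)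
    fix P' assume P': "P' \<in> probs_Omega"
    note [simp] = probs_OmegaD[OF P']
    interpret PP': prob_space P' by simp
    interpret PQ: pair_prob_space P' P ..
    let ?R = "distr (P' \<Otimes>\<^sub>M P) hcube_borel (\<lambda>(a, b). hpair a b)"
    have hp': "(\<lambda>(a, b). hpair a b) \<in> P' \<Otimes>\<^sub>M P \<rightarrow>\<^sub>M hcube_borel" by (rule hp) simp
    obtain R where R: "R \<in> probs_Omega"
      "\<forall>B\<in>sets hcube_borel. emeasure R B = emeasure ?R B"
      using PQ.prob_space_distr[OF hp'] by (rule probs_Omega_extension[of ?R]) (rule sets_distr)
    obtain B1 B2 where B: "B1 \<in> sets hcube_borel" "B2 \<in> sets hcube_borel" "B1 \<subseteq> A" "A \<subseteq> B2"
      "emeasure R (B2 - B1) = 0" by (rule probs_Omega_sandwich[OF R(1) A])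
    have B': "B1 \<in> sets B_Omega" "B2 \<in> sets B_Omega" using B by (auto intro: sets_hcube_borel_le)
    have s: "(\<lambda>(a, b). hpair a b) -` (B2 - B1) \<inter> space (P' \<Otimes>\<^sub>M P) \<in> sets (P' \<Otimes>\<^sub>M P)"
      by (rule measurable_sets[OF hp']) (use B in auto)
    have "0 = emeasure ?R (B2 - B1)" unfolding bspec[OF R(2) sets.Diff[OF B(2,1)], symmetric] by (rule B(5)[symmetric])
    also have "\<dots> = emeasure (P' \<Otimes>\<^sub>M P) ((\<lambda>(a, b). hpair a b) -` (B2 - B1) \<inter> space (P' \<Otimes>\<^sub>M P))"
      by (rule emeasure_distr[OF hp' sets.Diff[OF B(2,1)]])
    also have "\<dots> = (\<integral>\<^sup>+ a. emeasure P (hpair a -` (B2 - B1)) \<partial>P')"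
      unfolding PP.emeasure_pair_measure_alt[OF s]
      by (intro nn_integral_cong arg_cong[where f="emeasure P"]) (auto simp: space_pair_measure)
    finally have "(\<integral>\<^sup>+ a. emeasure P (hpair a -` (B2 - B1)) \<partial>P') = 0" by (rule sym)
    moreover have "(\<lambda>a. emeasure P (hpair a -` (B2 - B1))) \<in> borel_measurable P'"
      unfolding measurable_probs_Omega[OF P'] by (rule borel[OF sets.Diff[OF B(2,1)]])
    ultimately have "AE a in P'. emeasure P (hpair a -` (B2 - B1)) = 0"
      by (simp only: nn_integral_0_iff_AE)
    then have "AE a in P'. emeasure P (hpair a -` B1) = emeasure P (hpair a -` B2)"
    proof eventually_elim
      case (elim a)
      have "hpair a -` B2 = hpair a -` B1 \<union> hpair a -` (B2 - B1)" using B(3,4) by blast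
      moreover have "emeasure P (hpair a -` B1) + emeasure P (hpair a -` (B2 - B1)) =
          emeasure P (hpair a -` B1 \<union> hpair a -` (B2 - B1))"
        by (rule plus_emeasure) (simp_all add: m1 B' sets.Diff, blast)
      ultimately show ?case using elim by simp
    qed
    then show "\<exists>g1\<in>borel_measurable B_Omega. \<exists>g2\<in>borel_measurable B_Omega.
      (\<forall>x. g1 x \<le> emeasure P (hpair x -` A) \<and> emeasure P (hpair x -` A) \<le> g2 x) \<and>
      (AE x in P'. g1 x = g2 x)"
      using B(3,4)
      by (intro bexI[OF _ borel[OF B(1)]] bexI[OF _ borel[OF B(2)]] conjI allI
          emeasure_mono vimage_mono) (simp_all add: m1 A B')
  qed
qed

lemma measurable_hpair1: "hpair a \<in> B_Omega \<rightarrow>\<^sub>M B_Omega"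
  using measurable_hpair[OF measurable_const measurable_ident, of a] by simp

text \<open>The product measure transported to Omega. It is built as a \<open>bind\<close> of laws
  on \<open>B_Omega\<close>, since on the product sigma-algebra \<open>hpair\<close> is shown to be
  measurable only into the Borel sets.\<close>

definition hprod :: "hcube measure \<Rightarrow> hcube measure \<Rightarrow> hcube measure" where
  "hprod P Q = P \<bind> (\<lambda>a. distr Q B_Omega (hpair a))"

lemma
  assumes P: "P \<in> probs_Omega" and Q: "Q \<in> probs_Omega"
  shows hprod_probs_Omega: "hprod P Q \<in> probs_Omega"
    and emeasure_hprod:
      "A \<in> sets B_Omega \<Longrightarrow> emeasure (hprod P Q) A = (\<integral>\<^sup>+ a. emeasure Q (hpair a -` A) \<partial>P)"
proof -
  note [simp] = probs_OmegaD[OF P] probs_OmegaD[OF Q]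
  have mQ: "hpair a \<in> Q \<rightarrow>\<^sub>M B_Omega" for a
    by (simp add: measurable_probs_Omega[OF Q] measurable_hpair1)
  have pr: "prob_space (distr Q B_Omega (hpair a))" for a
    by (intro prob_space.prob_space_distr mQ) simp
  have k: "(\<lambda>a. distr Q B_Omega (hpair a)) \<in> B_Omega \<rightarrow>\<^sub>M prob_algebra B_Omega"
  proof (intro measurable_prob_algebraI measurable_subprob_algebra pr)
    fix A assume "A \<in> sets B_Omega"
    then show "(\<lambda>a. emeasure (distr Q B_Omega (hpair a)) A) \<in> borel_measurable B_Omega"
      using measurable_emeasure_hpair[OF Q] by (simp add: emeasure_distr[OF mQ])
  qed (auto intro: prob_space_imp_subprob_space pr)
  have "P \<in> space (prob_algebra B_Omega)" by (simp add: space_prob_algebra)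
  then show "emeasure (hprod P Q) A = (\<integral>\<^sup>+ a. emeasure Q (hpair a -` A) \<partial>P)"
    if "A \<in> sets B_Omega" for A
    unfolding hprod_def using that by (simp add: emeasure_bind_prob_algebra[OF _ k] emeasure_distr[OF mQ])
  show "hprod P Q \<in> probs_Omega"
    unfolding hprod_def probs_Omega_def mem_Collect_eq
  proof
    show "prob_space (P \<bind> (\<lambda>a. distr Q B_Omega (hpair a)))"
      by (rule prob_space_bind'[OF \<open>P \<in> space (prob_algebra B_Omega)\<close> k])
    show "sets (P \<bind> (\<lambda>a. distr Q B_Omega (hpair a))) = sets B_Omega"
      by (rule sets_bind') (use \<open>P \<in> space (prob_algebra B_Omega)\<close> k in auto)
  qed
qed

section \<open>Kernels between quasi-universal spaces\<close>

notation induced_algebra ("\<B>")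

lemma rvs_Omega: "rvs Omega = B_Omega \<rightarrow>\<^sub>M B_Omega"
  and points_Omega: "points Omega = UNIV"
  by (simp_all add: Omega_def)

lemma points_qprod: "points (X \<times>\<^sub>Q Y) = points X \<times> points Y"
  by (simp add: qprod_def)

lemma rvs_qprod_iff:
  "\<gamma> \<in> rvs (X \<times>\<^sub>Q Y) \<longleftrightarrow> (\<lambda>t. fst (\<gamma> t)) \<in> rvs X \<and> (\<lambda>t. snd (\<gamma> t)) \<in> rvs Y"
  by (simp add: qprod_def o_def)

lemma rvs_PairI: "\<alpha> \<in> rvs X \<Longrightarrow> \<beta> \<in> rvs Y \<Longrightarrow> (\<lambda>t. (\<alpha> t, \<beta> t)) \<in> rvs (X \<times>\<^sub>Q Y)"
  by (simp add: rvs_qprod_iff)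

lemma rvs_compose:
  "quasi_universal X \<Longrightarrow> \<alpha> \<in> rvs X \<Longrightarrow> \<Phi> \<in> B_Omega \<rightarrow>\<^sub>M B_Omega \<Longrightarrow> (\<lambda>t. \<alpha> (\<Phi> t)) \<in> rvs X"
  unfolding quasi_universal_def o_def by blast

lemma rvs_const: "quasi_universal X \<Longrightarrow> x \<in> points X \<Longrightarrow> (\<lambda>_. x) \<in> rvs X"
  unfolding quasi_universal_def by blast

lemma qmeasD: "g \<in> qmeas X Y \<Longrightarrow> \<alpha> \<in> rvs X \<Longrightarrow> (\<lambda>t. g (\<alpha> t)) \<in> rvs Y"
  by (simp add: qmeas_def o_def)

lemma qmeas_points: "g \<in> qmeas X Y \<Longrightarrow> x \<in> points X \<Longrightarrow> g x \<in> points Y"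
  by (auto simp: qmeas_def)

text \<open>Membership of the values in \<open>points Y\<close> follows from the condition on random
  variables, applied to constant ones.\<close>

lemma qmeasI:
  assumes X: "quasi_universal X" and Y: "quasi_universal Y" and g: "g \<in> extensional (points X)"
    and "\<And>\<alpha>. \<alpha> \<in> rvs X \<Longrightarrow> (\<lambda>t. g (\<alpha> t)) \<in> rvs Y"
  shows "g \<in> qmeas X Y"
proof -
  have "g x \<in> points Y" if "x \<in> points X" for x
    using quasi_universal_range[OF Y assms(4)[OF rvs_const[OF X that]]] .
  with assms show ?thesis by (auto simp: qmeas_def o_def PiE_iff)
qed

lemma sets_induced_algebra_iff:
  "quasi_universal X \<Longrightarrow> A \<in> sets (\<B> X) \<longleftrightarrow>
    A \<subseteq> points X \<and> (\<forall>\<alpha>\<in>rvs X. {t. \<alpha> t \<in> A} \<in> sets B_Omega)"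
  by (simp add: sets_induced_algebra vimage_def)

lemma sets_induced_algebra_vimage:
  assumes X: "quasi_universal X" and Y: "quasi_universal Y" and D: "D \<in> sets (\<B> Y)"
    and g: "\<And>\<alpha>. \<alpha> \<in> rvs X \<Longrightarrow> (\<lambda>t. g (\<alpha> t)) \<in> rvs Y"
  shows "{x \<in> points X. g x \<in> D} \<in> sets (\<B> X)"
  using D g quasi_universal_range[OF X]
  by (auto simp: sets_induced_algebra_iff[OF X] sets_induced_algebra_iff[OF Y])

lemma measurable_rvs:
  "quasi_universal X \<Longrightarrow> \<alpha> \<in> rvs X \<Longrightarrow> \<alpha> \<in> B_Omega \<rightarrow>\<^sub>M \<B> X"
  by (rule measurableI) (auto simp: sets_induced_algebra quasi_universal_range)

lemma measurable_induced_algebraI: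
  assumes X: "quasi_universal X" and "\<And>x. x \<in> points X \<Longrightarrow> g x \<in> space N"
    and g: "\<And>\<alpha>. \<alpha> \<in> rvs X \<Longrightarrow> (\<lambda>t. g (\<alpha> t)) \<in> B_Omega \<rightarrow>\<^sub>M N"
  shows "g \<in> \<B> X \<rightarrow>\<^sub>M N"
proof (rule measurableI)
  fix A assume A: "A \<in> sets N"
  have "{t. \<alpha> t \<in> g -` A \<inter> points X} \<in> sets B_Omega" if "\<alpha> \<in> rvs X" for \<alpha>
    using measurable_sets[OF g[OF that] A] quasi_universal_range[OF X that]
    by (simp add: vimage_def)
  then show "g -` A \<inter> space (\<B> X) \<in> sets (\<B> X)"
    by (simp add: sets_induced_algebra_iff[OF X])
qed (use assms in auto)

lemma section_fst_sets:
  assumes X: "quasi_universal X" and Y: "quasi_universal Y"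
    and D: "D \<in> sets (\<B> (X \<times>\<^sub>Q Y))" and y: "y \<in> points Y"
  shows "{x. (x, y) \<in> D} \<in> sets (\<B> X)"
proof -
  have "{x \<in> points X. (x, y) \<in> D} \<in> sets (\<B> X)"
    by (intro sets_induced_algebra_vimage[OF X quasi_universal_qprod[OF X Y] D] rvs_PairI
        rvs_const[OF Y y])
  moreover have "D \<subseteq> points X \<times> points Y"
    using sets.sets_into_space[OF D] by (simp add: points_qprod)
  ultimately show ?thesis by (auto elim!: back_subst[of "\<lambda>A. A \<in> _"])
qed

lemma sets_rv_vimage:
  assumes "quasi_universal X" "\<alpha> \<in> rvs X" "D \<in> sets (\<B> X)"
  shows "{t. \<alpha> t \<in> D} \<in> sets B_Omega"
  using assms by (simp add: sets_induced_algebra_iff)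

lemma distr_rv:
  assumes X: "quasi_universal X" and P: "P \<in> probs_Omega" and \<alpha>: "\<alpha> \<in> rvs X"
  shows "prob_space (distr P (\<B> X) \<alpha>)"
    and "A \<in> sets (\<B> X) \<Longrightarrow> emeasure (distr P (\<B> X) \<alpha>) A = emeasure P {t. \<alpha> t \<in> A}"
proof -
  have m: "\<alpha> \<in> P \<rightarrow>\<^sub>M \<B> X"
    using measurable_rvs[OF X \<alpha>] by (simp add: measurable_probs_Omega[OF P])
  show "prob_space (distr P (\<B> X) \<alpha>)"
    by (intro prob_space.prob_space_distr m probs_OmegaD P)
  show "A \<in> sets (\<B> X) \<Longrightarrow> emeasure (distr P (\<B> X) \<alpha>) A = emeasure P {t. \<alpha> t \<in> A}"
    by (simp add: emeasure_distr[OF m] probs_OmegaD[OF P] vimage_def)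
qed

lemma points_qprobE:
  assumes "\<mu> \<in> points (qprob X)"
  obtains P \<alpha> where "P \<in> probs_Omega" "\<alpha> \<in> rvs X" "\<mu> = distr P (\<B> X) \<alpha>"
  using assms by (auto simp: qprob_def)

lemma rvs_hpair:
  "quasi_universal X \<Longrightarrow> \<alpha> \<in> rvs X \<Longrightarrow> (\<lambda>u. \<alpha> (hpair t u)) \<in> rvs X"
  by (rule rvs_compose) (auto intro: measurable_hpair1)

text \<open>Uncurrying through \<open>hpair\<close> turns a random variable of random variables into
  a single random variable \<alpha>. The law P is the same for all t; the whole dependence on t sits
  in \<alpha>.\<close>

lemma rvs_qprob_iff:
  assumes X: "quasi_universal X"
  shows "K \<in> rvs (qprob X) \<longleftrightarrow> (\<exists>P\<in>probs_Omega. \<exists>\<alpha>\<in>rvs X.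
    K = (\<lambda>t. distr P (\<B> X) (\<lambda>u. \<alpha> (hpair t u))))" (is "_ \<longleftrightarrow> ?R")
proof
  assume "K \<in> rvs (qprob X)"
  then obtain P F where P: "P \<in> probs_Omega" and F: "F \<in> rvs (Omega \<Rightarrow>\<^sub>Q X)"
    and K: "K = (\<lambda>t. distr P (\<B> X) (F t))" by (auto simp: qprob_def)
  let ?\<alpha> = "\<lambda>w. F (hfst w) (hsnd w)"
  have "(\<lambda>(\<omega>, x)\<in>points (Omega \<times>\<^sub>Q Omega). F \<omega> x) \<in> qmeas (Omega \<times>\<^sub>Q Omega) X"
    using F by (simp add: qfun_def)
  from qmeasD[OF this, of "\<lambda>w. (hfst w, hsnd w)"] have "?\<alpha> \<in> rvs X"
    by (simp add: rvs_qprod_iff rvs_Omega points_qprod points_Omega measurable_hfst measurable_hsnd)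
  then show ?R using P by (intro bexI[of _ P] bexI[of _ ?\<alpha>]) (auto simp: K)
next
  assume ?R
  then obtain P \<alpha> where P: "P \<in> probs_Omega" and \<alpha>: "\<alpha> \<in> rvs X"
    and K: "K = (\<lambda>t. distr P (\<B> X) (\<lambda>u. \<alpha> (hpair t u)))" by blast
  have qO: "quasi_universal (Omega \<times>\<^sub>Q Omega)"
    by (intro quasi_universal_qprod quasi_universal_Omega)
  have "(\<lambda>t u. \<alpha> (hpair t u)) \<in> rvs (Omega \<Rightarrow>\<^sub>Q X)"
    unfolding qfun_def qus.simps mem_Collect_eq
  proof (intro conjI allI qmeasI[OF qO X] qmeasI[OF quasi_universal_Omega X])
    fix \<gamma> assume "\<gamma> \<in> rvs (Omega \<times>\<^sub>Q Omega)"
    then show "(\<lambda>t. (\<lambda>(\<omega>, x)\<in>points (Omega \<times>\<^sub>Q Omega). \<alpha> (hpair \<omega> x)) (\<gamma> t)) \<in> rvs X"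
      by (auto simp: points_qprod points_Omega case_prod_beta rvs_qprod_iff rvs_Omega
          intro!: rvs_compose[OF X \<alpha>] measurable_hpair)
  qed (auto simp: points_Omega rvs_Omega
        intro!: rvs_compose[OF X \<alpha>] measurable_hpair measurable_const)
  with P show "K \<in> rvs (qprob X)" unfolding qprob_def qus.simps by (auto simp: K)
qed

text \<open>The measured set moves together with t. Pulling D back along the representing random
  variable gives one universally measurable subset of Omega, and its sections are what
  \<open>measurable_emeasure_hpair\<close> handles.\<close>

lemma measurable_emeasure_rvs_qprob:
  assumes W: "quasi_universal W" and K: "K \<in> rvs (qprob W)"
    and D: "D \<in> sets (\<B> (Omega \<times>\<^sub>Q W))"
  shows "(\<lambda>t. emeasure (K t) {w. (t, w) \<in> D}) \<in> borel_measurable B_Omega"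
proof -
  obtain P \<alpha> where P: "P \<in> probs_Omega" and \<alpha>: "\<alpha> \<in> rvs W"
    and K: "K = (\<lambda>t. distr P (\<B> W) (\<lambda>u. \<alpha> (hpair t u)))"
    using K by (auto simp: rvs_qprob_iff[OF W])
  note qp = quasi_universal_qprod[OF quasi_universal_Omega W]
  let ?A = "{w. (hfst w, \<alpha> w) \<in> D}"
  have A: "?A \<in> sets B_Omega"
    by (intro sets_rv_vimage[OF qp _ D] rvs_PairI \<alpha>) (simp add: rvs_Omega measurable_hfst)
  have s: "{w. (t, w) \<in> D} \<in> sets (\<B> W)" for t
  proof -
    have "{w \<in> points W. (t, w) \<in> D} \<in> sets (\<B> W)"
      by (intro sets_induced_algebra_vimage[OF W qp D] rvs_PairI rvs_const[OF quasi_universal_Omega])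
        (auto simp: points_Omega)
    moreover have "D \<subseteq> UNIV \<times> points W"
      using sets.sets_into_space[OF D] by (simp add: points_qprod points_Omega)
    ultimately show ?thesis by (auto elim!: back_subst[of "\<lambda>A. A \<in> _"])
  qed
  have "emeasure (K t) {w. (t, w) \<in> D} = emeasure P (hpair t -` ?A)" for t
    using s[of t] by (simp add: K distr_rv[OF W P rvs_hpair[OF W \<alpha>]] vimage_def)
  then show ?thesis using measurable_emeasure_hpair[OF P A] by simp
qed

section \<open>The product of Markov kernels and its marginals\<close>

lemma points_markov_kernels: "points (markov_kernels Z X) = qmeas Z (qprob X)"
  by (simp add: qfun_def)

text \<open>Tested along a random variable \<beta> of Y, the moving section of D becomes a moving
  section of a set in Omega \<times> X, the situation of
  \<open>measurable_emeasure_rvs_qprob\<close>.\<close>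

lemma borel_measurable_kernel_section:
  assumes X: "quasi_universal X" and Y: "quasi_universal Y" and Z: "quasi_universal Z"
    and L: "L \<in> qmeas (Y \<times>\<^sub>Q Z) (qprob X)" and z: "z \<in> points Z"
    and D: "D \<in> sets (\<B> (X \<times>\<^sub>Q Y))"
  shows "(\<lambda>y. emeasure (L (y, z)) {x. (x, y) \<in> D}) \<in> borel_measurable (\<B> Y)"
proof (rule measurable_induced_algebraI[OF Y])
  fix \<beta> assume \<beta>: "\<beta> \<in> rvs Y"
  have "(\<lambda>t. L (\<beta> t, z)) \<in> rvs (qprob X)"
    by (rule qmeasD[OF L]) (intro rvs_PairI \<beta> rvs_const Z z)
  moreover have "{p \<in> points (Omega \<times>\<^sub>Q X). (snd p, \<beta> (fst p)) \<in> D} \<in> sets (\<B> (Omega \<times>\<^sub>Q X))"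
    by (intro sets_induced_algebra_vimage[OF _ _ D] quasi_universal_qprod quasi_universal_Omega X Y rvs_PairI)
      (auto simp: rvs_qprod_iff rvs_Omega intro: rvs_compose[OF Y \<beta>])
  ultimately have "(\<lambda>t. emeasure (L (\<beta> t, z)) {w. (t, w) \<in> {p \<in> points (Omega \<times>\<^sub>Q X). (snd p, \<beta> (fst p)) \<in> D}})
      \<in> borel_measurable B_Omega"
    by (rule measurable_emeasure_rvs_qprob[OF X])
  moreover have "D \<subseteq> points X \<times> points Y"
    using sets.sets_into_space[OF D] by (simp add: points_qprod)
  then have "{w. (t, w) \<in> {p \<in> points (Omega \<times>\<^sub>Q X). (snd p, \<beta> (fst p)) \<in> D}} = {x. (x, \<beta> t) \<in> D}" for t
    by (auto simp: points_qprod points_Omega)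
  ultimately show "(\<lambda>t. emeasure (L (\<beta> t, z)) {x. (x, \<beta> t) \<in> D}) \<in> borel_measurable B_Omega" by simp
qed simp

lemma nn_integral_kernel_section:
  assumes X: "quasi_universal X" and Y: "quasi_universal Y" and Z: "quasi_universal Z"
    and L: "L \<in> qmeas (Y \<times>\<^sub>Q Z) (qprob X)" and z: "z \<in> points Z"
    and D: "D \<in> sets (\<B> (X \<times>\<^sub>Q Y))"
    and P: "P \<in> probs_Omega" and \<beta>: "\<beta> \<in> rvs Y"
  shows "(\<integral>\<^sup>+ y. emeasure (L (y, z)) {x. (x, y) \<in> D} \<partial>distr P (\<B> Y) \<beta>) =
    (\<integral>\<^sup>+ u. emeasure (L (\<beta> u, z)) {x. (x, \<beta> u) \<in> D} \<partial>P)"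
  using borel_measurable_kernel_section[OF X Y Z L z D] measurable_rvs[OF Y \<beta>]
  by (subst nn_integral_distr) (auto simp: measurable_probs_Omega[OF P])

text \<open>\<open>measure_of\<close> reproduces a measure from its own values, so exhibiting a
  measure M with the prescribed values also settles the sigma-additivity of the integral
  formula.\<close>

lemma kernel_prod_eqI:
  assumes "L \<in> qmeas (Y \<times>\<^sub>Q Z) (qprob X)" "Q \<in> qmeas Z (qprob Y)" "z \<in> points Z"
    and M: "sets M = sets (\<B> (X \<times>\<^sub>Q Y))"
    and eq: "\<And>D. D \<in> sets (\<B> (X \<times>\<^sub>Q Y)) \<Longrightarrow>
      (\<integral>\<^sup>+ y. emeasure (L (y, z)) {x. (x, y) \<in> D} \<partial>Q z) = emeasure M D"
  shows "kernel_prod X Y Z (L, Q) z = M"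
proof -
  have sp: "space M = points (X \<times>\<^sub>Q Y)" using sets_eq_imp_space_eq[OF M] by simp
  have "kernel_prod X Y Z (L, Q) z =
      measure_of (points (X \<times>\<^sub>Q Y)) (sets (\<B> (X \<times>\<^sub>Q Y)))
        (\<lambda>D. \<integral>\<^sup>+ y. emeasure (L (y, z)) {x. (x, y) \<in> D} \<partial>Q z)"
    using assms(1-3) by (simp add: kernel_prod_def points_qprod[of "_ \<Rightarrow>\<^sub>Q _"] points_markov_kernels)
  also have "\<dots> = measure_of (space M) (sets M) (emeasure M)"
    unfolding sp M
    using sets.space_closed[of "\<B> (X \<times>\<^sub>Q Y)"] sets.sigma_sets_eq[of "\<B> (X \<times>\<^sub>Q Y)"]
    by (intro measure_of_eq) (auto simp: eq)
  finally show ?thesis by (simp add: measure_of_of_measure)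
qed

text \<open>Sampling in two stages: u produces y through the representation of Q, then v produces x
  through the representation of L. The latter is taken along the random variable that pairs y with
  z, so it is jointly admissible in t and u.\<close>

lemma kernel_prod_representation:
  assumes X: "quasi_universal X" and Y: "quasi_universal Y" and Z: "quasi_universal Z"
    and L: "L \<in> qmeas (Y \<times>\<^sub>Q Z) (qprob X)" and Q: "Q \<in> qmeas Z (qprob Y)" and \<zeta>: "\<zeta> \<in> rvs Z"
  shows "\<exists>R\<in>probs_Omega. \<exists>\<gamma>\<in>rvs (X \<times>\<^sub>Q Y). \<forall>t. \<forall>D\<in>sets (\<B> (X \<times>\<^sub>Q Y)).
    (\<integral>\<^sup>+ y. emeasure (L (y, \<zeta> t)) {x. (x, y) \<in> D} \<partial>Q (\<zeta> t)) =
      emeasure (distr R (\<B> (X \<times>\<^sub>Q Y)) (\<lambda>u. \<gamma> (hpair t u))) D"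
proof -
  note XY = quasi_universal_qprod[OF X Y]
  obtain P1 \<beta> where P1: "P1 \<in> probs_Omega" and \<beta>: "\<beta> \<in> rvs Y"
    and Q': "(\<lambda>t. Q (\<zeta> t)) = (\<lambda>t. distr P1 (\<B> Y) (\<lambda>u. \<beta> (hpair t u)))"
    using qmeasD[OF Q \<zeta>] by (auto simp: rvs_qprob_iff[OF Y])
  have "(\<lambda>w. (\<beta> w, \<zeta> (hfst w))) \<in> rvs (Y \<times>\<^sub>Q Z)"
    by (intro rvs_PairI \<beta> rvs_compose[OF Z \<zeta>] measurable_hfst)
  from qmeasD[OF L this] obtain P2 \<alpha> where P2: "P2 \<in> probs_Omega" and \<alpha>: "\<alpha> \<in> rvs X"
    and L': "(\<lambda>w. L (\<beta> w, \<zeta> (hfst w))) = (\<lambda>w. distr P2 (\<B> X) (\<lambda>u. \<alpha> (hpair w u)))"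
    by (auto simp: rvs_qprob_iff[OF X])
  define \<theta> where "\<theta> w = hpair (hfst w) (hfst (hsnd w))" for w
  define \<gamma> where "\<gamma> w = (\<alpha> (hpair (\<theta> w) (hsnd (hsnd w))), \<beta> (\<theta> w))" for w
  have \<theta>: "\<theta> \<in> B_Omega \<rightarrow>\<^sub>M B_Omega"
    unfolding \<theta>_def
    by (intro measurable_hpair measurable_hfst measurable_compose[OF measurable_hsnd measurable_hfst])
  have \<gamma>: "\<gamma> \<in> rvs (X \<times>\<^sub>Q Y)"
    unfolding \<gamma>_def
    by (intro rvs_PairI rvs_compose[OF X \<alpha>] rvs_compose[OF Y \<beta>] measurable_hpair \<theta>
        measurable_compose[OF measurable_hsnd measurable_hsnd])
  show ?thesis
  proof (intro bexI[OF _ hprod_probs_Omega[OF P1 P2]] bexI[OF _ \<gamma>] allI ballI)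
    fix t
    fix D assume D: "D \<in> sets (\<B> (X \<times>\<^sub>Q Y))"
    note \<gamma>t = rvs_hpair[OF XY \<gamma>, of t]
    have "(\<integral>\<^sup>+ y. emeasure (L (y, \<zeta> t)) {x. (x, y) \<in> D} \<partial>Q (\<zeta> t)) =
        (\<integral>\<^sup>+ u. emeasure (L (\<beta> (hpair t u), \<zeta> t)) {x. (x, \<beta> (hpair t u)) \<in> D} \<partial>P1)"
      using nn_integral_kernel_section[OF X Y Z L quasi_universal_range[OF Z \<zeta>] D P1 rvs_hpair[OF Y \<beta>]]
        fun_cong[OF Q', of t] by simp
    also have "\<dots> = (\<integral>\<^sup>+ u. emeasure P2 (hpair u -` {m. \<gamma> (hpair t m) \<in> D}) \<partial>P1)"
    proof (rule nn_integral_cong)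
      fix u
      have "L (\<beta> (hpair t u), \<zeta> t) = distr P2 (\<B> X) (\<lambda>v. \<alpha> (hpair (hpair t u) v))"
        using fun_cong[OF L', of "hpair t u"] by simp
      then show "emeasure (L (\<beta> (hpair t u), \<zeta> t)) {x. (x, \<beta> (hpair t u)) \<in> D} =
          emeasure P2 (hpair u -` {m. \<gamma> (hpair t m) \<in> D})"
        using section_fst_sets[OF X Y D quasi_universal_range[OF Y \<beta>, of "hpair t u"]]
        by (simp add: distr_rv[OF X P2 rvs_hpair[OF X \<alpha>]] vimage_def \<gamma>_def \<theta>_def)
    qed
    also have "\<dots> = emeasure (hprod P1 P2) {m. \<gamma> (hpair t m) \<in> D}"
      by (rule emeasure_hprod[symmetric, OF P1 P2 sets_rv_vimage[OF XY \<gamma>t D]])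
    also have "\<dots> = emeasure (distr (hprod P1 P2) (\<B> (X \<times>\<^sub>Q Y)) (\<lambda>u. \<gamma> (hpair t u))) D"
      by (rule distr_rv(2)[symmetric, OF XY hprod_probs_Omega[OF P1 P2] \<gamma>t D])
    finally show "(\<integral>\<^sup>+ y. emeasure (L (y, \<zeta> t)) {x. (x, y) \<in> D} \<partial>Q (\<zeta> t)) =
      emeasure (distr (hprod P1 P2) (\<B> (X \<times>\<^sub>Q Y)) (\<lambda>u. \<gamma> (hpair t u))) D" .
  qed
qed

lemma kernel_prod_rvs:
  assumes X: "quasi_universal X" and Y: "quasi_universal Y" and Z: "quasi_universal Z"
    and L: "L \<in> qmeas (Y \<times>\<^sub>Q Z) (qprob X)" and Q: "Q \<in> qmeas Z (qprob Y)" and \<zeta>: "\<zeta> \<in> rvs Z"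
  shows "(\<lambda>t. kernel_prod X Y Z (L, Q) (\<zeta> t)) \<in> rvs (qprob (X \<times>\<^sub>Q Y))"
proof -
  from kernel_prod_representation[OF assms] obtain R \<gamma> where
    R: "R \<in> probs_Omega" and \<gamma>: "\<gamma> \<in> rvs (X \<times>\<^sub>Q Y)" and
    eq: "\<forall>t. \<forall>D\<in>sets (\<B> (X \<times>\<^sub>Q Y)).
      (\<integral>\<^sup>+ y. emeasure (L (y, \<zeta> t)) {x. (x, y) \<in> D} \<partial>Q (\<zeta> t)) =
        emeasure (distr R (\<B> (X \<times>\<^sub>Q Y)) (\<lambda>u. \<gamma> (hpair t u))) D"
    by (elim bexE)
  have "kernel_prod X Y Z (L, Q) (\<zeta> t) =
      distr R (\<B> (X \<times>\<^sub>Q Y)) (\<lambda>u. \<gamma> (hpair t u))" for t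
    by (rule kernel_prod_eqI[OF L Q quasi_universal_range[OF Z \<zeta>] sets_distr bspec[OF spec[OF eq]]])
  then show ?thesis
    using R \<gamma> by (auto simp: rvs_qprob_iff[OF quasi_universal_qprod[OF X Y]] fun_eq_iff)
qed

lemma emeasure_kernel_prod:
  assumes X: "quasi_universal X" and Y: "quasi_universal Y" and Z: "quasi_universal Z"
    and L: "L \<in> qmeas (Y \<times>\<^sub>Q Z) (qprob X)" and Q: "Q \<in> qmeas Z (qprob Y)" and z: "z \<in> points Z"
    and D: "D \<in> sets (\<B> (X \<times>\<^sub>Q Y))"
  shows "emeasure (kernel_prod X Y Z (L, Q) z) D = (\<integral>\<^sup>+ y. emeasure (L (y, z)) {x. (x, y) \<in> D} \<partial>Q z)"
proof -
  from kernel_prod_representation[OF X Y Z L Q rvs_const[OF Z z]] obtain R \<gamma> where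
    eq: "\<forall>t. \<forall>D\<in>sets (\<B> (X \<times>\<^sub>Q Y)).
      (\<integral>\<^sup>+ y. emeasure (L (y, z)) {x. (x, y) \<in> D} \<partial>Q z) =
        emeasure (distr R (\<B> (X \<times>\<^sub>Q Y)) (\<lambda>u. \<gamma> (hpair t u))) D"
    by (elim bexE)
  \<comment> \<open>z entered as a constant random variable, so every t yields the same measure and
    \<open>undefined\<close> can serve as t.\<close>
  have "kernel_prod X Y Z (L, Q) z = distr R (\<B> (X \<times>\<^sub>Q Y)) (\<lambda>u. \<gamma> (hpair undefined u))"
    by (rule kernel_prod_eqI[OF L Q z sets_distr bspec[OF spec[OF eq]]])
  then show ?thesis using eq D by simp
qed

lemma kernel_prod_qmeas:
  assumes X: "quasi_universal X" and Y: "quasi_universal Y" and Z: "quasi_universal Z"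
    and L: "L \<in> qmeas (Y \<times>\<^sub>Q Z) (qprob X)" and Q: "Q \<in> qmeas Z (qprob Y)"
  shows "kernel_prod X Y Z (L, Q) \<in> qmeas Z (qprob (X \<times>\<^sub>Q Y))"
proof (rule qmeasI[OF Z quasi_universal_qprob[OF quasi_universal_qprod[OF X Y]] _ kernel_prod_rvs[OF assms]])
  show "kernel_prod X Y Z (L, Q) \<in> extensional (points Z)"
    using L Q by (simp add: kernel_prod_def points_qprod[of "_ \<Rightarrow>\<^sub>Q _"] points_markov_kernels)
qed

text \<open>Each \<open>F t\<close> is recovered from the joint map by inserting a constant first
  component.\<close>

lemma rvs_markov_kernels_iff:
  assumes Z: "quasi_universal Z" and W: "quasi_universal W"
  shows "F \<in> rvs (Z \<Rightarrow>\<^sub>Q W) \<longleftrightarrow> (\<forall>t. F t \<in> extensional (points Z)) \<and>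
    (\<lambda>(t, z)\<in>points (Omega \<times>\<^sub>Q Z). F t z) \<in> qmeas (Omega \<times>\<^sub>Q Z) W" (is "_ \<longleftrightarrow> ?R")
proof
  show "F \<in> rvs (Z \<Rightarrow>\<^sub>Q W) \<Longrightarrow> ?R" by (auto simp: qfun_def qmeas_def PiE_iff)
next
  assume R: ?R
  have "F t \<in> qmeas Z W" for t
  proof (rule qmeasI[OF Z W])
    show "F t \<in> extensional (points Z)" using R by blast
    fix \<zeta> assume \<zeta>: "\<zeta> \<in> rvs Z"
    then have "(\<lambda>u. (t, \<zeta> u)) \<in> rvs (Omega \<times>\<^sub>Q Z)" by (auto simp: rvs_qprod_iff rvs_Omega)
    from qmeasD[OF conjunct2[OF R] this] show "(\<lambda>u. F t (\<zeta> u)) \<in> rvs W"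
      using quasi_universal_range[OF Z \<zeta>] by (simp add: points_qprod points_Omega)
  qed
  with R show "F \<in> rvs (Z \<Rightarrow>\<^sub>Q W)" by (simp add: qfun_def)
qed

lemma measurable_fst_induced:
  "quasi_universal X \<Longrightarrow> quasi_universal Y \<Longrightarrow> fst \<in> \<B> (X \<times>\<^sub>Q Y) \<rightarrow>\<^sub>M \<B> X"
  by (rule measurable_induced_algebraI[OF quasi_universal_qprod])
    (auto simp: points_qprod rvs_qprod_iff intro: measurable_rvs)

lemma measurable_snd_induced:
  "quasi_universal X \<Longrightarrow> quasi_universal Y \<Longrightarrow> snd \<in> \<B> (X \<times>\<^sub>Q Y) \<rightarrow>\<^sub>M \<B> Y"
  by (rule measurable_induced_algebraI[OF quasi_universal_qprod])
    (auto simp: points_qprod rvs_qprod_iff intro: measurable_rvs)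

lemma kernel_marginal_qmeas:
  assumes X: "quasi_universal X" and Y: "quasi_universal Y" and Z: "quasi_universal Z"
    and K: "K \<in> qmeas Z (qprob (X \<times>\<^sub>Q Y))"
  shows "kernel_marginal Y Z K \<in> qmeas Z (qprob Y)"
proof (intro qmeasI Z quasi_universal_qprob Y)
  note XY = quasi_universal_qprod[OF X Y]
  show "kernel_marginal Y Z K \<in> extensional (points Z)" by (simp add: kernel_marginal_def)
  fix \<zeta> assume \<zeta>: "\<zeta> \<in> rvs Z"
  obtain P \<gamma> where P: "P \<in> probs_Omega" and \<gamma>: "\<gamma> \<in> rvs (X \<times>\<^sub>Q Y)"
    and eq: "(\<lambda>t. K (\<zeta> t)) = (\<lambda>t. distr P (\<B> (X \<times>\<^sub>Q Y)) (\<lambda>u. \<gamma> (hpair t u)))"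
    using qmeasD[OF K \<zeta>] by (auto simp: rvs_qprob_iff[OF XY])
  have "distr (K (\<zeta> t)) (\<B> Y) snd = distr P (\<B> Y) (\<lambda>u. snd (\<gamma> (hpair t u)))" for t
    using measurable_rvs[OF XY rvs_hpair[OF XY \<gamma>]] measurable_snd_induced[OF X Y]
    by (simp add: fun_cong[OF eq] distr_distr measurable_probs_Omega[OF P] o_def)
  then show "(\<lambda>t. kernel_marginal Y Z K (\<zeta> t)) \<in> rvs (qprob Y)"
    using P \<gamma> quasi_universal_range[OF Z \<zeta>]
    by (auto simp: rvs_qprob_iff[OF Y] kernel_marginal_def rvs_qprod_iff
        intro!: bexI[of _ P] bexI[of _ "\<lambda>w. snd (\<gamma> w)"])
qed

lemma kernel_marginal_distr:
  assumes X: "quasi_universal X" and Y: "quasi_universal Y" and z: "z \<in> points Z"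
    and P: "P \<in> probs_Omega" and \<gamma>: "\<gamma> \<in> rvs (X \<times>\<^sub>Q Y)"
    and K: "K z = distr P (\<B> (X \<times>\<^sub>Q Y)) \<gamma>"
  shows "kernel_marginal Y Z K z = distr P (\<B> Y) (\<lambda>u. snd (\<gamma> u))"
proof -
  note XY = quasi_universal_qprod[OF X Y]
  show ?thesis
    using measurable_rvs[OF XY \<gamma>] measurable_snd_induced[OF X Y] z
    by (simp add: K kernel_marginal_def distr_distr measurable_probs_Omega[OF P] o_def)
qed

section \<open>Real codes and quantile functions\<close>

text \<open>In base 4 with digits 0 and 1 the tail after the \<open>k\<close>th digit is at most 1/3, so \<open>floor\<close> reads
  off the digits without ambiguity.\<close>

definition bits_real :: "(nat \<Rightarrow> bool) \<Rightarrow> real" where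
  "bits_real b = (\<Sum>i. of_bool (b i) / 4 ^ Suc i)"

lemma bits_real_summable: "summable (\<lambda>i. of_bool (b i) / 4 ^ Suc i :: real)"
proof (rule summable_comparison_test')
  show "summable (\<lambda>i. (1/4) ^ i :: real)" by (rule summable_geometric) simp
  show "norm (of_bool (b i) / 4 ^ Suc i :: real) \<le> (1/4) ^ i" for i
    by (cases "b i") (auto simp: field_simps power_one_over)
qed

lemma bits_real_Suc: "bits_real b = (of_bool (b 0) + bits_real (\<lambda>i. b (Suc i))) / 4"
proof -
  have "bits_real b = of_bool (b 0) / 4 + (\<Sum>i. of_bool (b (Suc i)) / 4 ^ Suc (Suc i))"
    unfolding bits_real_def using suminf_split_head[OF bits_real_summable, of b] by simp
  also have "(\<Sum>i. of_bool (b (Suc i)) / 4 ^ Suc (Suc i)) = (\<Sum>i. (of_bool (b (Suc i)) / 4 ^ Suc i) / 4 :: real)"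
    by (intro suminf_cong) simp
  also have "\<dots> = bits_real (\<lambda>i. b (Suc i)) / 4"
    unfolding bits_real_def by (rule suminf_divide[OF bits_real_summable])
  finally show ?thesis by (simp add: field_simps)
qed

lemma bits_real_bounds: "0 \<le> bits_real b" "bits_real b \<le> 1/3"
proof -
  show "0 \<le> bits_real b"
    unfolding bits_real_def by (rule suminf_nonneg[OF bits_real_summable]) simp
  have s: "(\<lambda>i. (1/4) ^ i / 4 :: real) sums (1 / (1 - 1/4) / 4)"
    by (intro sums_divide geometric_sums) simp
  have "bits_real b \<le> (\<Sum>i. (1/4) ^ i / 4)"
    unfolding bits_real_def
    by (rule suminf_le[OF _ bits_real_summable sums_summable[OF s]])
      (auto simp: field_simps power_one_over)
  then show "bits_real b \<le> 1/3" using sums_unique[OF s] by simp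
qed

text \<open>Induction by shifting the digits. The leading digit contributes a multiple of 4 to the
  later floors and so keeps their parity; in the base case the tail is at most 1/3, so the floor is
  the leading digit itself.\<close>

lemma odd_floor_bits_real: "odd \<lfloor>4 ^ Suc k * bits_real b\<rfloor> \<longleftrightarrow> b k"
proof (induction k arbitrary: b)
  case 0
  have "\<lfloor>4 * bits_real b\<rfloor> = of_bool (b 0)"
    using bits_real_bounds[of "\<lambda>i. b (Suc i)"]
    by (subst bits_real_Suc) (auto intro!: floor_unique)
  then show ?case by simp
next
  case (Suc k)
  have "4 ^ Suc (Suc k) * bits_real b =
      4 ^ Suc k * bits_real (\<lambda>i. b (Suc i)) + of_int (4 ^ Suc k * of_bool (b 0))"
    by (subst bits_real_Suc) (simp add: field_simps)
  then have "\<lfloor>4 ^ Suc (Suc k) * bits_real b\<rfloor> =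
      \<lfloor>4 ^ Suc k * bits_real (\<lambda>i. b (Suc i))\<rfloor> + 4 ^ Suc k * of_bool (b 0)"
    by (simp only: floor_add_int[symmetric])
  then show ?case using Suc[of "\<lambda>i. b (Suc i)"] by simp
qed

lemma borel_measurable_bits_real:
  assumes "\<And>i. {x \<in> space M. b i x} \<in> sets M"
  shows "(\<lambda>x. bits_real (\<lambda>i. b i x)) \<in> borel_measurable M"
proof -
  have [measurable]: "Measurable.pred M (b i)" for i using assms by (simp add: pred_def)
  show ?thesis unfolding bits_real_def by measurable
qed

section \<open>Coding the cube by reals\<close>

definition hcube_bit :: "nat \<Rightarrow> hcube \<Rightarrow> bool" where
  "hcube_bit k x \<longleftrightarrow> of_rat (from_nat (snd (prod_decode k))) < hcube_nth x (fst (prod_decode k))"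

definition hcube_code :: "hcube \<Rightarrow> real" where
  "hcube_code x = bits_real (\<lambda>k. hcube_bit k x)"

text \<open>Digit (i, n) records whether the n-th rational lies strictly below coordinate i, so the
  coordinate is the supremum of the marked rationals. Clipping to [0,1] and the value 0 at unmarked
  digits make every real decode to a point of the cube; quantiles need not lie in the range of
  \<open>hcube_code\<close>.\<close>

definition hcube_decode :: "real \<Rightarrow> hcube" where
  "hcube_decode t = Abs_hcube (\<lambda>i. SUP n.
     if odd \<lfloor>4 ^ Suc (prod_encode (i, n)) * t\<rfloor> then max 0 (min 1 (of_rat (from_nat n))) else 0)"

lemma hcube_nth_decode:
  "hcube_nth (hcube_decode t) i = (SUP n.
     if odd \<lfloor>4 ^ Suc (prod_encode (i, n)) * t\<rfloor> then max 0 (min 1 (of_rat (from_nat n))) else 0)"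
  unfolding hcube_decode_def
proof (rule hcube_nth_Abs)
  fix i
  let ?f = "\<lambda>n. if odd \<lfloor>4 ^ Suc (prod_encode (i, n)) * t\<rfloor> then max 0 (min 1 (of_rat (from_nat n))) else 0 :: real"
  have "0 \<le> ?f 0" by simp
  also have "?f 0 \<le> (SUP n. ?f n)" by (rule cSUP_upper) (auto intro!: bdd_aboveI[of _ 1])
  finally have "0 \<le> (SUP n. ?f n)" .
  moreover have "(SUP n. ?f n) \<le> 1" by (rule cSUP_least) auto
  ultimately show "(SUP n. ?f n) \<in> {0..1}" by simp
qed

lemma hcube_decode_code: "hcube_decode (hcube_code x) = x"
proof (rule hcube_eqI)
  fix i
  have x: "0 \<le> hcube_nth x i" "hcube_nth x i \<le> 1" using hcube_nth_mem[of x i] by auto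
  let ?f = "\<lambda>n. if of_rat (from_nat n) < hcube_nth x i then max 0 (min 1 (of_rat (from_nat n))) else 0 :: real"
  have "hcube_nth (hcube_decode (hcube_code x)) i = (SUP n. ?f n)"
    unfolding hcube_nth_decode hcube_code_def odd_floor_bits_real
    by (simp add: hcube_bit_def)
  also have "\<dots> = hcube_nth x i"
  proof (rule antisym)
    show "(SUP n. ?f n) \<le> hcube_nth x i" by (rule cSUP_least) (use x in auto)
    have bdd: "bdd_above (range ?f)" by (auto intro!: bdd_aboveI[of _ 1])
    show "hcube_nth x i \<le> (SUP n. ?f n)"
    proof (rule dense_le)
      fix y assume "y < hcube_nth x i"
      then obtain q where q: "y < of_rat q" "of_rat q < hcube_nth x i"
        using of_rat_dense by blast
      obtain n where n: "q = from_nat n" using surj_from_nat by (metis surjD)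
      have "y \<le> ?f n" using q x unfolding n[symmetric] by simp
      also have "?f n \<le> (SUP n. ?f n)" by (rule cSUP_upper[OF _ bdd]) simp
      finally show "y \<le> (SUP n. ?f n)" .
    qed
  qed
  finally show "hcube_nth (hcube_decode (hcube_code x)) i = hcube_nth x i" .
qed

lemma borel_measurable_hcube_code: "hcube_code \<in> borel_measurable B_Omega"
proof -
  have "hcube_code \<in> borel_measurable hcube_borel"
    unfolding hcube_code_def hcube_bit_def
    by (intro borel_measurable_bits_real borel_measurable_less measurable_hcube_nth_coord) auto
  then show ?thesis by (rule measurable_hcube_borel_imp_B_Omega)
qed

lemma measurable_hcube_decode: "hcube_decode \<in> borel \<rightarrow>\<^sub>M hcube_borel"
proof (rule measurable_into_hcube_borel)
  fix i
  have [measurable]: "Measurable.pred borel (\<lambda>t::real. odd \<lfloor>4 ^ Suc (prod_encode (i, n)) * t\<rfloor>)" for n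
  proof -
    have "(\<lambda>t::real. \<lfloor>4 ^ Suc (prod_encode (i, n)) * t\<rfloor>) \<in> borel \<rightarrow>\<^sub>M count_space UNIV" by measurable
    from measurable_compose[OF this, of odd "count_space UNIV"] show ?thesis by simp
  qed
  show "(\<lambda>t. hcube_nth (hcube_decode t) i) \<in> borel_measurable borel"
    unfolding hcube_nth_decode
  proof (rule borel_measurable_cSUP)
    show "bdd_above ((\<lambda>n. if odd \<lfloor>4 ^ Suc (prod_encode (i, n)) * x\<rfloor>
        then max 0 (min 1 (real_of_rat (from_nat n))) else 0) ` UNIV)" for x
      by (auto intro!: bdd_aboveI[of _ 1])
  qed (auto intro!: measurable_If simp: pred_def[symmetric])
qed

lemma hcube_code_bounds: "0 \<le> hcube_code x" "hcube_code x \<le> 1"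
  using bits_real_bounds[of "\<lambda>k. hcube_bit k x"] by (auto simp: hcube_code_def)

section \<open>Uniform randomness and the quantile transform\<close>

lemma ex_uniform_probs_Omega:
  obtains P V where "P \<in> probs_Omega" "V \<in> borel_measurable B_Omega"
    "\<forall>s\<in>{0..1}. emeasure P {v. V v \<le> s} = ennreal s"
proof -
  let ?U = "uniform_measure lborel {0..1::real}"
  \<comment> \<open>All coordinates carry the same uniform variable, and V will read coordinate 0;
    clipping keeps the sequence in the cube for every real t.\<close>
  let ?f = "\<lambda>t::real. Abs_hcube (\<lambda>_. max 0 (min 1 t))"
  have nth: "hcube_nth (?f t) i = max 0 (min 1 t)" for t i
    by (rule hcube_nth_Abs) auto
  have f: "?f \<in> ?U \<rightarrow>\<^sub>M hcube_borel"
    by (rule measurable_into_hcube_borel) (simp add: nth)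
  have U: "prob_space ?U" by (rule prob_space_uniform_measure) auto
  obtain P where P: "P \<in> probs_Omega" and
    eq: "\<forall>B\<in>sets hcube_borel. emeasure P B = emeasure (distr ?U hcube_borel ?f) B"
    using prob_space.prob_space_distr[OF U f]
    by (rule probs_Omega_extension) (rule sets_distr)
  have m: "(\<lambda>x. hcube_nth x 0) \<in> borel_measurable hcube_borel"
    by (rule measurable_hcube_nth_coord)
  have "emeasure P {v. hcube_nth v 0 \<le> s} = ennreal s" if s: "s \<in> {0..1}" for s
  proof -
    have B: "{v. hcube_nth v 0 \<le> s} \<in> sets hcube_borel"
      using borel_measurable_le[OF m borel_measurable_const, of s] by simp
    have "emeasure P {v. hcube_nth v 0 \<le> s} = emeasure ?U {t. max 0 (min 1 t) \<le> s}"
      using bspec[OF eq B] emeasure_distr[OF f B] by (simp add: nth vimage_def)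
    also have "\<dots> = emeasure lborel ({0..1} \<inter> {t. max 0 (min 1 t) \<le> s}) / emeasure lborel {0..1::real}"
      by (rule emeasure_uniform_measure) auto
    also have "{0..1} \<inter> {t. max 0 (min 1 t) \<le> s} = {0..s}" using s by auto
    finally show ?thesis using s by (simp add: divide_ennreal_def)
  qed
  then show ?thesis
    using that[OF P measurable_hcube_borel_imp_B_Omega[OF m]] by blast
qed

text \<open>The element 0 keeps the supremum meaningful for every \<open>f\<close>, not only for distribution functions.\<close>

definition quantile :: "(rat \<Rightarrow> real) \<Rightarrow> real \<Rightarrow> real" where
  "quantile f s = Sup (insert 0 (of_rat ` {q. 0 \<le> q \<and> q \<le> 1 \<and> f q < s}))"

text \<open>The Galois property of a generalised inverse. Only rationals strictly above x occur, so
  a monotone f acts through its right limit at x; the clause 0 \<le> x comes from the element 0 in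
  the supremum. Being a countable conjunction, the right-hand side also yields measurability of the
  quantile.\<close>

lemma quantile_le_iff:
  "quantile f s \<le> x \<longleftrightarrow> 0 \<le> x \<and> (\<forall>q. 0 \<le> q \<and> q \<le> 1 \<and> x < of_rat q \<longrightarrow> s \<le> f q)"
proof -
  let ?S = "insert 0 (of_rat ` {q. 0 \<le> q \<and> q \<le> 1 \<and> f q < s}) :: real set"
  have "bdd_above ?S" by (auto intro!: bdd_aboveI[of _ 1])
  then have "Sup ?S \<le> x \<longleftrightarrow> (\<forall>y\<in>?S. y \<le> x)" by (intro cSup_le_iff) auto
  then show ?thesis unfolding quantile_def by (auto simp: not_le[symmetric])
qed

lemma borel_measurable_quantile:
  assumes f: "\<And>q. (\<lambda>w. f q w) \<in> borel_measurable M" and s: "s \<in> borel_measurable M"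
  shows "(\<lambda>w. quantile (\<lambda>q. f q w) (s w)) \<in> borel_measurable M"
  unfolding borel_measurable_iff_le quantile_le_iff
  by (intro allI sets.sets_Collect_conj sets.sets_Collect_const sets.sets_Collect_countable_All
      sets.sets_Collect_imp borel_measurable_le s f)

lemma rat_decseq_approx:
  fixes x :: real assumes "0 \<le> x" "x < 1"
  obtains q :: "nat \<Rightarrow> rat" where "decseq q" "\<forall>n. x < of_rat (q n)" "\<forall>n. 0 \<le> q n \<and> q n \<le> 1"
    "(\<lambda>n. of_rat (q n)) \<longlonglongrightarrow> x"
proof -
  \<comment> \<open>Dyadic rounding with 1 added to the floor stays strictly above x even at dyadic
    points, and x < 1 keeps it at most 1.\<close>
  let ?q = "\<lambda>n. of_int (\<lfloor>2 ^ n * x\<rfloor> + 1) / 2 ^ n :: rat"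
  have q: "real_of_rat (?q n) = (real_of_int \<lfloor>2 ^ n * x\<rfloor> + 1) / 2 ^ n" for n
    by (simp add: of_rat_divide of_rat_add of_rat_power)
  show ?thesis
  proof
    show "decseq ?q"
    proof (rule decseq_SucI)
      fix n
      have "\<lfloor>2 ^ Suc n * x\<rfloor> + 1 \<le> 2 * (\<lfloor>2 ^ n * x\<rfloor> + 1)" by simp linarith
      then have "(of_int (\<lfloor>2 ^ Suc n * x\<rfloor> + 1) :: rat) \<le> of_int (2 * (\<lfloor>2 ^ n * x\<rfloor> + 1))"
        by (simp only: of_int_le_iff)
      then have "?q (Suc n) \<le> of_int (2 * (\<lfloor>2 ^ n * x\<rfloor> + 1)) / 2 ^ Suc n"
        by (rule divide_right_mono) simp
      also have "\<dots> = ?q n" by (simp add: field_simps)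
      finally show "?q (Suc n) \<le> ?q n" .
    qed
    have lt: "x < of_rat (?q n)" for n
      unfolding q by (simp add: field_simps) linarith
    then show "\<forall>n. x < of_rat (?q n)" by blast
    show "\<forall>n. 0 \<le> ?q n \<and> ?q n \<le> 1"
    proof (intro allI conjI)
      fix n
      have "0 < real_of_rat (?q n)" using lt[of n] assms by linarith
      then show "0 \<le> ?q n" by (simp only: zero_less_of_rat_iff less_imp_le)
      have "2 ^ n * x < 2 ^ n" using assms by simp
      then have "\<lfloor>2 ^ n * x\<rfloor> < 2 ^ n" by (simp add: floor_less_iff)
      then have "(of_int (\<lfloor>2 ^ n * x\<rfloor> + 1) :: rat) \<le> of_int (2 ^ n)" by (simp only: of_int_le_iff)
      then show "?q n \<le> 1" by simp
    qed
    show "(\<lambda>n. of_rat (?q n)) \<longlonglongrightarrow> x"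
    proof (rule tendsto_sandwich[of "\<lambda>_. x" _ _ "\<lambda>n. x + (1/2) ^ n"])
      show "\<forall>\<^sub>F n in sequentially. x \<le> of_rat (?q n)"
        using lt by (intro always_eventually allI less_imp_le) auto
      have "real_of_rat (?q n) \<le> x + (1/2) ^ n" for n
        unfolding q by (simp add: field_simps power_one_over)
      then show "\<forall>\<^sub>F n in sequentially. of_rat (?q n) \<le> x + (1/2) ^ n" by simp
      have "(\<lambda>n. x + (1/2) ^ n) \<longlonglongrightarrow> x + 0"
        by (intro tendsto_add tendsto_const LIMSEQ_power_zero) simp
      then show "(\<lambda>n. x + (1/2) ^ n) \<longlonglongrightarrow> x" by simp
    qed simp
  qed
qed

text \<open>The hypothesis \<open>eq\<close> settles rational thresholds, and rationals decreasing
  to x reach every other one: both sides are then limits along decreasing events. Bounds and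
  monotonicity of f are assumed almost everywhere because f will be a limit of ratios, controlled
  only off a null set.\<close>

lemma nn_integral_quantile:
  fixes f :: "rat \<Rightarrow> 'a \<Rightarrow> real"
  assumes M: "prob_space M" and P: "prob_space P"
    and V: "V \<in> borel_measurable P"
    and unif: "\<And>s. s \<in> {0..1} \<Longrightarrow> emeasure P {v \<in> space P. V v \<le> s} = ennreal s"
    and a: "a \<in> borel_measurable M" "\<And>u. u \<in> space M \<Longrightarrow> a u \<in> {0..1}"
    and f: "\<And>q. f q \<in> borel_measurable M" 
    and bd: "AE u in M. \<forall>q. f q u \<in> {0..1}"
    and mono: "AE u in M. \<forall>q q'. q \<le> q' \<longrightarrow> f q u \<le> f q' u"
    and A: "A \<in> sets M"
    and eq: "\<And>q. (\<integral>u. indicator A u * f q u \<partial>M) = measure M ({u \<in> space M. a u \<le> of_rat q} \<inter> A)"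
  shows "(\<integral>\<^sup>+ u. indicator A u * emeasure P {v \<in> space P. quantile (\<lambda>q. f q u) (V v) \<le> x} \<partial>M) =
    emeasure M ({u \<in> space M. a u \<le> x} \<inter> A)" (is "(\<integral>\<^sup>+ u. _ * ?F u \<partial>M) = _")
proof -
  interpret M: prob_space M by fact
  interpret P: prob_space P by fact
  consider "x < 0" | "1 \<le> x" | "0 \<le> x" "x < 1" by linarith
  then show ?thesis
  proof cases
    case 1
    then have "{u \<in> space M. a u \<le> x} \<inter> A = {}" using a(2) by force
    then show ?thesis using 1 by (simp add: quantile_le_iff)
  next
    case 2
    \<comment> \<open>No rational in [0,1] exceeds x, so the quantile event is the whole
      space.\<close>
    have "x < real_of_rat q \<Longrightarrow> 1 < q" for q
      using 2 by (metis le_less_trans of_rat_1 of_rat_less)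
    then have "{v \<in> space P. quantile (\<lambda>q. f q u) (V v) \<le> x} = space P" for u
      using 2 by (force simp: quantile_le_iff)
    then have "?F u = 1" for u by (simp add: P.emeasure_space_1)
    moreover have "{u \<in> space M. a u \<le> x} \<inter> A = A"
      using a(2) 2 sets.sets_into_space[OF A] by force
    ultimately show ?thesis using A by simp
  next
    case 3
    obtain q where q: "decseq q" "\<forall>n. x < of_rat (q n)" "\<forall>n. 0 \<le> q n \<and> q n \<le> 1"
      "(\<lambda>n. real_of_rat (q n)) \<longlonglongrightarrow> x" by (rule rat_decseq_approx[OF 3])
    have "(\<lambda>w. quantile (\<lambda>q. f q (fst w)) (V (snd w))) \<in> borel_measurable (M \<Otimes>\<^sub>M P)"
      by (intro borel_measurable_quantile measurable_compose[OF measurable_fst f]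
          measurable_compose[OF measurable_snd V])
    then have "{w \<in> space (M \<Otimes>\<^sub>M P). quantile (\<lambda>q. f q (fst w)) (V (snd w)) \<le> x} \<in> sets (M \<Otimes>\<^sub>M P)"
      by measurable
    from P.measurable_emeasure_Pair[OF this]
    have Fm: "?F \<in> borel_measurable M"
      by (rule measurable_cong[THEN iffD1, rotated])
        (auto simp: space_pair_measure intro!: arg_cong[where f="emeasure P"])
    have lim: "AE u in M. (\<lambda>n. ennreal (f (q n) u)) \<longlonglongrightarrow> ?F u"
      using bd mono
    proof eventually_elim
      case (elim u)
      have "?F u = emeasure P (\<Inter>n. {v \<in> space P. V v \<le> f (q n) u})"
      proof (rule arg_cong[where f="emeasure P"])
        show "{v \<in> space P. quantile (\<lambda>q. f q u) (V v) \<le> x} = (\<Inter>n. {v \<in> space P. V v \<le> f (q n) u})"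
        proof (intro set_eqI iffI)
          fix v assume v: "v \<in> (\<Inter>n. {v \<in> space P. V v \<le> f (q n) u})"
          \<comment> \<open>Some member of the sequence lies below r, and monotonicity passes its
            bound on to r.\<close>
          have "V v \<le> f r u" if r: "x < of_rat r" for r
          proof -
            have "\<forall>\<^sub>F n in sequentially. real_of_rat (q n) < of_rat r"
              using q(4) r by (rule order_tendstoD)
            then obtain n where "real_of_rat (q n) < of_rat r"
              by (auto simp: eventually_sequentially)
            then have "f (q n) u \<le> f r u" using elim(2) by (simp add: of_rat_less)
            then show ?thesis using v by (auto intro: order_trans)
          qed
          then show "v \<in> {v \<in> space P. quantile (\<lambda>q. f q u) (V v) \<le> x}"
            using v 3 by (auto simp: quantile_le_iff)
        qed (use q in \<open>auto simp: quantile_le_iff\<close>)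
      qed
      moreover have "(\<lambda>n. emeasure P {v \<in> space P. V v \<le> f (q n) u})
          \<longlonglongrightarrow> emeasure P (\<Inter>n. {v \<in> space P. V v \<le> f (q n) u})"
      proof (rule Lim_emeasure_decseq)
        show "range (\<lambda>n. {v \<in> space P. V v \<le> f (q n) u}) \<subseteq> sets P" using borel_measurable_le[OF V borel_measurable_const] by blast
        show "decseq (\<lambda>n. {v \<in> space P. V v \<le> f (q n) u})"
          using elim(2) q(1) by (auto simp: decseq_def intro: order_trans)
      qed simp
      ultimately show ?case using elim(1) by (simp add: unif)
    qed
    have "(\<lambda>n. \<integral>\<^sup>+ u. indicator A u * ennreal (f (q n) u) \<partial>M) \<longlonglongrightarrow> (\<integral>\<^sup>+ u. indicator A u * ?F u \<partial>M)"
    proof (rule nn_integral_dominated_convergence[where w="\<lambda>_. 1"])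
      show "AE u in M. indicator A u * ennreal (f (q n) u) \<le> 1" for n
        using bd by eventually_elim (auto split: split_indicator)
      show "AE u in M. (\<lambda>n. indicator A u * ennreal (f (q n) u)) \<longlonglongrightarrow> indicator A u * ?F u"
        using lim by eventually_elim (auto split: split_indicator)
    qed (use A f Fm in \<open>auto simp: M.emeasure_space_1\<close>)
    moreover have "(\<integral>\<^sup>+ u. indicator A u * ennreal (f (q n) u) \<partial>M) =
        emeasure M ({u \<in> space M. a u \<le> of_rat (q n)} \<inter> A)" for n
    proof -
      have "(\<integral>\<^sup>+ u. indicator A u * ennreal (f (q n) u) \<partial>M) = (\<integral>\<^sup>+ u. ennreal (indicator A u * f (q n) u) \<partial>M)"
        by (intro nn_integral_cong) (simp split: split_indicator)
      also have "\<dots> = ennreal (\<integral>u. indicator A u * f (q n) u \<partial>M)"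
      proof (rule nn_integral_eq_integral)
        show "AE u in M. 0 \<le> indicator A u * f (q n) u"
          using bd by eventually_elim (auto split: split_indicator)
        show "integrable M (\<lambda>u. indicator A u * f (q n) u)"
          using bd A f by (intro M.integrable_const_bound[where B=1])
            (auto elim!: eventually_mono split: split_indicator)
      qed
      finally show ?thesis by (simp add: eq M.emeasure_eq_measure)
    qed
    moreover have "(\<lambda>n. emeasure M ({u \<in> space M. a u \<le> of_rat (q n)} \<inter> A))
        \<longlonglongrightarrow> emeasure M (\<Inter>n. {u \<in> space M. a u \<le> of_rat (q n)} \<inter> A)"
    proof (rule Lim_emeasure_decseq)
      show "range (\<lambda>n. {u \<in> space M. a u \<le> of_rat (q n)} \<inter> A) \<subseteq> sets M"
        using borel_measurable_le[OF a(1) borel_measurable_const] A by blast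
      show "decseq (\<lambda>n. {u \<in> space M. a u \<le> of_rat (q n)} \<inter> A)"
        unfolding decseq_def
      proof (intro allI impI subsetI)
        fix m n u assume "m \<le> n" and u: "u \<in> {u \<in> space M. a u \<le> of_rat (q n)} \<inter> A"
        then have "real_of_rat (q n) \<le> of_rat (q m)"
          using q(1) by (simp add: decseq_def of_rat_less_eq)
        with u show "u \<in> {u \<in> space M. a u \<le> of_rat (q m)} \<inter> A" by simp
      qed
    qed simp
    moreover have "(\<Inter>n. {u \<in> space M. a u \<le> of_rat (q n)} \<inter> A) = {u \<in> space M. a u \<le> x} \<inter> A"
    proof (intro set_eqI iffI)
      fix u assume "u \<in> (\<Inter>n. {u \<in> space M. a u \<le> of_rat (q n)} \<inter> A)"
      then show "u \<in> {u \<in> space M. a u \<le> x} \<inter> A"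
        by (auto intro!: LIMSEQ_le_const[OF q(4)])
    next
      fix u assume u: "u \<in> {u \<in> space M. a u \<le> x} \<inter> A"
      have "a u \<le> of_rat (q n)" for n
        using u spec[OF q(2), of n] by simp
      then show "u \<in> (\<Inter>n. {u \<in> space M. a u \<le> of_rat (q n)} \<inter> A)" using u by simp
    qed
    ultimately show ?thesis using LIMSEQ_unique by simp
  qed
qed

section \<open>Differentiation along finite partitions\<close>

definition cell :: "'a set \<Rightarrow> (nat \<Rightarrow> 'a set) \<Rightarrow> nat \<Rightarrow> 'a \<Rightarrow> 'a set" where
  "cell S A n x = {x' \<in> S. \<forall>i<n. x' \<in> A i \<longleftrightarrow> x \<in> A i}"

text \<open>The conditional probability of C given \<open>A 0\<close>, ...,
  \<open>A (n - 1)\<close>, fixed pointwise by a formula so that it can later depend measurably on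
  parameters. On a cell of measure 0, division by zero makes it 0.\<close>

definition cell_ratio :: "'a measure \<Rightarrow> (nat \<Rightarrow> 'a set) \<Rightarrow> 'a set \<Rightarrow> nat \<Rightarrow> 'a \<Rightarrow> real" where
  "cell_ratio M A C n x = measure M (C \<inter> cell (space M) A n x) / measure M (cell (space M) A n x)"

definition cell_code :: "(nat \<Rightarrow> 'a set) \<Rightarrow> nat \<Rightarrow> 'a \<Rightarrow> nat set" where
  "cell_code A n x = {i. i < n \<and> x \<in> A i}"

text \<open>Constancy on cells stands for measurability with respect to the finite algebra of level
  n; integrals of real functions of this kind are finite sums.\<close>

definition adapted :: "'a measure \<Rightarrow> (nat \<Rightarrow> 'a set) \<Rightarrow> nat \<Rightarrow> ('a \<Rightarrow> 'b) \<Rightarrow> bool" where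
  "adapted M A n h \<longleftrightarrow> (\<exists>h'. \<forall>x\<in>space M. h x = h' (cell_code A n x))"

lemma cell_altdef: "cell S A n x = {x' \<in> S. cell_code A n x' = cell_code A n x}"
  by (auto simp: cell_def cell_code_def)

lemma cell_code_Pow: "cell_code A n x \<in> Pow {..<n}"
  by (auto simp: cell_code_def)

lemma adapted_mono: "adapted M A m h \<Longrightarrow> m \<le> n \<Longrightarrow> adapted M A n h"
proof -
  assume "adapted M A m h" and mn: "m \<le> n"
  then obtain h' where h': "\<forall>x\<in>space M. h x = h' (cell_code A m x)" by (auto simp: adapted_def)
  have "cell_code A m x = cell_code A n x \<inter> {..<m}" for x using mn by (auto simp: cell_code_def)
  with h' have "\<forall>x\<in>space M. h x = h' (cell_code A n x \<inter> {..<m})" by simp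
  then show ?thesis unfolding adapted_def by (rule exI[of _ "\<lambda>I. h' (I \<inter> {..<m})"])
qed

lemma adapted_const: "adapted M A n (\<lambda>_. c)"
  by (auto simp: adapted_def)

lemma adapted_comp2:
  assumes "adapted M A n h1" "adapted M A n h2"
  shows "adapted M A n (\<lambda>x. F (h1 x) (h2 x))"
proof -
  obtain a b where "\<forall>x\<in>space M. h1 x = a (cell_code A n x)" "\<forall>x\<in>space M. h2 x = b (cell_code A n x)"
    using assms by (auto simp: adapted_def)
  then show ?thesis unfolding adapted_def by (intro exI[of _ "\<lambda>I. F (a I) (b I)"]) simp
qed

lemma adapted_comp: "adapted M A n h \<Longrightarrow> adapted M A n (\<lambda>x. F (h x))"
  using adapted_comp2[of M A n h h "\<lambda>x y. F x"] by simp

lemma adapted_cell_ratio: "adapted M A n (cell_ratio M A C n)"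
  unfolding adapted_def cell_ratio_def cell_altdef
  by (rule exI[of _ "\<lambda>I. measure M (C \<inter> {x' \<in> space M. cell_code A n x' = I}) /
    measure M {x' \<in> space M. cell_code A n x' = I}"]) simp

lemma adapted_mem: "i < n \<Longrightarrow> adapted M A n (\<lambda>x. x \<in> A i)"
  unfolding adapted_def by (rule exI[of _ "\<lambda>I. i \<in> I"]) (simp add: cell_code_def)

lemma cell_ratio_bounds:
  assumes "prob_space M" "\<And>i. A i \<in> sets M" 
  shows "0 \<le> cell_ratio M A C n x" "cell_ratio M A C n x \<le> 1"
proof -
  interpret prob_space M by fact
  have "cell (space M) A n x \<in> sets M"
    unfolding cell_def using assms(2) by measurable
  then have "measure M (C \<inter> cell (space M) A n x) \<le> measure M (cell (space M) A n x)"
    by (intro finite_measure_mono) auto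
  then show "cell_ratio M A C n x \<le> 1" by (simp add: cell_ratio_def divide_le_eq)
qed (simp add: cell_ratio_def)

lemma cell_ratio_mono:
  assumes "prob_space M" "\<And>i. A i \<in> sets M" "C \<subseteq> C'" "C' \<in> sets M"
  shows "cell_ratio M A C n x \<le> cell_ratio M A C' n x"
proof -
  interpret prob_space M by fact
  have "cell (space M) A n x \<in> sets M"
    unfolding cell_def using assms(2) by measurable
  then have "measure M (C \<inter> cell (space M) A n x) \<le> measure M (C' \<inter> cell (space M) A n x)"
    using assms by (intro finite_measure_mono) auto
  then show ?thesis by (simp add: cell_ratio_def divide_right_mono)
qed

section \<open>Martingale convergence by orthogonality of increments\<close>

context prob_space
begin

context
  fixes A :: "nat \<Rightarrow> 'a set" and C :: "'a set"
  assumes A: "\<And>i. A i \<in> sets M" and C: "C \<in> sets M"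
begin

private abbreviation "g \<equiv> cell_ratio M A C"
private abbreviation "block n I \<equiv> {x \<in> space M. cell_code A n x = I}"

private lemma block_sets: "block n I \<in> sets M"
proof -
  have "block n I = {x \<in> space M. I \<subseteq> {..<n} \<and> (\<forall>i<n. x \<in> A i \<longleftrightarrow> i \<in> I)}"
    by (auto simp: cell_code_def)
  also have "\<dots> \<in> sets M" using A by measurable
  finally show ?thesis .
qed

private lemma adapted_expand:
  fixes h' :: "nat set \<Rightarrow> real"
  assumes "x \<in> space M"
  shows "h' (cell_code A n x) = (\<Sum>I\<in>Pow {..<n}. h' I * indicator (block n I) x)"
proof -
  have "(\<Sum>I\<in>Pow {..<n}. h' I * indicator (block n I) x) =
      (\<Sum>I\<in>Pow {..<n}. if cell_code A n x = I then h' I else 0)"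
    using assms by (intro sum.cong) (auto simp: indicator_def)
  also have "\<dots> = h' (cell_code A n x)"
    using cell_code_Pow[of A n x] by (subst sum.delta') auto
  finally show ?thesis by simp
qed

lemma adapted_borel_measurable:
  assumes "adapted M A n (h :: 'a \<Rightarrow> real)" shows "h \<in> borel_measurable M"
proof -
  obtain h' where h: "\<And>x. x \<in> space M \<Longrightarrow> h x = h' (cell_code A n x)"
    using assms by (auto simp: adapted_def)
  have "(\<lambda>x. \<Sum>I\<in>Pow {..<n}. h' I * indicator (block n I) x) \<in> borel_measurable M"
    using block_sets by measurable
  then show ?thesis
    by (rule measurable_cong[THEN iffD1, rotated]) (simp only: h adapted_expand)
qed

lemma adapted_integrable:
  assumes "adapted M A n (h :: 'a \<Rightarrow> real)" shows "integrable M h"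
proof -
  obtain h' where h: "\<And>x. x \<in> space M \<Longrightarrow> h x = h' (cell_code A n x)"
    using assms by (auto simp: adapted_def)
  have "integrable M (\<lambda>x. \<Sum>I\<in>Pow {..<n}. h' I * indicator (block n I) x)"
    using block_sets by (intro Bochner_Integration.integrable_sum integrable_mult_right
      integrable_real_indicator emeasure_finite) (auto simp: less_top[symmetric])
  then show ?thesis
    by (rule Bochner_Integration.integrable_cong[THEN iffD1, rotated 2]) (simp_all only: h adapted_expand)
qed

private lemma integral_block_sum:
  fixes h' :: "nat set \<Rightarrow> real" assumes D: "D \<in> sets M"
  shows "(\<integral>x. h' (cell_code A n x) * indicator D x \<partial>M) = (\<Sum>I\<in>Pow {..<n}. h' I * prob (D \<inter> block n I))"
proof -
  have "(\<integral>x. h' (cell_code A n x) * indicator D x \<partial>M) =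
      (\<integral>x. (\<Sum>I\<in>Pow {..<n}. h' I * indicator (D \<inter> block n I) x) \<partial>M)"
  proof (rule Bochner_Integration.integral_cong[OF refl])
    fix x assume x: "x \<in> space M"
    show "h' (cell_code A n x) * indicator D x = (\<Sum>I\<in>Pow {..<n}. h' I * indicator (D \<inter> block n I) x)"
      unfolding adapted_expand[OF x, of h' n] sum_distrib_right
      by (intro sum.cong refl) (simp only: indicator_inter_arith mult.assoc mult.commute[of "indicator D x"])
  qed
  also have "\<dots> = (\<Sum>I\<in>Pow {..<n}. h' I * prob (D \<inter> block n I))"
  proof -
    have DB: "D \<inter> block n I \<in> sets M" for I using D block_sets by (rule sets.Int)
    then have "integrable M (\<lambda>x. h' I * indicator (D \<inter> block n I) x)" for I
      by (intro integrable_mult_right integrable_real_indicator emeasure_finite)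
        (auto simp: less_top[symmetric])
    moreover have "(\<integral>x. h' I * indicator (D \<inter> block n I) x \<partial>M) = h' I * prob (D \<inter> block n I)" for I
    proof -
      have "D \<inter> block n I \<inter> space M = D \<inter> block n I"
        using sets.sets_into_space[OF DB[of I]] by blast
      then show ?thesis by (simp only: integral_mult_right_zero Bochner_Integration.integral_indicator)
    qed
    ultimately show ?thesis by (simp only: Bochner_Integration.integral_sum)
  qed
  finally show ?thesis .
qed

text \<open>The defining property of a conditional expectation, checked block by block. A block of
  probability 0 is consistent with it because its part in C has probability 0 as well.\<close>

lemma integral_adapted_cell_ratio:
  assumes "adapted M A n (h :: 'a \<Rightarrow> real)"
  shows "(\<integral>x. h x * g n x \<partial>M) = (\<integral>x. h x * indicator C x \<partial>M)"
proof -
  obtain h' where h: "\<And>x. x \<in> space M \<Longrightarrow> h x = h' (cell_code A n x)"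
    using assms by (auto simp: adapted_def)
  define r where "r I = prob (C \<inter> block n I) / prob (block n I)" for I
  have "(\<integral>x. h x * g n x \<partial>M) = (\<integral>x. (h' (cell_code A n x) * r (cell_code A n x)) * indicator (space M) x \<partial>M)"
    by (intro Bochner_Integration.integral_cong) (auto simp: h cell_ratio_def cell_altdef r_def)
  also have "\<dots> = (\<Sum>I\<in>Pow {..<n}. h' I * r I * prob (space M \<inter> block n I))"
    by (rule integral_block_sum) simp
  also have "\<dots> = (\<Sum>I\<in>Pow {..<n}. h' I * prob (C \<inter> block n I))"
  proof (rule sum.cong[OF refl])
    fix I
    have "prob (C \<inter> block n I) \<le> prob (block n I)"
      by (intro finite_measure_mono block_sets) auto
    moreover have "space M \<inter> block n I = block n I" by auto
    ultimately show "h' I * r I * prob (space M \<inter> block n I) = h' I * prob (C \<inter> block n I)"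
      using measure_nonneg[of M "C \<inter> block n I"]
      by (cases "prob (block n I) = 0") (simp_all add: r_def)
  qed
  also have "\<dots> = (\<integral>x. h' (cell_code A n x) * indicator C x \<partial>M)"
    by (rule integral_block_sum[symmetric, OF C])
  also have "\<dots> = (\<integral>x. h x * indicator C x \<partial>M)"
    by (intro Bochner_Integration.integral_cong) (auto simp: h)
  finally show ?thesis .
qed

private lemma adapted_g: "m \<le> n \<Longrightarrow> adapted M A n (g m)"
  by (rule adapted_mono[OF adapted_cell_ratio])

text \<open>Both sides are the integral of h over C.\<close>

private lemma martingale:
  assumes h: "adapted M A m (h :: 'a \<Rightarrow> real)" and mn: "m \<le> N"
  shows "(\<integral>x. h x * g N x \<partial>M) = (\<integral>x. h x * g m x \<partial>M)"
  using integral_adapted_cell_ratio[OF h] integral_adapted_cell_ratio[OF adapted_mono[OF h mn]] by simp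

text \<open>The cross term is the integral of \<open>h x * (g N x - g m x)\<close> with h adapted at
  level m, so the martingale property cancels it. The weight T will localise to the event of a first
  exit at time m.\<close>

private lemma pythagoras:
  assumes T: "adapted M A m (T :: 'a \<Rightarrow> real)" and nm: "n \<le> m" and mN: "m \<le> N"
  shows "(\<integral>x. T x * (g N x - g n x)\<^sup>2 \<partial>M) =
    (\<integral>x. T x * (g N x - g m x)\<^sup>2 \<partial>M) + (\<integral>x. T x * (g m x - g n x)\<^sup>2 \<partial>M)"
proof -
  define h where "h x = 2 * T x * (g m x - g n x)" for x
  have h: "adapted M A m h"
    unfolding h_def by (intro adapted_comp2[where F="(*)"] adapted_comp2[where F="(-)"] adapted_const T adapted_g nm order_refl)
  note TN = adapted_mono[OF T mN] and hN = adapted_mono[OF h mN]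
  have i: "integrable M (\<lambda>x. T x * (g k x - g l x)\<^sup>2)" if "k \<le> N" "l \<le> N" for k l
    by (intro adapted_integrable[of N] adapted_comp2[where F="(*)"] adapted_comp[where F="\<lambda>x. x\<^sup>2"]
        adapted_comp2[where F="(-)"] TN adapted_g that)
  have j: "integrable M (\<lambda>x. h x * g k x)" if "k \<le> N" for k
    by (intro adapted_integrable[of N] adapted_comp2[where F="(*)"] hN adapted_g that)
  have "(\<integral>x. T x * (g N x - g n x)\<^sup>2 \<partial>M) =
      (\<integral>x. T x * (g N x - g m x)\<^sup>2 + T x * (g m x - g n x)\<^sup>2 + (h x * g N x - h x * g m x) \<partial>M)"
    by (intro Bochner_Integration.integral_cong) (auto simp: h_def power2_eq_square algebra_simps)
  also have "\<dots> = (\<integral>x. T x * (g N x - g m x)\<^sup>2 \<partial>M) + (\<integral>x. T x * (g m x - g n x)\<^sup>2 \<partial>M) +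
      ((\<integral>x. h x * g N x \<partial>M) - (\<integral>x. h x * g m x \<partial>M))"
    using nm mN by (simp add: i j)
  also have "(\<integral>x. h x * g N x \<partial>M) = (\<integral>x. h x * g m x \<partial>M)" by (rule martingale[OF h mN])
  finally show ?thesis by simp
qed

text \<open>The squared L2 norm of \<open>g n\<close>. Its increments are squared L2 distances;
  being monotone and bounded by 1, it controls all late oscillation.\<close>

private definition "energy n = (\<integral>x. (g n x)\<^sup>2 \<partial>M)"

private lemma energy_diff:
  assumes "n \<le> N" shows "(\<integral>x. (g N x - g n x)\<^sup>2 \<partial>M) = energy N - energy n"
proof -
  have i: "integrable M (\<lambda>x. g k x * g l x)" if "k \<le> N" "l \<le> N" for k l
    by (intro adapted_integrable[of N] adapted_comp2[where F="(*)"] adapted_g that)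
  have "(\<integral>x. (g N x - g n x)\<^sup>2 \<partial>M) = (\<integral>x. g N x * g N x - 2 * (g n x * g N x) + g n x * g n x \<partial>M)"
    by (intro Bochner_Integration.integral_cong) (auto simp: power2_eq_square algebra_simps)
  also have "\<dots> = energy N - 2 * (\<integral>x. g n x * g N x \<partial>M) + energy n"
    using assms by (simp add: i energy_def power2_eq_square)
  also have "(\<integral>x. g n x * g N x \<partial>M) = energy n"
    using martingale[OF adapted_g[OF order_refl] assms] by (simp add: energy_def power2_eq_square)
  finally show ?thesis by simp
qed

private lemma g_bounds: "0 \<le> g n x" "g n x \<le> 1"
  using cell_ratio_bounds[OF prob_space_axioms A] by auto

text \<open>Kolmogorov's inequality, by splitting according to the first exit time.\<close>

private lemma maximal_inequality:
  assumes e: "0 < e" and nN: "n \<le> N"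
  shows "e\<^sup>2 * prob {x \<in> space M. \<exists>m\<in>{n..N}. e < \<bar>g m x - g n x\<bar>} \<le> energy N - energy n"
proof -
  \<comment> \<open>\<open>?T m\<close> is the event that the deviation from \<open>g n\<close>
    exceeds e for the first time at m. It is decided at level m, as the weight in
    \<open>pythagoras\<close> must be.\<close>
  let ?T = "\<lambda>m. {x \<in> space M. e < \<bar>g m x - g n x\<bar> \<and> (\<forall>k\<in>{n..<m}. \<bar>g k x - g n x\<bar> \<le> e)}"
  have gm[measurable]: "g k \<in> borel_measurable M" for k by (rule adapted_borel_measurable[OF adapted_g[OF order_refl]])
  have T[measurable]: "?T m \<in> sets M" for m by measurable
  have Tad: "adapted M A m (indicator (?T m) :: 'a \<Rightarrow> real)" if m: "m \<in> {n..N}" for m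
  proof -
    have "adapted M A m (\<lambda>x. \<forall>k\<in>K. \<bar>g k x - g n x\<bar> \<le> e)" if "finite K" "K \<subseteq> {n..<m}" for K
      using that
    proof induction
      case empty show ?case by (simp add: adapted_const)
    next
      case (insert k K)
      then show ?case using m
        by (auto intro!: adapted_comp2[where F="(\<and>)"] adapted_comp[where F="\<lambda>x. \<bar>x\<bar> \<le> e"]
            adapted_comp2[where F="(-)"] adapted_g)
    qed
    from this[of "{n..<m}"] have "adapted M A m (\<lambda>x. of_bool (e < \<bar>g m x - g n x\<bar> \<and> (\<forall>k\<in>{n..<m}. \<bar>g k x - g n x\<bar> \<le> e)) :: real)"
      using m by (intro adapted_comp[where F=of_bool] adapted_comp2[where F="(\<and>)"] adapted_comp[where F="\<lambda>x. e < \<bar>x\<bar>"]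
            adapted_comp2[where F="(-)"] adapted_g) auto
    then show ?thesis by (auto simp: adapted_def indicator_def of_bool_def)
  qed
  have i: "integrable M (\<lambda>x. indicator (?T m) x * (g k x - g l x)\<^sup>2)" if "m \<in> {n..N}" "k \<le> N" "l \<le> N" for m k l
    using that by (intro adapted_integrable[of N] adapted_comp2[where F="(*)"] adapted_comp[where F="\<lambda>x. x\<^sup>2"]
        adapted_comp2[where F="(-)"] adapted_g adapted_mono[OF Tad]) auto
  have i2: "integrable M (\<lambda>x. (g N x - g n x)\<^sup>2)"
    using nN by (intro adapted_integrable[of N] adapted_comp[where F="\<lambda>x. x\<^sup>2"] adapted_comp2[where F="(-)"] adapted_g) auto
  have disj: "disjoint_family_on ?T {n..N}"
    unfolding disjoint_family_on_def
  proof (intro ballI impI)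
    fix a b assume "a \<in> {n..N}" "b \<in> {n..N}" "a \<noteq> b"
    then show "?T a \<inter> ?T b = {}" by (cases "a < b") force+
  qed
  have un: "{x \<in> space M. \<exists>m\<in>{n..N}. e < \<bar>g m x - g n x\<bar>} = (\<Union>m\<in>{n..N}. ?T m)"
  proof (intro set_eqI iffI)
    fix x assume "x \<in> {x \<in> space M. \<exists>m\<in>{n..N}. e < \<bar>g m x - g n x\<bar>}"
    then have x: "x \<in> space M" and ex: "\<exists>m. m \<in> {n..N} \<and> e < \<bar>g m x - g n x\<bar>" by auto
    define m where "m = (LEAST m. m \<in> {n..N} \<and> e < \<bar>g m x - g n x\<bar>)"
    have m: "m \<in> {n..N}" "e < \<bar>g m x - g n x\<bar>" using LeastI_ex[OF ex] by (auto simp: m_def)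
    have "\<bar>g k x - g n x\<bar> \<le> e" if "k \<in> {n..<m}" for k
      using not_less_Least[of k "\<lambda>m. m \<in> {n..N} \<and> e < \<bar>g m x - g n x\<bar>", folded m_def] that m(1)
      by (simp add: not_less)
    with x m show "x \<in> (\<Union>m\<in>{n..N}. ?T m)" by blast
  qed auto
  have "e\<^sup>2 * prob {x \<in> space M. \<exists>m\<in>{n..N}. e < \<bar>g m x - g n x\<bar>} = (\<Sum>m\<in>{n..N}. e\<^sup>2 * prob (?T m))"
    unfolding un by (subst finite_measure_finite_Union[OF _ _ disj]) (auto simp: sum_distrib_left)
  also have "\<dots> \<le> (\<Sum>m\<in>{n..N}. (\<integral>x. indicator (?T m) x * (g N x - g n x)\<^sup>2 \<partial>M))"
  proof (rule sum_mono)
    fix m assume m: "m \<in> {n..N}"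
    have "e\<^sup>2 * prob (?T m) = (\<integral>x. indicator (?T m) x * e\<^sup>2 \<partial>M)" by simp
    also have "\<dots> \<le> (\<integral>x. indicator (?T m) x * (g m x - g n x)\<^sup>2 \<partial>M)"
    proof (rule integral_mono)
      show "integrable M (\<lambda>x. indicator (?T m) x * (g m x - g n x)\<^sup>2)" using m nN by (intro i) auto
      fix x show "indicator (?T m) x * e\<^sup>2 \<le> indicator (?T m) x * (g m x - g n x)\<^sup>2"
      proof (cases "x \<in> ?T m")
        case True
        then have "e\<^sup>2 \<le> \<bar>g m x - g n x\<bar>\<^sup>2" using e by (intro power_mono) auto
        then show ?thesis by (simp add: mult_left_mono)
      qed simp
    qed (simp add: less_top[symmetric])
    \<comment> \<open>On the exit event, the squared deviation at the final time N dominates in mean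
      the one at the exit time: \<open>pythagoras\<close> leaves a nonnegative remainder.\<close>
    also have "\<dots> \<le> (\<integral>x. indicator (?T m) x * (g N x - g n x)\<^sup>2 \<partial>M)"
      using pythagoras[OF Tad[OF m], of n N] m by (auto intro!: Bochner_Integration.integral_nonneg)
    finally show "e\<^sup>2 * prob (?T m) \<le> (\<integral>x. indicator (?T m) x * (g N x - g n x)\<^sup>2 \<partial>M)" .
  qed
  also have "\<dots> = (\<integral>x. (\<Sum>m\<in>{n..N}. indicator (?T m) x * (g N x - g n x)\<^sup>2) \<partial>M)"
    using nN by (intro Bochner_Integration.integral_sum[symmetric] i) auto
  also have "\<dots> \<le> (\<integral>x. (g N x - g n x)\<^sup>2 \<partial>M)"
  proof (rule integral_mono[OF _ i2])
    show "integrable M (\<lambda>x. \<Sum>m\<in>{n..N}. indicator (?T m) x * (g N x - g n x)\<^sup>2)"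
      using nN by (intro Bochner_Integration.integrable_sum i) auto
    fix x
    have "(\<Sum>m\<in>{n..N}. indicator (?T m) x :: real) = indicator (\<Union>m\<in>{n..N}. ?T m) x"
      by (rule indicator_UN_disjoint[symmetric, OF _ disj]) simp
    also have "\<dots> \<le> 1" by (rule indicator_le_1)
    finally have "(\<Sum>m\<in>{n..N}. indicator (?T m) x :: real) \<le> 1" .
    then have "(\<Sum>m\<in>{n..N}. indicator (?T m) x) * (g N x - g n x)\<^sup>2 \<le> 1 * (g N x - g n x)\<^sup>2"
      by (intro mult_right_mono) auto
    then show "(\<Sum>m\<in>{n..N}. indicator (?T m) x * (g N x - g n x)\<^sup>2) \<le> (g N x - g n x)\<^sup>2"
      by (simp add: sum_distrib_right)
  qed
  also have "\<dots> = energy N - energy n" by (rule energy_diff[OF nN])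
  finally show ?thesis .
qed

text \<open>The energies converge to some l, so the maximal inequality bounds the probability of a
  deviation above e after time n by (l - energy n) / e^2, which tends to 0. Off a null set the
  ratios are therefore Cauchy.\<close>

lemma AE_convergent_cell_ratio: "AE x in M. convergent (\<lambda>n. g n x)"
proof -
  have gm[measurable]: "g k \<in> borel_measurable M" for k by (rule adapted_borel_measurable[OF adapted_g[OF order_refl]])
  have inc: "incseq energy"
  proof (unfold incseq_def, intro allI impI)
    fix n m :: nat assume "n \<le> m"
    have "0 \<le> (\<integral>x. (g m x - g n x)\<^sup>2 \<partial>M)" by (intro Bochner_Integration.integral_nonneg) simp
    then show "energy n \<le> energy m" using energy_diff[OF \<open>n \<le> m\<close>] by simp
  qed
  have "energy n \<le> 1" for n
  proof -
    have "energy n \<le> (\<integral>x. 1 \<partial>M)" unfolding energy_def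
      by (intro integral_mono adapted_integrable[of n] adapted_comp[where F="\<lambda>x. x\<^sup>2"] adapted_g adapted_const)
        (auto simp: power_le_one g_bounds)
    then show ?thesis by (simp add: prob_space)
  qed
  then obtain l where l: "energy \<longlonglongrightarrow> l" "\<And>n. energy n \<le> l"
    using incseq_convergent[OF inc, of 1] by auto
  have main: "AE x in M. \<exists>n. \<forall>m\<ge>n. \<bar>g m x - g n x\<bar> \<le> e" if e: "0 < e" for e
  proof -
    let ?B = "\<lambda>n. {x \<in> space M. \<exists>m\<ge>n. e < \<bar>g m x - g n x\<bar>}"
    have B: "e\<^sup>2 * prob (?B n) \<le> l - energy n" for n
    proof (rule LIMSEQ_le_const2)
      let ?S = "\<lambda>k. {x \<in> space M. \<exists>m\<in>{n..n+k}. e < \<bar>g m x - g n x\<bar>}"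
      have "(\<lambda>k. prob (?S k)) \<longlonglongrightarrow> prob (\<Union>k. ?S k)"
      proof (rule finite_Lim_measure_incseq)
        show "range ?S \<subseteq> sets M" by (auto intro!: sets.sets_Collect_finite_Ex) 
        show "incseq ?S" by (force simp: incseq_def)
      qed
      moreover have "(\<Union>k. ?S k) = ?B n"
      proof (intro set_eqI iffI)
        fix x assume "x \<in> ?B n"
        then obtain m where "x \<in> space M" "n \<le> m" "e < \<bar>g m x - g n x\<bar>" by auto
        then show "x \<in> (\<Union>k. ?S k)" by (intro UN_I[of "m - n"]) auto
      qed auto
      ultimately show "(\<lambda>k. e\<^sup>2 * prob (?S k)) \<longlonglongrightarrow> e\<^sup>2 * prob (?B n)"
        by (intro tendsto_mult tendsto_const) simp
      have "e\<^sup>2 * prob (?S k) \<le> l - energy n" for k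
        using maximal_inequality[OF e, of n "n + k"] l(2)[of "n + k"] by simp
      then show "\<exists>K. \<forall>k\<ge>K. e\<^sup>2 * prob (?S k) \<le> l - energy n" by blast
    qed
    have "e\<^sup>2 * prob (\<Inter>n. ?B n) \<le> l - energy n" for n
    proof -
      have "prob (\<Inter>n. ?B n) \<le> prob (?B n)" by (rule finite_measure_mono) auto
      then show ?thesis using B[of n] e by (meson mult_left_mono order_trans zero_le_power2)
    qed
    then have "e\<^sup>2 * prob (\<Inter>n. ?B n) \<le> l - l"
      by (intro LIMSEQ_le_const[OF tendsto_diff[OF tendsto_const l(1)]]) auto
    then have "prob (\<Inter>n. ?B n) = 0"
      using e measure_nonneg[of M "\<Inter>n. ?B n"] by (simp add: mult_le_0_iff)
    then have "(\<Inter>n. ?B n) \<in> null_sets M"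
      by (auto simp: null_sets_def emeasure_eq_measure)
    then show ?thesis by (rule AE_I') (auto simp: not_le)
  qed
  have "AE x in M. \<forall>j. \<exists>n. \<forall>m\<ge>n. \<bar>g m x - g n x\<bar> \<le> inverse (real (Suc j))"
    unfolding AE_all_countable by (intro allI main) simp
  then show ?thesis
  proof eventually_elim
    case (elim x)
    have "Cauchy (\<lambda>n. g n x)"
    proof (rule metric_CauchyI)
      fix e :: real assume "0 < e"
      then obtain j where j: "inverse (real (Suc j)) < e / 2" using reals_Archimedean[of "e/2"] by auto
      obtain n where n: "\<And>m. m \<ge> n \<Longrightarrow> \<bar>g m x - g n x\<bar> \<le> inverse (real (Suc j))" using elim by blast
      have "dist (g a x) (g b x) < e" if "n \<le> a" "n \<le> b" for a b
        using n[OF that(1)] n[OF that(2)] j by (auto simp: dist_real_def)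
      then show "\<exists>n. \<forall>a\<ge>n. \<forall>b\<ge>n. dist (g a x) (g b x) < e" by blast
    qed
    then show ?case by (rule Cauchy_convergent)
  qed
qed

text \<open>Levy's upward theorem for an indicator. On sets decided at a finite level the integrals
  of the ratios are eventually constant, and dominated convergence passes to the limit; these sets
  form an intersection-stable generator, and a Dynkin argument does the rest.\<close>

lemma integral_lim_cell_ratio:
  assumes D: "D \<in> sigma_sets (space M) (range A)"
  shows "(\<integral>x. indicator D x * lim (\<lambda>n. g n x) \<partial>M) = prob (C \<inter> D)"
proof -
  have gm[measurable]: "g k \<in> borel_measurable M" for k by (rule adapted_borel_measurable[OF adapted_g[OF order_refl]])
  let ?L = "\<lambda>x. lim (\<lambda>n. g n x)"
  have L: "?L \<in> borel_measurable M" by measurable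
  have lim: "AE x in M. (\<lambda>n. g n x) \<longlonglongrightarrow> ?L x"
    using AE_convergent_cell_ratio by eventually_elim (simp add: convergent_LIMSEQ_iff)
  have bd: "AE x in M. ?L x \<in> {0..1}"
    using lim
  proof eventually_elim
    case (elim x)
    show ?case
      using LIMSEQ_le_const[OF elim, of 0] LIMSEQ_le_const2[OF elim, of 1] by (auto simp: g_bounds)
  qed
  have int: "integrable M (\<lambda>x. indicator D x * ?L x)" if "D \<in> sets M" for D
  proof (rule integrable_const_bound[where B=1])
    show "AE x in M. norm (indicator D x * ?L x) \<le> 1"
      using bd by eventually_elim (auto split: split_indicator)
  qed (use that L in measurable)
  define G where "G = {D. D \<subseteq> space M \<and> (\<exists>n. adapted M A n (\<lambda>x. x \<in> D))}"
  have AG: "range A \<subseteq> G"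
  proof
    fix D assume "D \<in> range A"
    then obtain i where i: "D = A i" by blast
    have "adapted M A (Suc i) (\<lambda>x. x \<in> A i)" by (rule adapted_mem) simp
    then show "D \<in> G" using sets.sets_into_space[OF A[of i]] unfolding G_def i by blast
  qed
  have GM: "G \<subseteq> sets M"
  proof
    fix D assume "D \<in> G"
    then obtain n where n: "D \<subseteq> space M" "adapted M A n (\<lambda>x. x \<in> D)" by (auto simp: G_def)
    from adapted_borel_measurable[OF adapted_comp[OF n(2), of of_bool]]
    have "{x \<in> space M. (of_bool (x \<in> D) :: real) = 1} \<in> sets M" by measurable
    also have "{x \<in> space M. (of_bool (x \<in> D) :: real) = 1} = D" using n(1) by auto
    finally show "D \<in> sets M" .
  qed
  have sG: "D \<in> sets M" if "D \<in> sigma_sets (space M) G" for D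
    using sets.sigma_sets_subset[OF GM] that by blast
  have G: "(\<integral>x. indicator D x * ?L x \<partial>M) = prob (C \<inter> D)" if "D \<in> G" for D
  proof -
    note DG = that
    obtain n where n: "adapted M A n (\<lambda>x. x \<in> D)" using DG by (auto simp: G_def)
    have DM: "D \<in> sets M" using DG GM by blast
    have ad: "adapted M A k (indicator D :: 'a \<Rightarrow> real)" if "n \<le> k" for k
      using adapted_comp[OF adapted_mono[OF n that], of "of_bool :: bool \<Rightarrow> real"]
      by (simp add: indicator_def[abs_def] of_bool_def)
    have "(\<lambda>k. \<integral>x. indicator D x * g k x \<partial>M) \<longlonglongrightarrow> (\<integral>x. indicator D x * ?L x \<partial>M)"
    proof (rule integral_dominated_convergence[where w="\<lambda>_. 1"])
      show "AE x in M. (\<lambda>i. indicator D x * g i x) \<longlonglongrightarrow> indicator D x * ?L x"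
        using lim by eventually_elim (intro tendsto_mult tendsto_const)
      show "AE x in M. norm (indicator D x * g i x) \<le> 1" for i
        by (rule AE_I2) (auto simp: g_bounds split: split_indicator)
    qed (use DM L in auto)
    moreover have "(\<lambda>k. \<integral>x. indicator D x * g k x \<partial>M) \<longlonglongrightarrow> prob (C \<inter> D)"
    proof (rule Lim_transform_eventually[OF tendsto_const])
      have "prob (C \<inter> D) = (\<integral>x. indicator D x * g k x \<partial>M)" if "n \<le> k" for k
      proof -
        have "prob (C \<inter> D) = (\<integral>x. indicator (C \<inter> D) x \<partial>M)"
          using C DM by (simp add: Int_absorb2 sets.sets_into_space)
        also have "\<dots> = (\<integral>x. indicator D x * indicator C x \<partial>M)"
          by (intro Bochner_Integration.integral_cong) (auto split: split_indicator)
        finally show ?thesis using integral_adapted_cell_ratio[OF ad[OF that]] by simp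
      qed
      then show "\<forall>\<^sub>F k in sequentially. prob (C \<inter> D) = (\<integral>x. indicator D x * g k x \<partial>M)"
        by (auto simp: eventually_sequentially)
    qed
    ultimately show ?thesis by (rule LIMSEQ_unique)
  qed
  have "Int_stable G"
  proof (rule Int_stableI)
    fix D E assume "D \<in> G" "E \<in> G"
    then obtain m n where mn: "D \<subseteq> space M" "adapted M A m (\<lambda>x. x \<in> D)" "adapted M A n (\<lambda>x. x \<in> E)"
      by (auto simp: G_def)
    have "adapted M A (max m n) (\<lambda>x. x \<in> D \<and> x \<in> E)"
      by (intro adapted_comp2[where F="(\<and>)"] adapted_mono[OF mn(2)] adapted_mono[OF mn(3)]) auto
    then show "D \<inter> E \<in> G" using mn(1) by (auto simp: G_def)
  qed
  moreover have "G \<subseteq> Pow (space M)" by (auto simp: G_def)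
  moreover have "D \<in> sigma_sets (space M) G" using D sigma_sets_mono'[OF AG] by blast
  ultimately show ?thesis
  proof (induction rule: sigma_sets_induct_disjoint)
    case (basic D)
    then show ?case by (rule G)
  next
    case empty show ?case by simp
  next
    case (compl D)
    have DM: "D \<in> sets M" by (rule sG[OF compl.hyps])
    have full: "(\<integral>x. indicator (space M) x * ?L x \<partial>M) = prob (C \<inter> space M)"
      by (rule G) (auto simp: G_def adapted_def)
    have "(\<integral>x. indicator (space M - D) x * ?L x \<partial>M) =
        (\<integral>x. indicator (space M) x * ?L x - indicator D x * ?L x \<partial>M)"
      by (intro Bochner_Integration.integral_cong) (auto split: split_indicator)
    also have "\<dots> = prob (C \<inter> space M) - prob (C \<inter> D)"
      using int[OF DM] int[OF sets.top] by (subst Bochner_Integration.integral_diff) (auto simp: full compl)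
    also have "\<dots> = prob (C \<inter> (space M - D))"
    proof -
      have "C \<inter> space M = C" "C \<inter> (space M - D) = C - D"
        using sets.sets_into_space[OF C] by auto
      then show ?thesis using finite_measure_Diff'[OF C DM] by simp
    qed
    finally show ?case .
  next
    case (union F)
    have FM: "F i \<in> sets M" for i using sG union.hyps by blast
    have F: "(\<integral>x. indicator (F i) x * ?L x \<partial>M) = prob (C \<inter> F i)" for i using union by simp
    have "(\<integral>x. indicator (\<Union>i. F i) x * ?L x \<partial>M) = (\<Sum>i. \<integral>x. indicator (F i) x * ?L x \<partial>M)"
      using lebesgue_integral_countable_add[of F M ?L] FM union.hyps int[of "\<Union>i. F i"]
      by (auto simp: set_lebesgue_integral_def set_integrable_def disjoint_family_on_def)
    moreover have "(\<lambda>i. prob (C \<inter> F i)) sums prob (\<Union>i. C \<inter> F i)"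
      using FM C union.hyps by (intro finite_measure_UNION) (auto simp: disjoint_family_on_def)
    ultimately show ?case by (simp add: F sums_unique[symmetric])
  qed
qed

end

end

section \<open>Perfectness of probability measures\<close>

lemma range_hcube_nth: "range hcube_nth = {x. \<forall>i. x i \<in> {0..1}}"
proof (intro set_eqI iffI)
  fix x :: "nat \<Rightarrow> real" assume "x \<in> {x. \<forall>i. x i \<in> {0..1}}"
  then have "hcube_nth (Abs_hcube x) = x" by (subst Abs_hcube_inverse) auto
  then show "x \<in> range hcube_nth" by (metis rangeI)
qed (use hcube_nth_mem in auto)

lemma closed_range_hcube_nth: "closed (range hcube_nth)"
proof -
  have "range hcube_nth = (\<Inter>i. (\<lambda>x. x i) -` {0..1})" by (auto simp: range_hcube_nth)
  also have "closed \<dots>"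
    by (intro closed_INT ballI closed_vimage closed_atLeastAtMost continuous_on_product_coordinates)
  finally show ?thesis .
qed

text \<open>Compactness refers to the space of all real sequences, where finite Borel measures are
  inner regular; compact sets return to the cube as preimages under \<open>hcube_nth\<close>. The
  range of \<open>hcube_nth\<close> is closed, so the Borel set can be cut down to it
  beforehand.\<close>

lemma probs_Omega_inner_regular:
  assumes P: "P \<in> probs_Omega" and S: "S \<in> sets B_Omega" and e: "0 < (e::real)"
  obtains K where "compact K" "K \<subseteq> range hcube_nth" "hcube_nth -` K \<subseteq> S" "emeasure P (S - hcube_nth -` K) \<le> ennreal e"
proof -
  note [simp] = probs_OmegaD[OF P]
  interpret P: prob_space P by simp
  have nth: "hcube_nth \<in> B_Omega \<rightarrow>\<^sub>M borel"
    by (rule measurable_hcube_borel_imp_B_Omega[OF measurable_hcube_nth])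
  then have nthP: "hcube_nth \<in> P \<rightarrow>\<^sub>M borel" by (simp add: measurable_probs_Omega[OF P])
  obtain B1 B2 where B: "B1 \<in> sets hcube_borel" "B2 \<in> sets hcube_borel" "B1 \<subseteq> S" "S \<subseteq> B2"
    "emeasure P (B2 - B1) = 0" by (rule probs_Omega_sandwich[OF P S])
  obtain B0 where B0: "B0 \<in> sets borel" "B1 = hcube_nth -` B0"
    using B(1) by (auto simp: hcube_borel_def sets_vimage_algebra2)
  define B' where "B' = B0 \<inter> range hcube_nth"
  have B': "B' \<in> sets borel" "B1 = hcube_nth -` B'"
    using B0 closed_range_hcube_nth by (auto simp: B'_def)
  let ?M = "distr P borel hcube_nth"
  interpret M: prob_space ?M by (rule P.prob_space_distr[OF nthP])
  have "emeasure ?M B' = (SUP K\<in>{K. K \<subseteq> B' \<and> compact K}. emeasure ?M K)"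
    by (rule inner_regular) (auto simp: B' M.emeasure_space_1)
  moreover have "\<exists>K. K \<subseteq> B' \<and> compact K \<and> emeasure ?M B' \<le> emeasure ?M K + ennreal e"
  \<comment> \<open>Subtraction in \<open>ennreal\<close> is truncated, so the approximation from
    below is run for mass above e; for smaller mass the empty set serves.\<close>
  proof (cases "emeasure ?M B' \<le> ennreal e")
    case True
    then show ?thesis by (intro exI[of _ "{}"]) auto
  next
    case False
    then have "emeasure ?M B' - ennreal e < emeasure ?M B'"
      using e by (intro ennreal_between) (auto simp: M.emeasure_eq_measure less_top[symmetric])
    then obtain K where K: "K \<subseteq> B'" "compact K" "emeasure ?M B' - ennreal e < emeasure ?M K"
      unfolding calculation by (auto simp: less_SUP_iff)
    then have "emeasure ?M B' \<le> emeasure ?M K + ennreal e"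
      by (metis add.commute ennreal_minus_le_iff ennreal_neq_top less_imp_le)
    with K show ?thesis by blast
  qed
  ultimately obtain K where K: "K \<subseteq> B'" "compact K" "emeasure ?M B' \<le> emeasure ?M K + ennreal e" by blast
  have Kb: "K \<in> sets borel" using K(2) by (rule borel_compact)
  have vK: "hcube_nth -` K \<in> sets B_Omega" using measurable_sets[OF nth Kb] by simp
  have B1: "B1 \<in> sets B_Omega" by (rule sets_hcube_borel_le[OF B(1)])
  have "emeasure P B1 \<le> emeasure P (hcube_nth -` K) + ennreal e"
    using K(3) by (simp add: emeasure_distr[OF nthP] B' Kb)
  moreover have "emeasure P (B1 - hcube_nth -` K) = emeasure P B1 - emeasure P (hcube_nth -` K)"
    using K(1) vK B1 B'(2) by (intro emeasure_Diff) (auto simp: P.emeasure_eq_measure)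
  ultimately have "emeasure P (B1 - hcube_nth -` K) \<le> ennreal e"
    by (simp add: ennreal_minus_le_iff P.emeasure_eq_measure)
  moreover have "emeasure P (S - hcube_nth -` K) \<le> emeasure P ((B2 - B1) \<union> (B1 - hcube_nth -` K))"
    using B vK B1 by (intro emeasure_mono) (auto intro: sets_hcube_borel_le)
  moreover have "\<dots> \<le> emeasure P (B2 - B1) + emeasure P (B1 - hcube_nth -` K)"
    using B vK B1 by (intro emeasure_subadditive) (auto intro: sets_hcube_borel_le)
  ultimately have "emeasure P (S - hcube_nth -` K) \<le> ennreal e"
    unfolding B(5) by (auto intro: order_trans)
  moreover have "K \<subseteq> range hcube_nth" "hcube_nth -` K \<subseteq> S"
    using K(1) B(3) by (auto simp: B'(2)) (auto simp: B'_def)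
  ultimately show ?thesis using that K(2) by blast
qed

text \<open>Lusin's argument: on a compact set of almost full measure \<open>T\<close> is continuous, so the image
  of that set is compact.\<close>

lemma probs_Omega_compact_image:
  fixes T :: "hcube \<Rightarrow> 'b::{second_countable_topology, t2_space}"
  assumes P: "P \<in> probs_Omega" and S: "S \<in> sets B_Omega" and T: "T \<in> B_Omega \<rightarrow>\<^sub>M borel" and e: "0 < (e::real)"
  obtains N where "compact N" "N \<subseteq> T ` S" "emeasure P (S - T -` N) \<le> ennreal e"
proof -
  note [simp] = probs_OmegaD[OF P]
  interpret P: prob_space P by simp
  obtain B :: "'b set set" where B: "countable B" "topological_basis B"
    using ex_countable_basis by blast
  have basis: "\<exists>W\<in>B. x \<in> W \<and> W \<subseteq> V" if "open V" "x \<in> V" for V x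
    using topological_basisE[OF B(2) that] by metis
  then have "B \<noteq> {}" by (metis UNIV_I empty_iff open_UNIV)
  define U where "U = from_nat_into B"
  have range_U: "range U = B" unfolding U_def by (rule range_from_nat_into[OF \<open>B \<noteq> {}\<close> B(1)])
  have U: "open (U k)" for k using range_U topological_basis_open[OF B(2)] by blast
  have U_basis: "\<exists>k. x \<in> U k \<and> U k \<subseteq> V" if "open V" "x \<in> V" for V x
    using basis[OF that] range_U by blast
  have TU: "T -` U k \<in> sets B_Omega" "- (T -` U k) \<in> sets B_Omega" for k
    using measurable_sets[OF T, of "U k"] measurable_sets[OF T, of "- U k"] U
    by (auto simp: vimage_Compl)
  \<comment> \<open>Each index k spends this budget twice, on \<open>F k\<close> and on
    \<open>G k\<close>; over all k this amounts to e/2, and \<open>K0\<close> uses the other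
    half.\<close>
  define d where "d k = e / 4 * (1/2) ^ Suc k" for k
  have d: "0 < d k" for k using e by (simp add: d_def)
  obtain K0 where K0: "compact K0" "K0 \<subseteq> range hcube_nth" "hcube_nth -` K0 \<subseteq> S"
      "emeasure P (S - hcube_nth -` K0) \<le> ennreal (e/2)"
    by (rule probs_Omega_inner_regular[OF P S, of "e/2"]) (use e in auto)
  have "\<forall>k. \<exists>K. compact K \<and> K \<subseteq> range hcube_nth \<and> hcube_nth -` K \<subseteq> T -` U k \<and>
      emeasure P (T -` U k - hcube_nth -` K) \<le> ennreal (d k)"
    by (metis probs_Omega_inner_regular[OF P TU(1) d])
  then obtain F where F: "\<And>k. compact (F k)" "\<And>k. F k \<subseteq> range hcube_nth" "\<And>k. hcube_nth -` F k \<subseteq> T -` U k"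
      "\<And>k. emeasure P (T -` U k - hcube_nth -` F k) \<le> ennreal (d k)" by metis
  have "\<forall>k. \<exists>K. compact K \<and> K \<subseteq> range hcube_nth \<and> hcube_nth -` K \<subseteq> - (T -` U k) \<and>
      emeasure P (- (T -` U k) - hcube_nth -` K) \<le> ennreal (d k)"
    by (metis probs_Omega_inner_regular[OF P TU(2) d])
  then obtain G where G: "\<And>k. compact (G k)" "\<And>k. G k \<subseteq> range hcube_nth" "\<And>k. hcube_nth -` G k \<subseteq> - (T -` U k)"
      "\<And>k. emeasure P (- (T -` U k) - hcube_nth -` G k) \<le> ennreal (d k)" by metis
  define C where "C = K0 \<inter> (\<Inter>k. F k \<union> G k)"
  have C: "compact C" unfolding C_def
    by (intro compact_Int_closed K0 closed_INT ballI closed_Un compact_imp_closed F G)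
  have Crange: "C \<subseteq> range hcube_nth" using K0 by (auto simp: C_def)
  have cont: "continuous_on C (T \<circ> Abs_hcube)"
    unfolding continuous_on_open_invariant
  proof (intro allI impI)
    fix V :: "'b set" assume V: "open V"
    \<comment> \<open>On C the sets \<open>F k\<close> and \<open>G k\<close> are complementary, so
      the preimage of \<open>U k\<close> is C minus the closed set \<open>G k\<close>, hence
      relatively open.\<close>
    let ?W = "\<Union>k\<in>{k. U k \<subseteq> V}. - G k"
    have "?W \<inter> C = (T \<circ> Abs_hcube) -` V \<inter> C"
    proof (intro set_eqI iffI)
      fix x assume "x \<in> ?W \<inter> C"
      then obtain k where k: "U k \<subseteq> V" "x \<notin> G k" "x \<in> C" by auto
      then have "x \<in> F k" by (auto simp: C_def)
      moreover obtain w where "x = hcube_nth w" using k(3) Crange by auto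
      ultimately show "x \<in> (T \<circ> Abs_hcube) -` V \<inter> C"
        using F(3)[of k] k by (auto simp: hcube_nth_inverse)
    next
      fix x assume x: "x \<in> (T \<circ> Abs_hcube) -` V \<inter> C"
      then obtain w where w: "x = hcube_nth w" using Crange by auto
      with x have "T w \<in> V" by (simp add: hcube_nth_inverse)
      with U_basis[OF V] obtain k where "T w \<in> U k" "U k \<subseteq> V" by blast
      then show "x \<in> ?W \<inter> C" using x w G(3)[of k] by auto
    qed
    moreover have "open ?W" by (intro open_UN ballI open_Compl compact_imp_closed G)
    ultimately show "\<exists>A. open A \<and> A \<inter> C = (T \<circ> Abs_hcube) -` V \<inter> C" by blast
  qed
  define N where "N = (T \<circ> Abs_hcube) ` C"
  have N: "compact N" unfolding N_def by (rule compact_continuous_image[OF cont C])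
  have NS: "N \<subseteq> T ` S"
  proof
    fix y assume "y \<in> N"
    then obtain w where "hcube_nth w \<in> C" "y = T w"
      using Crange by (auto simp: N_def hcube_nth_inverse)
    then show "y \<in> T ` S" using K0(3) by (auto simp: C_def)
  qed
  have nth: "hcube_nth -` K \<in> sets B_Omega" if "compact K" for K
    using measurable_sets[OF measurable_hcube_borel_imp_B_Omega[OF measurable_hcube_nth] borel_compact[OF that]] by simp
  let ?E = "\<lambda>k. (T -` U k - hcube_nth -` F k) \<union> (- (T -` U k) - hcube_nth -` G k)"
  have E: "?E k \<in> sets B_Omega" for k using TU nth[OF F(1)] nth[OF G(1)] by auto
  have Ek: "emeasure P (?E k) \<le> ennreal (e / 2 * (1/2) ^ Suc k)" for k
  proof -
    have "emeasure P (?E k) \<le> emeasure P (T -` U k - hcube_nth -` F k) + emeasure P (- (T -` U k) - hcube_nth -` G k)"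
      using TU nth[OF F(1)] nth[OF G(1)] by (intro emeasure_subadditive) auto
    also have "\<dots> \<le> ennreal (d k) + ennreal (d k)" by (intro add_mono F G)
    also have "\<dots> = ennreal (e / 2 * (1/2) ^ Suc k)"
      using d[of k] by (simp add: ennreal_plus[symmetric] del: ennreal_plus) (simp add: d_def)
    finally show ?thesis .
  qed
  have "S - T -` N \<subseteq> (S - hcube_nth -` K0) \<union> (\<Union>k. ?E k)"
  proof
    fix w assume w: "w \<in> S - T -` N"
    have "hcube_nth w \<notin> C"
    proof
      assume "hcube_nth w \<in> C"
      then have "T w \<in> N" unfolding N_def by (intro image_eqI[of _ _ "hcube_nth w"]) (auto simp: hcube_nth_inverse)
      with w show False by simp
    qed
    with w show "w \<in> (S - hcube_nth -` K0) \<union> (\<Union>k. ?E k)" by (auto simp: C_def)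
  qed
  then have "emeasure P (S - T -` N) \<le> emeasure P ((S - hcube_nth -` K0) \<union> (\<Union>k. ?E k))"
    using S nth[OF K0(1)] E by (intro emeasure_mono) auto
  also have "\<dots> \<le> emeasure P (S - hcube_nth -` K0) + emeasure P (\<Union>k. ?E k)"
    using S nth[OF K0(1)] E by (intro emeasure_subadditive) auto
  also have "\<dots> \<le> ennreal (e/2) + (\<Sum>k. ennreal (e / 2 * (1/2) ^ Suc k))"
  proof (intro add_mono K0(4))
    have "emeasure P (\<Union>k. ?E k) \<le> (\<Sum>k. emeasure P (?E k))"
      using E by (intro emeasure_subadditive_countably) auto
    also have "\<dots> \<le> (\<Sum>k. ennreal (e / 2 * (1/2) ^ Suc k))" by (intro suminf_le Ek summableI)
    finally show "emeasure P (\<Union>k. ?E k) \<le> (\<Sum>k. ennreal (e / 2 * (1/2) ^ Suc k))" .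
  qed
  also have "(\<Sum>k. ennreal (e / 2 * (1/2) ^ Suc k)) = ennreal (e/2)"
  proof -
    have "(\<lambda>k. e / 2 * (1/2) ^ Suc k) sums (e / 2 * 1)" by (rule sums_mult[OF power_half_series])
    then show ?thesis using e by (intro suminf_ennreal_eq) auto
  qed
  also have "ennreal (e/2) + ennreal (e/2) = ennreal e"
    using e by (simp add: ennreal_plus[symmetric] del: ennreal_plus)
  finally show ?thesis using that N NS by blast
qed

text \<open>D itself may be far from Borel. The preimages of D and of its complement are both
  exhausted up to null sets by preimages of countable unions of compact subsets of their images; the
  first union is \<open>D1\<close>, the complement of the second is \<open>D2\<close>.\<close>

lemma probs_Omega_perfect:
  fixes T :: "hcube \<Rightarrow> 'b::{second_countable_topology, t2_space}"
  assumes P: "P \<in> probs_Omega" and T: "T \<in> B_Omega \<rightarrow>\<^sub>M borel" and D: "T -` D \<in> sets B_Omega"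
  obtains D1 D2 where "D1 \<in> sets borel" "D2 \<in> sets borel" "D1 \<subseteq> D" "D \<subseteq> D2"
    "emeasure P (T -` (D2 - D1)) = 0"
proof -
  note [simp] = probs_OmegaD[OF P]
  have approx: "\<exists>N\<in>sets borel. N \<subseteq> T ` S \<and> emeasure P (S - T -` N) = 0" if S: "S \<in> sets B_Omega" for S
  proof -
    have "\<forall>k. \<exists>N. compact N \<and> N \<subseteq> T ` S \<and> emeasure P (S - T -` N) \<le> ennreal (inverse (real (Suc k)))"
    proof
      fix k
      have "0 < inverse (real (Suc k))" by simp
      from probs_Omega_compact_image[OF P S T this]
      show "\<exists>N. compact N \<and> N \<subseteq> T ` S \<and> emeasure P (S - T -` N) \<le> ennreal (inverse (real (Suc k)))" by metis
    qed
    then obtain N where N: "\<And>k. compact (N k)" "\<And>k. N k \<subseteq> T ` S"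
      "\<And>k. emeasure P (S - T -` N k) \<le> ennreal (inverse (real (Suc k)))" by metis
    have Nb: "N k \<in> sets borel" for k using N(1) by (rule borel_compact)
    have TN: "T -` N k \<in> sets B_Omega" for k using measurable_sets[OF T Nb] by simp
    have "emeasure P (S - T -` (\<Union>k. N k)) \<le> ennreal (inverse (real (Suc k)))" for k
    proof -
      have "emeasure P (S - T -` (\<Union>k. N k)) \<le> emeasure P (S - T -` N k)"
        using S TN by (intro emeasure_mono) auto
      also note N(3)[of k]
      finally show ?thesis .
    qed
    moreover have "(\<lambda>k. ennreal (inverse (real (Suc k)))) \<longlonglongrightarrow> ennreal 0"
      by (intro tendsto_ennrealI LIMSEQ_inverse_real_of_nat)
    ultimately have "emeasure P (S - T -` (\<Union>k. N k)) \<le> ennreal 0"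
      by (intro LIMSEQ_le_const) auto
    then show ?thesis using Nb N(2) by (intro bexI[of _ "\<Union>k. N k"]) auto
  qed
  obtain N where N: "N \<in> sets borel" "N \<subseteq> T ` (T -` D)" "emeasure P (T -` D - T -` N) = 0"
    using approx[OF D] by blast
  have D': "- (T -` D) \<in> sets B_Omega" using sets.compl_sets[OF D] by (simp add: Compl_eq_Diff_UNIV)
  obtain N' where N': "N' \<in> sets borel" "N' \<subseteq> T ` (- (T -` D))" "emeasure P (- (T -` D) - T -` N') = 0"
    using approx[OF D'] by blast
  have TN: "T -` N \<in> sets B_Omega" "T -` N' \<in> sets B_Omega"
    using measurable_sets[OF T N(1)] measurable_sets[OF T N'(1)] by auto
  have "emeasure P (T -` (- N' - N)) \<le> emeasure P ((T -` D - T -` N) \<union> (- (T -` D) - T -` N'))"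
    using D D' TN by (intro emeasure_mono) auto
  also have "\<dots> \<le> emeasure P (T -` D - T -` N) + emeasure P (- (T -` D) - T -` N')"
    using D D' TN by (intro emeasure_subadditive) auto
  finally have "emeasure P (T -` (- N' - N)) = 0" using N(3) N'(3) by simp
  then show ?thesis using N N' by (intro that[of N "- N'"]) auto
qed

section \<open>Standard first component\<close>

text \<open>The Borel bounds found under P have a null gap there. The laws agree on both bounds,
  which traps the two measures of D between the same numbers.\<close>

lemma probs_Omega_law_transfer:
  fixes T S :: "hcube \<Rightarrow> 'b::{second_countable_topology, t2_space}"
  assumes P: "P \<in> probs_Omega" and R: "R \<in> probs_Omega"
    and T: "T \<in> B_Omega \<rightarrow>\<^sub>M borel" and S: "S \<in> B_Omega \<rightarrow>\<^sub>M borel"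
    and eq: "distr P borel T = distr R borel S"
    and D: "T -` D \<in> sets B_Omega" "S -` D \<in> sets B_Omega"
  shows "emeasure P (T -` D) = emeasure R (S -` D)"
proof -
  note [simp] = probs_OmegaD[OF P] probs_OmegaD[OF R]
  obtain D1 D2 where B: "D1 \<in> sets borel" "D2 \<in> sets borel" "D1 \<subseteq> D" "D \<subseteq> D2"
    "emeasure P (T -` (D2 - D1)) = 0" by (rule probs_Omega_perfect[OF P T D(1)])
  have eq': "emeasure P (T -` B) = emeasure R (S -` B)" if "B \<in> sets borel" for B
    using arg_cong[OF eq, of "\<lambda>M. emeasure M B"] that T S
    by (simp add: emeasure_distr measurable_probs_Omega[OF P] measurable_probs_Omega[OF R])
  have m: "T -` B \<in> sets B_Omega" "S -` B \<in> sets B_Omega" if "B \<in> sets borel" for B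
    using measurable_sets[OF T that] measurable_sets[OF S that] by auto
  have "emeasure P (T -` D2) \<le> emeasure P (T -` D1 \<union> T -` (D2 - D1))"
    using B by (intro emeasure_mono) (auto intro!: m sets.Un)
  also have "\<dots> \<le> emeasure P (T -` D1) + emeasure P (T -` (D2 - D1))"
    using B by (intro emeasure_subadditive) (auto intro!: m)
  finally have le: "emeasure P (T -` D2) \<le> emeasure P (T -` D1)" using B by simp
  have P12: "emeasure P (T -` D1) \<le> emeasure P (T -` D)" "emeasure P (T -` D) \<le> emeasure P (T -` D2)"
    using B D by (auto intro!: emeasure_mono m)
  have R12: "emeasure R (S -` D1) \<le> emeasure R (S -` D)" "emeasure R (S -` D) \<le> emeasure R (S -` D2)"
    using B D by (auto intro!: emeasure_mono m)
  from le P12 R12 show ?thesis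
    unfolding eq'[OF B(1)] eq'[OF B(2)] by (blast intro: order.antisym order.trans)
qed

text \<open>The generator matches what the quantile transform supplies: lower half-lines for the
  first coordinate, all Borel sets for the second.\<close>

lemma sets_borel_half_plane_generator:
  "sets (borel :: (real \<times> real) measure) = sigma_sets UNIV {{..x} \<times> B | x B. B \<in> sets borel}"
    (is "_ = sigma_sets UNIV ?E")
proof
  have "?E \<subseteq> sets borel" by (auto intro: borel_Times)
  then show "sigma_sets UNIV ?E \<subseteq> sets (borel :: (real \<times> real) measure)"
    using sets.sigma_sets_subset[of ?E "borel :: (real \<times> real) measure"] by simp
  interpret gen: sigma_algebra UNIV "sigma_sets UNIV ?E" by (rule sigma_algebra_sigma_sets) auto
  have rect: "a \<times> B \<in> sigma_sets UNIV ?E" if a: "a \<in> sets borel" and B: "B \<in> sets borel" for a B :: "real set"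
  proof -
    have "a \<in> sigma_sets UNIV (range atMost)"
      using a unfolding borel_eq_atMost by (simp add: sets_measure_of)
    then show ?thesis
    proof induction
      case (Basic a)
      then show ?case using B by (intro sigma_sets.Basic) auto
    next
      case Empty
      then show ?case by (simp add: sigma_sets.Empty)
    next
      case (Compl a)
      have "(\<Union>n. {..real n} \<times> B) \<in> sigma_sets UNIV ?E"
        using B by (intro sigma_sets.Union sigma_sets.Basic) auto
      moreover have "(\<Union>n. {..real n} \<times> B) = UNIV \<times> B"
        using real_arch_simple by auto
      ultimately have "UNIV \<times> B \<in> sigma_sets UNIV ?E" by simp
      moreover have "(UNIV - a) \<times> B = UNIV \<times> B - a \<times> B" by auto
      ultimately show ?case
        using Compl.IH by (simp add: gen.Diff)
    next
      case (Union F)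
      have "(\<Union>i. F i) \<times> B = (\<Union>i. F i \<times> B)" by auto
      then show ?case using Union.IH by (simp add: sigma_sets.Union)
    qed
  qed
  have "sets (borel :: (real \<times> real) measure) = sets ((borel :: real measure) \<Otimes>\<^sub>M (borel :: real measure))"
    by (simp only: borel_prod)
  also have "\<dots> = sigma_sets UNIV {a \<times> b | a b. a \<in> sets (borel :: real measure) \<and> b \<in> sets (borel :: real measure)}"
    by (simp add: sets_pair_measure)
  also have "\<dots> \<subseteq> sigma_sets UNIV ?E"
    by (rule sigma_sets_mono) (auto intro: rect)
  finally show "sets (borel :: (real \<times> real) measure) \<subseteq> sigma_sets UNIV ?E" .
qed

lemma measure_real_pair_eqI:
  fixes M N :: "(real \<times> real) measure"
  assumes M: "prob_space M" "sets M = sets borel" and N: "sets N = sets borel"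
    and eq: "\<And>x B. B \<in> sets borel \<Longrightarrow> emeasure M ({..x} \<times> B) = emeasure N ({..x} \<times> B)"
  shows "M = N"
proof (rule measure_eqI_generator_eq)
  let ?E = "{{..x} \<times> B | x B. B \<in> sets (borel :: real measure)} :: (real \<times> real) set set"
  show "Int_stable ?E"
  proof (rule Int_stableI)
    fix a b assume "a \<in> ?E" "b \<in> ?E"
    then obtain x B y C where "a = {..x} \<times> B" "b = {..y} \<times> C" "B \<in> sets borel" "C \<in> sets borel" by blast
    then have "a \<inter> b = {..min x y} \<times> (B \<inter> C)" "B \<inter> C \<in> sets borel" by auto
    then show "a \<inter> b \<in> ?E" by blast
  qed
  show "range (\<lambda>n. {..real n} \<times> UNIV) \<subseteq> ?E"
    using borel_open[OF open_UNIV, where 'a=real] by blast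
  show "(\<Union>n. {..real n} \<times> (UNIV :: real set)) = UNIV" using real_arch_simple by auto
  interpret prob_space M by fact
  show "emeasure M ({..real n} \<times> UNIV) \<noteq> \<infinity>" for n by simp
qed (use assms sets_borel_half_plane_generator in auto)

lemma countably_separated_sequence:
  fixes Y :: "'b qus"
  assumes "countably_separated Y"
  shows "\<exists>A::nat \<Rightarrow> 'b set. (\<forall>k. A k \<in> sets (\<B> Y)) \<and>
    (\<forall>x\<in>points Y. \<forall>y\<in>points Y. (\<forall>k. x \<in> A k \<longleftrightarrow> y \<in> A k) \<longrightarrow> x = y)"
proof -
  from assms[unfolded countably_separated_def] obtain E where E: "countable E" "E \<subseteq> sets (\<B> Y)"
    "\<forall>x\<in>points Y. \<forall>y\<in>points Y. x \<noteq> y \<longrightarrow> (\<exists>A\<in>E. (x \<in> A) \<noteq> (y \<in> A))"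
    by (elim exE conjE)
  \<comment> \<open>Adding the empty set makes the family nonempty, so that it has an enumeration;
    the empty set separates no points.\<close>
  let ?A = "from_nat_into (insert {} E)"
  have r: "range ?A = insert {} E" using E(1) by (intro range_from_nat_into) auto
  have mem: "?A k \<in> insert {} E" for k by (metis r rangeI)
  have "\<forall>k. ?A k \<in> sets (\<B> Y)"
  proof
    fix k show "?A k \<in> sets (\<B> Y)" using mem[of k] E(2) by auto
  qed
  moreover have "\<forall>x\<in>points Y. \<forall>y\<in>points Y. (\<forall>k. x \<in> ?A k \<longleftrightarrow> y \<in> ?A k) \<longrightarrow> x = y"
  proof (intro ballI impI, rule ccontr)
    fix x y assume xy: "x \<in> points Y" "y \<in> points Y" "\<forall>k. x \<in> ?A k \<longleftrightarrow> y \<in> ?A k" "x \<noteq> y"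
    from bspec[OF bspec[OF E(3) xy(1)] xy(2)] xy(4)
    obtain B where B: "B \<in> E" "(x \<in> B) \<noteq> (y \<in> B)" by blast
    then have "B \<in> range ?A" unfolding r by simp
    then obtain k where "B = ?A k" by (rule rangeE)
    then show False using spec[OF xy(3), of k] B(2) by simp
  qed
  ultimately show ?thesis by (intro exI[of _ ?A] conjI)
qed

text \<open>All kernels over an empty parameter space coincide. The case stands apart because an
  empty \<open>standard_qus\<close> is not a retract of Omega.\<close>

lemma disintegration_empty_parameter:
  assumes X: "quasi_universal X" and Y: "quasi_universal Y" and Z: "quasi_universal Z"
    and K: "K \<in> qmeas Z (qprob (X \<times>\<^sub>Q Y))" and Ze: "points Z = {}"
  shows "\<exists>L\<in>qmeas (Y \<times>\<^sub>Q Z) (qprob X). K = kernel_prod X Y Z (L, kernel_marginal Y Z K)"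
proof -
  have "(\<lambda>_. undefined) \<in> qmeas (Y \<times>\<^sub>Q Z) (qprob X)"
    using quasi_universal_range[OF quasi_universal_qprod[OF Y Z]]
    by (intro qmeasI quasi_universal_qprod Y Z quasi_universal_qprob X) (auto simp: points_qprod Ze)
  moreover have "K = kernel_prod X Y Z (L, kernel_marginal Y Z K)" if "L \<in> qmeas (Y \<times>\<^sub>Q Z) (qprob X)" for L
    using K kernel_prod_qmeas[OF X Y Z that kernel_marginal_qmeas[OF X Y Z K]]
    by (auto simp: qmeas_def PiE_iff Ze)
  ultimately show ?thesis by blast
qed

text \<open>The analogue of \<open>cell_ratio\<close> with y and the measure as free arguments. It
  mentions no representing random variable, so one formula serves all z at once.\<close>

definition cond_ratio :: "'a qus \<Rightarrow> 'b qus \<Rightarrow> (nat \<Rightarrow> 'b set) \<Rightarrow> ('a \<times> 'b) measure \<Rightarrow> ('a \<times> 'b) set \<Rightarrow> nat \<Rightarrow> 'b \<Rightarrow> real" where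
  "cond_ratio X Y A \<mu> C n y =
    measure \<mu> (C \<inter> {w \<in> points (X \<times>\<^sub>Q Y). \<forall>k<n. snd w \<in> A k \<longleftrightarrow> y \<in> A k}) /
    measure \<mu> {w \<in> points (X \<times>\<^sub>Q Y). \<forall>k<n. snd w \<in> A k \<longleftrightarrow> y \<in> A k}"

text \<open>The cell moves with t through \<open>\<eta> t\<close>; it is read as the section at t of
  one set in Omega \<times> (X \<times> Y).\<close>

lemma borel_measurable_measure_section:
  fixes A :: "nat \<Rightarrow> 'b set"
  assumes X: "quasi_universal X" and Y: "quasi_universal Y"
    and K: "K \<in> rvs (qprob (X \<times>\<^sub>Q Y))" and \<eta>: "\<eta> \<in> rvs Y" and A: "\<forall>k. A k \<in> sets (\<B> Y)"
    and C: "C \<in> sets (\<B> (X \<times>\<^sub>Q Y))"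
  shows "(\<lambda>t. measure (K t) (C \<inter> {w \<in> points (X \<times>\<^sub>Q Y). \<forall>k<n. snd w \<in> A k \<longleftrightarrow> \<eta> t \<in> A k})) \<in> borel_measurable B_Omega"
proof -
  note XY = quasi_universal_qprod[OF X Y]
  note OXY = quasi_universal_qprod[OF quasi_universal_Omega XY]
  let ?D = "{p. snd p \<in> C \<and> snd p \<in> points (X \<times>\<^sub>Q Y) \<and> (\<forall>k<n. snd (snd p) \<in> A k \<longleftrightarrow> \<eta> (fst p) \<in> A k)}"
  have D: "?D \<in> sets (\<B> (Omega \<times>\<^sub>Q (X \<times>\<^sub>Q Y)))"
    unfolding sets_induced_algebra_iff[OF OXY]
  proof (intro conjI ballI)
    fix \<gamma> assume \<gamma>: "\<gamma> \<in> rvs (Omega \<times>\<^sub>Q (X \<times>\<^sub>Q Y))"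
    then have g: "(\<lambda>t. fst (\<gamma> t)) \<in> B_Omega \<rightarrow>\<^sub>M B_Omega" "(\<lambda>t. snd (\<gamma> t)) \<in> rvs (X \<times>\<^sub>Q Y)"
      "(\<lambda>t. snd (snd (\<gamma> t))) \<in> rvs Y" by (auto simp: rvs_qprod_iff rvs_Omega)
    have 1: "{t \<in> space B_Omega. snd (\<gamma> t) \<in> C} \<in> sets B_Omega"
      using sets_rv_vimage[OF XY g(2) C] by simp
    have 2: "{t \<in> space B_Omega. snd (snd (\<gamma> t)) \<in> A k} \<in> sets B_Omega"
      "{t \<in> space B_Omega. \<eta> (fst (\<gamma> t)) \<in> A k} \<in> sets B_Omega" for k
      using sets_rv_vimage[OF Y g(3) spec[OF A]]
        sets_rv_vimage[OF Y rvs_compose[OF Y \<eta> g(1)] spec[OF A]] by simp_all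
    have "{t. \<gamma> t \<in> ?D} = {t \<in> space B_Omega. snd (\<gamma> t) \<in> C \<and>
        (\<forall>k\<in>{..<n}. (snd (snd (\<gamma> t)) \<in> A k \<longrightarrow> \<eta> (fst (\<gamma> t)) \<in> A k) \<and>
          (\<eta> (fst (\<gamma> t)) \<in> A k \<longrightarrow> snd (snd (\<gamma> t)) \<in> A k))}"
      using quasi_universal_range[OF XY g(2)] by auto
    also have "\<dots> \<in> sets B_Omega"
      by (intro sets.sets_Collect_conj sets.sets_Collect_countable_All'
          sets.sets_Collect_imp countableI_type 1 2)
    finally show "{t. \<gamma> t \<in> ?D} \<in> sets B_Omega" .
  qed (auto simp: points_qprod points_Omega)
  have "(\<lambda>t. enn2real (emeasure (K t) {w. (t, w) \<in> ?D})) \<in> borel_measurable B_Omega"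
    by (intro borel_measurable_enn2real measurable_emeasure_rvs_qprob[OF XY K D])
  then show ?thesis by (simp add: measure_def Int_def)
qed

lemma borel_measurable_cond_ratio:
  assumes X: "quasi_universal X" and Y: "quasi_universal Y"
    and K: "K \<in> rvs (qprob (X \<times>\<^sub>Q Y))" and \<eta>: "\<eta> \<in> rvs Y" and A: "\<forall>k. A k \<in> sets (\<B> Y)"
    and C: "C \<in> sets (\<B> (X \<times>\<^sub>Q Y))"
  shows "(\<lambda>t. cond_ratio X Y A (K t) C n (\<eta> t)) \<in> borel_measurable B_Omega"
proof -
  have top: "points (X \<times>\<^sub>Q Y) \<in> sets (\<B> (X \<times>\<^sub>Q Y))"
    using sets.top[of "\<B> (X \<times>\<^sub>Q Y)"] by simp
  have "points (X \<times>\<^sub>Q Y) \<inter> {w \<in> points (X \<times>\<^sub>Q Y). \<forall>k<n. snd w \<in> A k \<longleftrightarrow> \<eta> t \<in> A k} =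
      {w \<in> points (X \<times>\<^sub>Q Y). \<forall>k<n. snd w \<in> A k \<longleftrightarrow> \<eta> t \<in> A k}" for t by auto
  with borel_measurable_measure_section[OF X Y K \<eta> A top, of n]
  have "(\<lambda>t. measure (K t) {w \<in> points (X \<times>\<^sub>Q Y). \<forall>k<n. snd w \<in> A k \<longleftrightarrow> \<eta> t \<in> A k}) \<in> borel_measurable B_Omega"
    by simp
  then show ?thesis unfolding cond_ratio_def
    by (intro borel_measurable_divide borel_measurable_measure_section assms)
qed

text \<open>On a probability space that represents one fixed measure, the ratios are those of the
  martingale above, so its convergence results become available.\<close>

lemma cond_ratio_eq_cell_ratio:
  assumes X: "quasi_universal X" and Y: "quasi_universal Y"
    and P: "P \<in> probs_Omega" and \<gamma>: "\<gamma> \<in> rvs (X \<times>\<^sub>Q Y)" and A: "\<forall>k. A k \<in> sets (\<B> Y)"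
    and C: "C \<in> sets (\<B> (X \<times>\<^sub>Q Y))"
  shows "cond_ratio X Y A (distr P (\<B> (X \<times>\<^sub>Q Y)) \<gamma>) C n (snd (\<gamma> u)) =
    cell_ratio P (\<lambda>k. {u. snd (\<gamma> u) \<in> A k}) {u. \<gamma> u \<in> C} n u"
proof -
  note XY = quasi_universal_qprod[OF X Y]
  let ?B = "{w \<in> points (X \<times>\<^sub>Q Y). \<forall>k<n. snd w \<in> A k \<longleftrightarrow> snd (\<gamma> u) \<in> A k}"
  have B: "?B \<in> sets (\<B> (X \<times>\<^sub>Q Y))"
  proof -
    have [measurable]: "snd \<in> \<B> (X \<times>\<^sub>Q Y) \<rightarrow>\<^sub>M \<B> Y"
      by (rule measurable_snd_induced[OF X Y])
    have [measurable]: "A k \<in> sets (\<B> Y)" for k using A by blast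
    have "?B = {w \<in> space (\<B> (X \<times>\<^sub>Q Y)). \<forall>k<n. snd w \<in> A k \<longleftrightarrow> snd (\<gamma> u) \<in> A k}" by simp
    also have "\<dots> \<in> sets (\<B> (X \<times>\<^sub>Q Y))" by measurable
    finally show ?thesis .
  qed
  have e: "{v. \<gamma> v \<in> ?B} = cell (space P) (\<lambda>k. {u. snd (\<gamma> u) \<in> A k}) n u"
    using quasi_universal_range[OF XY \<gamma>] by (auto simp: cell_def probs_OmegaD[OF P])
  have "measure (distr P (\<B> (X \<times>\<^sub>Q Y)) \<gamma>) D = measure P {v. \<gamma> v \<in> D}"
    if "D \<in> sets (\<B> (X \<times>\<^sub>Q Y))" for D
    using distr_rv(2)[OF XY P \<gamma> that] by (simp add: measure_def)
  from this[OF B] this[OF sets.Int[OF C B]] show ?thesis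
    unfolding cond_ratio_def cell_ratio_def e[symmetric] by (simp add: Int_def)
qed

text \<open>For fixed z the original pair and the pair with x redrawn from L are compared after
  coding both components by reals. The quantile law gives equality on a generator and hence on the
  Borel sets of the plane; \<open>probs_Omega_law_transfer\<close> carries it to the coded form of
  an arbitrary D in the induced sigma-algebra.\<close>

lemma disintegration_standard_fst:
  fixes Y :: "'b qus"
  assumes X: "quasi_universal X" and Y: "quasi_universal Y" and Z: "quasi_universal Z"
    and sep: "countably_separated Y" and st: "standard_qus X"
    and K: "K \<in> qmeas Z (qprob (X \<times>\<^sub>Q Y))"
  shows "\<exists>L\<in>qmeas (Y \<times>\<^sub>Q Z) (qprob X). K = kernel_prod X Y Z (L, kernel_marginal Y Z K)"
proof (cases "points X = {}")
  case True
  \<comment> \<open>No random variable takes values in an empty product, so K can only have an empty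
    domain.\<close>
  then have "points (qprob (X \<times>\<^sub>Q Y)) = {}"
    using quasi_universal_range[OF quasi_universal_qprod[OF X Y]] by (auto simp: qprob_def points_qprod)
  then have "points Z = {}" using qmeas_points[OF K] by blast
  then show ?thesis by (rule disintegration_empty_parameter[OF X Y Z K])
next
  case False
  note XY = quasi_universal_qprod[OF X Y] and YZ = quasi_universal_qprod[OF Y Z]
  obtain i r where i: "i \<in> qmeas X Omega" and r: "r \<in> qmeas Omega X" and ri: "\<forall>x\<in>points X. r (i x) = x"
    using st False by (auto simp: standard_qus_def)
  from countably_separated_sequence[OF sep] obtain A :: "nat \<Rightarrow> 'b set" where A: "\<forall>k. A k \<in> sets (\<B> Y)"
    and A_sep: "\<forall>x\<in>points Y. \<forall>y\<in>points Y. (\<forall>k. x \<in> A k \<longleftrightarrow> y \<in> A k) \<longrightarrow> x = y"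
    by (elim exE conjE)
  obtain P0 V where P0: "P0 \<in> probs_Omega" and V: "V \<in> borel_measurable B_Omega"
    and V_unif: "\<forall>s\<in>{0..1}. emeasure P0 {v. V v \<le> s} = ennreal s"
    by (rule ex_uniform_probs_Omega)
  define C where "C q = {w \<in> points (X \<times>\<^sub>Q Y). hcube_code (i (fst w)) \<le> of_rat q}" for q
  have i_meas: "(\<lambda>t. hcube_code (i (\<alpha> t))) \<in> borel_measurable B_Omega" if "\<alpha> \<in> rvs X" for \<alpha>
    using qmeasD[OF i that] measurable_compose[OF _ borel_measurable_hcube_code] by (simp add: rvs_Omega)
  have C: "C q \<in> sets (\<B> (X \<times>\<^sub>Q Y))" for q
    unfolding sets_induced_algebra_iff[OF XY]
  proof (intro conjI ballI)
    fix \<gamma> assume \<gamma>: "\<gamma> \<in> rvs (X \<times>\<^sub>Q Y)"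
    have "{t. \<gamma> t \<in> C q} = {t \<in> space B_Omega. hcube_code (i (fst (\<gamma> t))) \<le> of_rat q}"
      using quasi_universal_range[OF XY \<gamma>] by (auto simp: C_def)
    also have "\<dots> \<in> sets B_Omega"
      using \<gamma> by (intro borel_measurable_le i_meas borel_measurable_const) (simp add: rvs_qprod_iff)
    finally show "{t. \<gamma> t \<in> C q} \<in> sets B_Omega" .
  qed (auto simp: C_def)
  \<comment> \<open>Where the ratios diverge, \<open>lim\<close> is some fixed real; for every \<open>z\<close> such \<open>y\<close> form a null set of the
    marginal of \<open>K z\<close>.\<close>
  define f where "f q y z = lim (\<lambda>n. cond_ratio X Y A (K z) (C q) n y)" for q y z
  \<comment> \<open>The quantile of a uniform variable is decoded to a point of Omega and sent to X
    by r. Both maps are total, so the formula gives a random variable of X even where f is no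
    distribution function.\<close>
  define L where "L = (\<lambda>(y, z)\<in>points (Y \<times>\<^sub>Q Z). distr P0 (\<B> X)
    (\<lambda>v. r (hcube_decode (quantile (\<lambda>q. f q y z) (V v)))))"
  have f_meas: "(\<lambda>t. f q (\<eta> t) (\<zeta> t)) \<in> borel_measurable B_Omega"
    if "\<eta> \<in> rvs Y" "\<zeta> \<in> rvs Z" for q \<eta> \<zeta>
    unfolding f_def
    by (intro borel_measurable_lim_metric borel_measurable_cond_ratio[OF X Y] qmeasD[OF K] that A C)
  have L_rv: "(\<lambda>w. r (hcube_decode (quantile (\<lambda>q. f q (\<eta> (hfst w)) (\<zeta> (hfst w))) (V (hsnd w))))) \<in> rvs X"
    if "\<eta> \<in> rvs Y" "\<zeta> \<in> rvs Z" for \<eta> \<zeta>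
  proof (rule qmeasD[OF r])
    have "(\<lambda>w. quantile (\<lambda>q. f q (\<eta> (hfst w)) (\<zeta> (hfst w))) (V (hsnd w))) \<in> borel_measurable B_Omega"
      by (intro borel_measurable_quantile measurable_compose[OF measurable_hfst f_meas] that
          measurable_compose[OF measurable_hsnd V])
    then show "(\<lambda>w. hcube_decode (quantile (\<lambda>q. f q (\<eta> (hfst w)) (\<zeta> (hfst w))) (V (hsnd w)))) \<in> rvs Omega"
      unfolding rvs_Omega
      by (intro measurable_B_Omega_B_Omega measurable_compose[OF _ measurable_hcube_decode])
  qed
  have L: "L \<in> qmeas (Y \<times>\<^sub>Q Z) (qprob X)"
  proof (rule qmeasI[OF YZ quasi_universal_qprob[OF X]])
    show "L \<in> extensional (points (Y \<times>\<^sub>Q Z))" by (simp add: L_def)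
    fix \<gamma> assume \<gamma>: "\<gamma> \<in> rvs (Y \<times>\<^sub>Q Z)"
    let ?\<alpha> = "\<lambda>w. r (hcube_decode (quantile (\<lambda>q. f q (fst (\<gamma> (hfst w))) (snd (\<gamma> (hfst w)))) (V (hsnd w))))"
    have "?\<alpha> \<in> rvs X" using \<gamma> by (intro L_rv[of "\<lambda>t. fst (\<gamma> t)" "\<lambda>t. snd (\<gamma> t)"]) (auto simp: rvs_qprod_iff)
    moreover have "(\<lambda>t. L (\<gamma> t)) = (\<lambda>t. distr P0 (\<B> X) (\<lambda>u. ?\<alpha> (hpair t u)))"
      using quasi_universal_range[OF YZ \<gamma>] by (auto simp: L_def case_prod_beta)
    ultimately show "(\<lambda>t. L (\<gamma> t)) \<in> rvs (qprob X)"
      using P0 unfolding rvs_qprob_iff[OF X] by (intro bexI[of _ P0] bexI[of _ ?\<alpha>])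
  qed
  have "kernel_prod X Y Z (L, kernel_marginal Y Z K) z = K z" if z: "z \<in> points Z" for z
  proof (rule kernel_prod_eqI[OF L kernel_marginal_qmeas[OF X Y Z K] z])
    obtain P \<gamma> where P: "P \<in> probs_Omega" and \<gamma>: "\<gamma> \<in> rvs (X \<times>\<^sub>Q Y)"
      and Kz: "K z = distr P (\<B> (X \<times>\<^sub>Q Y)) \<gamma>"
      by (rule points_qprobE[OF qmeas_points[OF K z]])
    show "sets (K z) = sets (\<B> (X \<times>\<^sub>Q Y))" by (simp add: Kz)
    fix D assume D: "D \<in> sets (\<B> (X \<times>\<^sub>Q Y))"
    note [simp] = probs_OmegaD[OF P] probs_OmegaD[OF P0]
    interpret PS: prob_space P by simp
    define \<beta> where "\<beta> u = snd (\<gamma> u)" for u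
    have \<beta>: "\<beta> \<in> rvs Y" using \<gamma> by (simp add: rvs_qprod_iff \<beta>_def[abs_def])
    have \<alpha>: "(\<lambda>u. fst (\<gamma> u)) \<in> rvs X" using \<gamma> by (simp add: rvs_qprod_iff)
    have \<gamma>_points: "fst (\<gamma> u) \<in> points X" "\<beta> u \<in> points Y" for u
      using quasi_universal_range[OF XY \<gamma>, of u] by (auto simp: points_qprod \<beta>_def)
    define a where "a u = hcube_code (i (fst (\<gamma> u)))" for u
    \<comment> \<open>e codes y by its membership bits, injectively on \<open>points Y\<close>.
      Along \<beta> the code is measurable for the sigma-algebra generated by the sets
      \<open>B k\<close>, which is where the limit of the ratios is known to integrate
      correctly.\<close>
    define e where "e y = bits_real (\<lambda>k. y \<in> A k)" for y
    define h where "h u v = quantile (\<lambda>q. f q (\<beta> u) z) (V v)" for u v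
    define B where "B k = {u. \<beta> u \<in> A k}" for k
    have a_bounds: "0 \<le> a u" "a u \<le> 1" for u by (simp_all add: a_def hcube_code_bounds)
    have a: "a \<in> borel_measurable B_Omega" unfolding a_def by (rule i_meas[OF \<alpha>])
    have B: "B k \<in> sets B_Omega" for k
      unfolding B_def by (rule sets_rv_vimage[OF Y \<beta>]) (use A in blast)
    have e_inj: "y = y'" if "e y = e y'" "y \<in> points Y" "y' \<in> points Y" for y y'
      using A_sep that odd_floor_bits_real unfolding e_def by metis
    have e_sigma: "(\<lambda>u. e (\<beta> u)) \<in> borel_measurable (sigma UNIV (range B))"
      unfolding e_def by (rule borel_measurable_bits_real) (auto simp: B_def sets_measure_of)
    have e_meas: "(\<lambda>u. e (\<beta> u)) \<in> borel_measurable B_Omega"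
      unfolding e_def using B by (intro borel_measurable_bits_real) (simp add: B_def)
    have gC: "{u. \<gamma> u \<in> C q} = {u. a u \<le> of_rat q}" for q
      using quasi_universal_range[OF XY \<gamma>] by (auto simp: C_def a_def)
    have aq: "{u. a u \<le> x} \<in> sets B_Omega" for x
      using borel_measurable_le[OF a borel_measurable_const, of x] by simp
    have f_eq: "f q (\<beta> u) z = lim (\<lambda>n. cell_ratio P B {u. a u \<le> of_rat q} n u)" for q u
      unfolding f_def Kz \<beta>_def cond_ratio_eq_cell_ratio[OF X Y P \<gamma> A C] gC
      by (simp add: B_def[abs_def] \<beta>_def)
    have BP: "B k \<in> sets P" for k using B by simp
    have CP: "{u. a u \<le> x} \<in> sets P" for x using aq by simp
    have conv: "AE u in P. \<forall>q::rat. convergent (\<lambda>n. cell_ratio P B {u. a u \<le> of_rat q} n u)"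
      unfolding AE_all_countable by (intro allI PS.AE_convergent_cell_ratio BP CP)
    have bd: "AE u in P. \<forall>q. f q (\<beta> u) z \<in> {0..1}"
      using conv
    proof eventually_elim
      case (elim u)
      then have l: "(\<lambda>n. cell_ratio P B {u. a u \<le> of_rat q} n u) \<longlonglongrightarrow> f q (\<beta> u) z" for q
        unfolding f_eq by (simp add: convergent_LIMSEQ_iff)
      have "f q (\<beta> u) z \<in> {0..1}" for q
        using LIMSEQ_le_const[OF l[of q], of 0] LIMSEQ_le_const2[OF l[of q], of 1]
          cell_ratio_bounds[OF PS.prob_space_axioms BP] by auto
      then show ?case ..
    qed
    have mono: "AE u in P. \<forall>q q'. q \<le> q' \<longrightarrow> f q (\<beta> u) z \<le> f q' (\<beta> u) z"
      using conv
    proof eventually_elim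
      case (elim u)
      then have l: "(\<lambda>n. cell_ratio P B {u. a u \<le> of_rat q} n u) \<longlonglongrightarrow> f q (\<beta> u) z" for q
        unfolding f_eq by (simp add: convergent_LIMSEQ_iff)
      show ?case
      proof (intro allI impI)
        fix q q' :: rat assume "q \<le> q'"
        then have "{u. a u \<le> of_rat q} \<subseteq> {u. a u \<le> of_rat q'}"
          using of_rat_less_eq[of q q', where 'a=real] by auto
        then have "cell_ratio P B {u. a u \<le> of_rat q} n u \<le> cell_ratio P B {u. a u \<le> of_rat q'} n u" for n
          by (rule cell_ratio_mono[OF PS.prob_space_axioms BP _ CP])
        then show "f q (\<beta> u) z \<le> f q' (\<beta> u) z"
          by (intro LIMSEQ_le[OF l l] exI allI impI)
      qed
    qed
    have f_meas': "(\<lambda>u. f q (\<beta> u) z) \<in> borel_measurable P" for q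
      using f_meas[OF \<beta> rvs_const[OF Z z]] by (simp add: measurable_probs_Omega[OF P])
    have law: "(\<integral>\<^sup>+ u. indicator S u * emeasure P0 {v. h u v \<le> x} \<partial>P) = emeasure P ({u. a u \<le> x} \<inter> S)"
      if S: "S \<in> sigma_sets UNIV (range B)" for S x
    proof -
      have SP: "S \<in> sets P"
        using sets.sigma_sets_subset[of "range B" P] BP S by auto
      have eq: "(\<integral>u. indicator S u * f q (\<beta> u) z \<partial>P) = measure P ({u \<in> space P. a u \<le> of_rat q} \<inter> S)" for q
      proof -
        have "S \<in> sigma_sets (space P) (range B)" using S by simp
        from PS.integral_lim_cell_ratio[OF BP CP this] show ?thesis unfolding f_eq by simp
      qed
      have "(\<integral>\<^sup>+ u. indicator S u * emeasure P0 {v \<in> space P0. quantile (\<lambda>q. f q (\<beta> u) z) (V v) \<le> x} \<partial>P) =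
          emeasure P ({u \<in> space P. a u \<le> x} \<inter> S)"
        by (rule nn_integral_quantile[OF PS.prob_space_axioms probs_OmegaD(1)[OF P0] _ _ _ _ f_meas' bd mono SP eq])
          (use V a V_unif in
            \<open>auto simp: measurable_probs_Omega[OF P] measurable_probs_Omega[OF P0] a_bounds\<close>)
      then show ?thesis by (simp add: h_def)
    qed
    define R where "R = hprod P P0"
    have R: "R \<in> probs_Omega" unfolding R_def by (rule hprod_probs_Omega[OF P P0])
    \<comment> \<open>\<open>?T\<close> is the coded original pair under P; \<open>?S\<close> is the
      coded pair under R, with the first component redrawn as a quantile given y.\<close>
    let ?T = "\<lambda>u. (a u, e (\<beta> u))" and ?S = "\<lambda>m. (h (hfst m) (hsnd m), e (\<beta> (hfst m)))"
    have T: "?T \<in> B_Omega \<rightarrow>\<^sub>M borel" using a e_meas by simp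
    have h_meas: "(\<lambda>m. h (hfst m) (hsnd m)) \<in> borel_measurable B_Omega"
      unfolding h_def
      by (intro borel_measurable_quantile measurable_compose[OF measurable_hfst f_meas[OF \<beta> rvs_const[OF Z z]]]
          measurable_compose[OF measurable_hsnd V])
    have S: "?S \<in> B_Omega \<rightarrow>\<^sub>M borel"
      using h_meas measurable_compose[OF measurable_hfst e_meas] by simp
    have laws: "distr P borel ?T = distr R borel ?S"
    proof (rule measure_real_pair_eqI)
      have TP: "?T \<in> P \<rightarrow>\<^sub>M borel" using T by (simp add: measurable_probs_Omega[OF P])
      have SR: "?S \<in> R \<rightarrow>\<^sub>M borel" using S by (simp add: measurable_probs_Omega[OF R])
      show "prob_space (distr P borel ?T)" by (rule PS.prob_space_distr[OF TP])
      fix x :: real and E :: "real set" assume E: "E \<in> sets borel"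
      then have xE: "{..x} \<times> E \<in> sets borel" by (auto intro: borel_Times)
      have "(\<lambda>u. e (\<beta> u)) -` E \<in> sigma_sets UNIV (range B)"
        using measurable_sets[OF e_sigma E] by (simp add: sets_measure_of)
      note law' = law[OF this, of x]
      have SE: "?S -` ({..x} \<times> E) \<in> sets B_Omega" using measurable_sets[OF S xE] by simp
      have "emeasure (distr R borel ?S) ({..x} \<times> E) = emeasure R (?S -` ({..x} \<times> E))"
        by (simp add: emeasure_distr[OF SR xE] probs_OmegaD[OF R])
      also have "\<dots> = (\<integral>\<^sup>+ u. emeasure P0 (hpair u -` (?S -` ({..x} \<times> E))) \<partial>P)"
        unfolding R_def by (rule emeasure_hprod[OF P P0 SE])
      also have "\<dots> = (\<integral>\<^sup>+ u. indicator ((\<lambda>u. e (\<beta> u)) -` E) u * emeasure P0 {v. h u v \<le> x} \<partial>P)"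
        by (intro nn_integral_cong) (auto simp: indicator_def vimage_def)
      also have "\<dots> = emeasure P (?T -` ({..x} \<times> E))"
        unfolding law' by (intro arg_cong[where f="emeasure P"]) auto
      also have "\<dots> = emeasure (distr P borel ?T) ({..x} \<times> E)"
        by (simp add: emeasure_distr[OF TP xE])
      finally show "emeasure (distr P borel ?T) ({..x} \<times> E) = emeasure (distr R borel ?S) ({..x} \<times> E)" ..
    qed auto
    \<comment> \<open>The coded form of D, in general not a Borel set of the plane: the transfer
      asks only that its preimages under \<open>?T\<close> and \<open>?S\<close> be
      measurable.\<close>
    define D' where "D' = {p. \<exists>y\<in>points Y. e y = snd p \<and> (r (hcube_decode (fst p)), y) \<in> D}"
    have TD: "?T -` D' = {u. \<gamma> u \<in> D}"
    proof (intro set_eqI iffI)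
      fix u assume "u \<in> ?T -` D'"
      then obtain y where "y \<in> points Y" "e y = e (\<beta> u)" "(r (hcube_decode (a u)), y) \<in> D"
        by (auto simp: D'_def)
      then have "(fst (\<gamma> u), \<beta> u) \<in> D"
        using e_inj[of y "\<beta> u"] \<gamma>_points[of u] ri by (simp add: a_def hcube_decode_code)
      then show "u \<in> {u. \<gamma> u \<in> D}" by (simp add: \<beta>_def)
    next
      fix u assume "u \<in> {u. \<gamma> u \<in> D}"
      then have "(fst (\<gamma> u), \<beta> u) \<in> D" by (simp add: \<beta>_def)
      then show "u \<in> ?T -` D'"
        using \<gamma>_points[of u] ri by (auto simp: D'_def a_def hcube_decode_code)
    qed
    have SD: "?S -` D' = {m. (r (hcube_decode (h (hfst m) (hsnd m))), \<beta> (hfst m)) \<in> D}"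
      using e_inj \<gamma>_points by (fastforce simp: D'_def)
    have rv: "(\<lambda>m. (r (hcube_decode (h (hfst m) (hsnd m))), \<beta> (hfst m))) \<in> rvs (X \<times>\<^sub>Q Y)"
      unfolding h_def by (intro rvs_PairI L_rv[OF \<beta> rvs_const[OF Z z]] rvs_compose[OF Y \<beta> measurable_hfst])
    have TDs: "?T -` D' \<in> sets B_Omega" unfolding TD by (rule sets_rv_vimage[OF XY \<gamma> D])
    have SDs: "?S -` D' \<in> sets B_Omega" unfolding SD by (rule sets_rv_vimage[OF XY rv D])
    have "(\<integral>\<^sup>+ y. emeasure (L (y, z)) {x. (x, y) \<in> D} \<partial>kernel_marginal Y Z K z) =
        (\<integral>\<^sup>+ u. emeasure (L (\<beta> u, z)) {x. (x, \<beta> u) \<in> D} \<partial>P)"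
      unfolding kernel_marginal_distr[where K=K and z=z, OF X Y z P \<gamma> Kz] \<beta>_def[symmetric]
      by (rule nn_integral_kernel_section[OF X Y Z L z D P \<beta>])
    also have "\<dots> = (\<integral>\<^sup>+ u. emeasure P0 (hpair u -` (?S -` D')) \<partial>P)"
    proof (rule nn_integral_cong)
      fix u
      have "(\<lambda>v. r (hcube_decode (quantile (\<lambda>q. f q (\<beta> u) z) (V v)))) \<in> rvs X"
        using rvs_hpair[OF X L_rv[OF \<beta> rvs_const[OF Z z]], of u] by simp
      from distr_rv(2)[OF X P0 this section_fst_sets[OF X Y D \<gamma>_points(2)[of u]]]
      show "emeasure (L (\<beta> u, z)) {x. (x, \<beta> u) \<in> D} = emeasure P0 (hpair u -` (?S -` D'))"
        using \<gamma>_points(2)[of u] z unfolding SD by (simp add: L_def points_qprod h_def vimage_def)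
    qed
    also have "\<dots> = emeasure R (?S -` D')"
      unfolding R_def by (rule emeasure_hprod[OF P P0 SDs, symmetric])
    also have "\<dots> = emeasure P (?T -` D')"
      by (rule probs_Omega_law_transfer[OF P R T S laws TDs SDs, symmetric])
    also have "\<dots> = emeasure (K z) D"
      unfolding TD Kz by (rule distr_rv(2)[OF XY P \<gamma> D, symmetric])
    finally show "(\<integral>\<^sup>+ y. emeasure (L (y, z)) {x. (x, y) \<in> D} \<partial>kernel_marginal Y Z K z) = emeasure (K z) D" .
  qed
  then have "K = kernel_prod X Y Z (L, kernel_marginal Y Z K)"
    using K kernel_prod_qmeas[OF X Y Z L kernel_marginal_qmeas[OF X Y Z K]]
    by (intro extensionalityI[of _ "points Z"]) (auto simp: qmeas_def PiE_iff)
  with L show ?thesis by blast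
qed

section \<open>Standard parameter space\<close>

lemma standard_Omega: "standard_qus Omega"
proof -
  have "(\<lambda>x. x) \<in> qmeas Omega Omega"
    by (rule qmeasI[OF quasi_universal_Omega quasi_universal_Omega]) (auto simp: points_Omega)
  then show ?thesis unfolding standard_qus_def by (intro disjI2 bexI[of _ "\<lambda>x. x"]) auto
qed

lemma sets_induced_Omega: "sets (\<B> Omega) = sets B_Omega"
proof (intro set_eqI iffI)
  fix A assume "A \<in> sets (\<B> Omega)"
  then have "{t. t \<in> A} \<in> sets B_Omega"
    by (rule sets_rv_vimage[OF quasi_universal_Omega, rotated]) (simp add: rvs_Omega)
  then show "A \<in> sets B_Omega" by simp
next
  fix A assume A: "A \<in> sets B_Omega"
  have "{t. \<alpha> t \<in> A} \<in> sets B_Omega" if "\<alpha> \<in> B_Omega \<rightarrow>\<^sub>M B_Omega" for \<alpha>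
    using measurable_sets[OF that A] by (simp add: vimage_def)
  then show "A \<in> sets (\<B> Omega)"
    by (simp add: sets_induced_algebra_iff[OF quasi_universal_Omega] points_Omega rvs_Omega)
qed

text \<open>This conditions the source \<open>u\<close> of randomness instead of \<open>X\<close>: pushing the result forward disintegrates
  a kernel into \<open>X \<times>\<^sub>Q Y\<close> even when \<open>X\<close> is not standard.\<close>

lemma randomness_disintegration:
  assumes Y: "quasi_universal Y" and sep: "countably_separated Y"
    and P: "P \<in> probs_Omega" and \<beta>: "\<beta> \<in> rvs Y"
  shows "\<exists>M\<in>qmeas (Y \<times>\<^sub>Q Omega) (qprob Omega). \<forall>t. \<forall>D\<in>sets (\<B> (Omega \<times>\<^sub>Q Y)).
    (\<integral>\<^sup>+ u. emeasure (M (\<beta> (hpair t u), t)) {x. (x, \<beta> (hpair t u)) \<in> D} \<partial>P) =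
      emeasure P {u. (u, \<beta> (hpair t u)) \<in> D}"
proof -
  note O = quasi_universal_Omega
  note OY = quasi_universal_qprod[OF O Y]
  let ?\<gamma> = "\<lambda>t u. (u, \<beta> (hpair t u))"
  let ?K = "\<lambda>t. distr P (\<B> (Omega \<times>\<^sub>Q Y)) (?\<gamma> t)"
  have g: "?\<gamma> t \<in> rvs (Omega \<times>\<^sub>Q Y)" for t
    by (intro rvs_PairI rvs_hpair[OF Y \<beta>]) (simp add: rvs_Omega)
  have K: "?K \<in> qmeas Omega (qprob (Omega \<times>\<^sub>Q Y))"
  proof (rule qmeasI[OF O quasi_universal_qprob[OF OY]])
    fix \<Phi> assume "\<Phi> \<in> rvs Omega"
    then have \<Phi>: "\<Phi> \<in> B_Omega \<rightarrow>\<^sub>M B_Omega" by (simp add: rvs_Omega)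
    have "(\<lambda>w. (hsnd w, \<beta> (hpair (\<Phi> (hfst w)) (hsnd w)))) \<in> rvs (Omega \<times>\<^sub>Q Y)"
      using measurable_hsnd
      by (intro rvs_PairI rvs_compose[OF Y \<beta>] measurable_hpair measurable_compose[OF measurable_hfst \<Phi>])
        (simp_all add: rvs_Omega)
    then show "(\<lambda>t. ?K (\<Phi> t)) \<in> rvs (qprob (Omega \<times>\<^sub>Q Y))"
      unfolding rvs_qprob_iff[OF OY]
      by (intro bexI[OF _ P] bexI[of _ "\<lambda>w. (hsnd w, \<beta> (hpair (\<Phi> (hfst w)) (hsnd w)))"]) simp_all
  qed (simp add: points_Omega)
  \<comment> \<open>The case of a standard first component with Omega in the place of both X and Z;
    the first component is u itself.\<close>
  obtain M where M: "M \<in> qmeas (Y \<times>\<^sub>Q Omega) (qprob Omega)"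
    and eq: "?K = kernel_prod Omega Y Omega (M, kernel_marginal Y Omega ?K)"
    using disintegration_standard_fst[OF O Y O sep standard_Omega K] by (elim bexE)
  show ?thesis
  proof (intro bexI[OF _ M] allI ballI)
    fix t D assume D: "D \<in> sets (\<B> (Omega \<times>\<^sub>Q Y))"
    have t: "t \<in> points Omega" by (simp add: points_Omega)
    have marg: "kernel_marginal Y Omega ?K t = distr P (\<B> Y) (\<lambda>u. \<beta> (hpair t u))"
      using kernel_marginal_distr[where K="?K" and z=t and Z=Omega, OF O Y t P g[of t]] by simp
    have "emeasure P {u. (u, \<beta> (hpair t u)) \<in> D} = emeasure (?K t) D"
      by (rule distr_rv(2)[OF OY P g D, symmetric])
    also have "\<dots> = (\<integral>\<^sup>+ y. emeasure (M (y, t)) {x. (x, y) \<in> D} \<partial>kernel_marginal Y Omega ?K t)"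
      using arg_cong[OF fun_cong[OF eq, of t], of "\<lambda>\<mu>. emeasure \<mu> D"]
      unfolding emeasure_kernel_prod[OF O Y O M kernel_marginal_qmeas[OF O Y O K] t D] .
    also have "\<dots> = (\<integral>\<^sup>+ u. emeasure (M (\<beta> (hpair t u), t)) {x. (x, \<beta> (hpair t u)) \<in> D} \<partial>P)"
      unfolding marg by (rule nn_integral_kernel_section[OF O Y O M t D P rvs_hpair[OF Y \<beta>]])
    finally show "(\<integral>\<^sup>+ u. emeasure (M (\<beta> (hpair t u), t)) {x. (x, \<beta> (hpair t u)) \<in> D} \<partial>P) =
      emeasure P {u. (u, \<beta> (hpair t u)) \<in> D}" by (rule sym)
  qed
qed

lemma distr_rv_distr:
  assumes X: "quasi_universal X" and P: "P \<in> probs_Omega" and \<alpha>: "\<alpha> \<in> rvs X"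
    and \<phi>: "\<phi> \<in> B_Omega \<rightarrow>\<^sub>M B_Omega"
  shows "distr (distr P (\<B> Omega) \<phi>) (\<B> X) \<alpha> = distr P (\<B> X) (\<lambda>v. \<alpha> (\<phi> v))"
proof -
  have "\<phi> \<in> P \<rightarrow>\<^sub>M \<B> Omega"
    using \<phi> by (simp add: measurable_probs_Omega[OF P] cong: measurable_cong_sets[OF refl sets_induced_Omega])
  moreover have "\<alpha> \<in> \<B> Omega \<rightarrow>\<^sub>M \<B> X"
    using measurable_rvs[OF X \<alpha>] measurable_cong_sets[OF sets_induced_Omega refl] by blast
  ultimately show ?thesis by (simp add: distr_distr o_def)
qed

lemma emeasure_distr_qprob_Omega:
  assumes X: "quasi_universal X" and \<mu>: "\<mu> \<in> points (qprob Omega)" and \<alpha>: "\<alpha> \<in> rvs X"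
    and B: "B \<in> sets (\<B> X)"
  shows "emeasure (distr \<mu> (\<B> X) \<alpha>) B = emeasure \<mu> {u. \<alpha> u \<in> B}"
proof -
  obtain P \<phi> where P: "P \<in> probs_Omega" "\<phi> \<in> rvs Omega" and \<mu>: "\<mu> = distr P (\<B> Omega) \<phi>"
    using \<mu> by (rule points_qprobE)
  have "\<alpha> \<in> \<mu> \<rightarrow>\<^sub>M \<B> X"
    using measurable_rvs[OF X \<alpha>] measurable_cong_sets[OF sets_induced_Omega refl]
    unfolding \<mu> measurable_distr_eq1 by blast
  from emeasure_distr[OF this B] show ?thesis by (simp add: \<mu> points_Omega vimage_def)
qed

text \<open>Once L is known to be a kernel, the equation is pointwise in z, so P and \<gamma> may be
  chosen for each z separately, without regard to measurability.\<close>

lemma disintegration_eqI: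
  assumes X: "quasi_universal X" and Y: "quasi_universal Y" and Z: "quasi_universal Z"
    and K: "K \<in> qmeas Z (qprob (X \<times>\<^sub>Q Y))" and L: "L \<in> qmeas (Y \<times>\<^sub>Q Z) (qprob X)"
    and eq: "\<And>z. z \<in> points Z \<Longrightarrow> \<exists>P\<in>probs_Omega. \<exists>\<gamma>\<in>rvs (X \<times>\<^sub>Q Y).
      K z = distr P (\<B> (X \<times>\<^sub>Q Y)) \<gamma> \<and>
      (\<forall>D\<in>sets (\<B> (X \<times>\<^sub>Q Y)).
        (\<integral>\<^sup>+ u. emeasure (L (snd (\<gamma> u), z)) {x. (x, snd (\<gamma> u)) \<in> D} \<partial>P) = emeasure P {u. \<gamma> u \<in> D})"
  shows "K = kernel_prod X Y Z (L, kernel_marginal Y Z K)"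
proof -
  note XY = quasi_universal_qprod[OF X Y]
  have "kernel_prod X Y Z (L, kernel_marginal Y Z K) z = K z" if z: "z \<in> points Z" for z
  proof (rule kernel_prod_eqI[OF L kernel_marginal_qmeas[OF X Y Z K] z])
    from eq[OF z] obtain P \<gamma> where P: "P \<in> probs_Omega" and \<gamma>: "\<gamma> \<in> rvs (X \<times>\<^sub>Q Y)"
      and Kz: "K z = distr P (\<B> (X \<times>\<^sub>Q Y)) \<gamma>"
      and e: "\<forall>D\<in>sets (\<B> (X \<times>\<^sub>Q Y)).
        (\<integral>\<^sup>+ u. emeasure (L (snd (\<gamma> u), z)) {x. (x, snd (\<gamma> u)) \<in> D} \<partial>P) = emeasure P {u. \<gamma> u \<in> D}"
      by (elim bexE conjE)
    show "sets (K z) = sets (\<B> (X \<times>\<^sub>Q Y))" by (simp add: Kz)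
    fix D assume D: "D \<in> sets (\<B> (X \<times>\<^sub>Q Y))"
    have \<beta>: "(\<lambda>u. snd (\<gamma> u)) \<in> rvs Y" using \<gamma> by (simp add: rvs_qprod_iff)
    show "(\<integral>\<^sup>+ y. emeasure (L (y, z)) {x. (x, y) \<in> D} \<partial>kernel_marginal Y Z K z) = emeasure (K z) D"
      unfolding kernel_marginal_distr[where K=K and z=z, OF X Y z P \<gamma> Kz]
        nn_integral_kernel_section[OF X Y Z L z D P \<beta>] bspec[OF e D]
      unfolding Kz by (rule distr_rv(2)[OF XY P \<gamma> D, symmetric])
  qed
  then show ?thesis
    using K kernel_prod_qmeas[OF X Y Z L kernel_marginal_qmeas[OF X Y Z K]]
    by (intro extensionalityI[of _ "points Z"]) (auto simp: qmeas_def PiE_iff)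
qed

text \<open>The retraction r is itself a random variable of Z, so K along r has a single
  representation on Omega, and t = i z recovers K z.\<close>

lemma disintegration_standard_parameter:
  assumes X: "quasi_universal X" and Y: "quasi_universal Y" and Z: "quasi_universal Z"
    and sep: "countably_separated Y" and i: "i \<in> qmeas Z Omega" and r: "r \<in> qmeas Omega Z"
    and ri: "\<forall>z\<in>points Z. r (i z) = z"
    and K: "K \<in> qmeas Z (qprob (X \<times>\<^sub>Q Y))"
  shows "\<exists>L\<in>qmeas (Y \<times>\<^sub>Q Z) (qprob X). K = kernel_prod X Y Z (L, kernel_marginal Y Z K)"
proof -
  note O = quasi_universal_Omega
  note XY = quasi_universal_qprod[OF X Y] and YZ = quasi_universal_qprod[OF Y Z]
  have "r \<in> rvs Z" using qmeasD[OF r, of "\<lambda>t. t"] by (simp add: rvs_Omega)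
  from qmeasD[OF K this] obtain P \<gamma> where P: "P \<in> probs_Omega" and \<gamma>: "\<gamma> \<in> rvs (X \<times>\<^sub>Q Y)"
    and Kr: "(\<lambda>t. K (r t)) = (\<lambda>t. distr P (\<B> (X \<times>\<^sub>Q Y)) (\<lambda>u. \<gamma> (hpair t u)))"
    unfolding rvs_qprob_iff[OF XY] by (elim bexE)
  define \<alpha> \<beta> where "\<alpha> w = fst (\<gamma> w)" and "\<beta> w = snd (\<gamma> w)" for w
  have \<alpha>: "\<alpha> \<in> rvs X" and \<beta>: "\<beta> \<in> rvs Y"
    using \<gamma> by (simp_all add: rvs_qprod_iff \<alpha>_def[abs_def] \<beta>_def[abs_def])
  obtain M where M: "M \<in> qmeas (Y \<times>\<^sub>Q Omega) (qprob Omega)"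
    and M_eq: "\<forall>t. \<forall>D\<in>sets (\<B> (Omega \<times>\<^sub>Q Y)).
      (\<integral>\<^sup>+ u. emeasure (M (\<beta> (hpair t u), t)) {x. (x, \<beta> (hpair t u)) \<in> D} \<partial>P) =
        emeasure P {u. (u, \<beta> (hpair t u)) \<in> D}"
    using randomness_disintegration[OF Y sep P \<beta>] by (elim bexE)
  define L where "L = (\<lambda>(y, z)\<in>points (Y \<times>\<^sub>Q Z).
    distr (M (y, i z)) (\<B> X) (\<lambda>u. \<alpha> (hpair (i z) u)))"
  have L: "L \<in> qmeas (Y \<times>\<^sub>Q Z) (qprob X)"
  proof (rule qmeasI[OF YZ quasi_universal_qprob[OF X]])
    show "L \<in> extensional (points (Y \<times>\<^sub>Q Z))" by (simp add: L_def)
    fix \<theta> assume \<theta>: "\<theta> \<in> rvs (Y \<times>\<^sub>Q Z)"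
    define \<zeta> where "\<zeta> t = i (snd (\<theta> t))" for t
    have \<zeta>: "\<zeta> \<in> B_Omega \<rightarrow>\<^sub>M B_Omega"
      using qmeasD[OF i, of "\<lambda>t. snd (\<theta> t)"] \<theta> by (simp add: rvs_qprod_iff rvs_Omega \<zeta>_def[abs_def])
    have "(\<lambda>t. (fst (\<theta> t), \<zeta> t)) \<in> rvs (Y \<times>\<^sub>Q Omega)"
      using \<theta> \<zeta> by (simp add: rvs_qprod_iff rvs_Omega)
    from qmeasD[OF M this] obtain P' \<phi> where P': "P' \<in> probs_Omega" and \<phi>: "\<phi> \<in> rvs Omega"
      and M': "(\<lambda>t. M (fst (\<theta> t), \<zeta> t)) = (\<lambda>t. distr P' (\<B> Omega) (\<lambda>u. \<phi> (hpair t u)))"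
      unfolding rvs_qprob_iff[OF O] by (elim bexE)
    have \<phi>': "\<phi> \<in> B_Omega \<rightarrow>\<^sub>M B_Omega" using \<phi> by (simp add: rvs_Omega)
    have "L (\<theta> t) = distr P' (\<B> X) (\<lambda>v. \<alpha> (hpair (\<zeta> (hfst (hpair t v))) (\<phi> (hpair t v))))" for t
    proof -
      have "L (\<theta> t) = distr (M (fst (\<theta> t), \<zeta> t)) (\<B> X) (\<lambda>u. \<alpha> (hpair (\<zeta> t) u))"
        using quasi_universal_range[OF YZ \<theta>, of t] by (simp add: L_def case_prod_beta \<zeta>_def)
      also have "M (fst (\<theta> t), \<zeta> t) = distr P' (\<B> Omega) (\<lambda>u. \<phi> (hpair t u))"
        by (rule fun_cong[OF M'])
      finally show ?thesis
        using distr_rv_distr[OF X P' rvs_hpair[OF X \<alpha>] measurable_compose[OF measurable_hpair1 \<phi>']] by simp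
    qed
    moreover have "(\<lambda>w. \<alpha> (hpair (\<zeta> (hfst w)) (\<phi> w))) \<in> rvs X"
      by (intro rvs_compose[OF X \<alpha>] measurable_hpair measurable_compose[OF measurable_hfst \<zeta>] \<phi>')
    ultimately show "(\<lambda>t. L (\<theta> t)) \<in> rvs (qprob X)"
      unfolding rvs_qprob_iff[OF X]
      by (intro bexI[OF _ P'] bexI[of _ "\<lambda>w. \<alpha> (hpair (\<zeta> (hfst w)) (\<phi> w))"] ext)
  qed
  have "K = kernel_prod X Y Z (L, kernel_marginal Y Z K)"
  proof (rule disintegration_eqI[OF X Y Z K L], intro bexI conjI ballI)
    fix z assume z: "z \<in> points Z"
    show "K z = distr P (\<B> (X \<times>\<^sub>Q Y)) (\<lambda>u. \<gamma> (hpair (i z) u))"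
      using fun_cong[OF Kr, of "i z"] ri z by simp
    show "(\<lambda>u. \<gamma> (hpair (i z) u)) \<in> rvs (X \<times>\<^sub>Q Y)" by (rule rvs_hpair[OF XY \<gamma>])
    fix D assume D: "D \<in> sets (\<B> (X \<times>\<^sub>Q Y))"
    \<comment> \<open>D pulled back in its first component only: the law of u given y is tested
      against it, while y stays in place.\<close>
    let ?D = "{p \<in> points (Omega \<times>\<^sub>Q Y). (\<alpha> (hpair (i z) (fst p)), snd p) \<in> D}"
    have D': "?D \<in> sets (\<B> (Omega \<times>\<^sub>Q Y))"
      using rvs_compose[OF X rvs_hpair[OF X \<alpha>]]
      by (intro sets_induced_algebra_vimage[OF quasi_universal_qprod[OF O Y] XY D] rvs_PairI)
        (simp_all add: rvs_qprod_iff rvs_Omega)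
    have pt: "(u, \<beta> w) \<in> ?D \<longleftrightarrow> (\<alpha> (hpair (i z) u), \<beta> w) \<in> D" for u w
      using quasi_universal_range[OF Y \<beta>] by (simp add: points_qprod points_Omega)
    have "emeasure (L (\<beta> w, z)) {x. (x, \<beta> w) \<in> D} = emeasure (M (\<beta> w, i z)) {x. (x, \<beta> w) \<in> ?D}" for w
    proof -
      have bp: "\<beta> w \<in> points Y" by (rule quasi_universal_range[OF Y \<beta>])
      have "M (\<beta> w, i z) \<in> points (qprob Omega)"
        using bp by (intro qmeas_points[OF M]) (simp add: points_qprod points_Omega)
      from emeasure_distr_qprob_Omega[OF X this rvs_hpair[OF X \<alpha>] section_fst_sets[OF X Y D bp], of "i z"]
      show ?thesis unfolding pt using bp z by (simp add: L_def points_qprod)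
    qed
    then show "(\<integral>\<^sup>+ u. emeasure (L (snd (\<gamma> (hpair (i z) u)), z)) {x. (x, snd (\<gamma> (hpair (i z) u))) \<in> D} \<partial>P) =
        emeasure P {u. \<gamma> (hpair (i z) u) \<in> D}"
      using bspec[OF spec[OF M_eq, of "i z"] D'] unfolding pt by (simp add: \<alpha>_def \<beta>_def)
  qed (rule P)
  with L show ?thesis by blast
qed

lemma emeasure_hprod_hfst:
  assumes "P \<in> probs_Omega" "Q \<in> probs_Omega" "A \<in> sets B_Omega"
  shows "emeasure (hprod P Q) {m. hfst m \<in> A} = emeasure P A"
proof -
  note [simp] = probs_OmegaD[OF assms(1)] probs_OmegaD[OF assms(2)]
  have s: "{m. hfst m \<in> A} \<in> sets B_Omega"
    using measurable_sets[OF measurable_hfst assms(3)] by (simp add: vimage_def)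
  have "emeasure Q (hpair a -` {m. hfst m \<in> A}) = indicator A a" for a
    using prob_space.emeasure_space_1[OF probs_OmegaD(1)[OF assms(2)]] by (simp add: vimage_def indicator_def)
  then show ?thesis using emeasure_hprod[OF assms(1,2) s] assms(3) by simp
qed

lemma emeasure_hprod_hsnd:
  assumes "P \<in> probs_Omega" "Q \<in> probs_Omega" "A \<in> sets B_Omega"
  shows "emeasure (hprod P Q) {m. hsnd m \<in> A} = emeasure Q A"
proof -
  note [simp] = probs_OmegaD[OF assms(1)] probs_OmegaD[OF assms(2)]
  have s: "{m. hsnd m \<in> A} \<in> sets B_Omega"
    using measurable_sets[OF measurable_hsnd assms(3)] by (simp add: vimage_def)
  have "emeasure Q (hpair a -` {m. hsnd m \<in> A}) = emeasure Q A" for a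
    by (simp add: vimage_def)
  then show ?thesis using emeasure_hprod[OF assms(1,2) s] 
      prob_space.emeasure_space_1[OF probs_OmegaD(1)[OF assms(1)]] by simp
qed

section \<open>Discrete conditioning space\<close>

lemma discrete_sets_induced:
  assumes Y: "quasi_universal Y" and d: "discrete_qus Y" and S: "S \<subseteq> points Y"
  shows "S \<in> sets (\<B> Y)"
proof -
  have "{t. \<alpha> t \<in> S} \<in> sets B_Omega" if "\<alpha> \<in> rvs Y" for \<alpha>
  proof -
    have "\<alpha> \<in> B_Omega \<rightarrow>\<^sub>M count_space (points Y)" using d that by (simp add: discrete_qus_def)
    then have "\<alpha> -` S \<inter> space B_Omega \<in> sets B_Omega" by (rule measurable_sets) (simp add: S)
    then show ?thesis by (simp add: vimage_def)
  qed
  then show ?thesis using S by (simp add: sets_induced_algebra_iff[OF Y])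
qed

lemma discrete_countably_separated:
  assumes Y: "quasi_universal Y" and d: "discrete_qus Y"
  shows "countably_separated Y"
  unfolding countably_separated_def
proof (intro exI conjI ballI impI)
  show "countable ((\<lambda>y. {y}) ` points Y)" using d by (simp add: discrete_qus_def)
  show "(\<lambda>y. {y}) ` points Y \<subseteq> sets (\<B> Y)"
    by (auto intro: discrete_sets_induced[OF Y d])
  show "\<exists>A\<in>(\<lambda>y. {y}) ` points Y. (x \<in> A) \<noteq> (y \<in> A)" if "x \<in> points Y" "x \<noteq> y" for x y
    using that by (intro bexI[of _ "{x}"]) auto
qed

lemma distr_hprod_hfst:
  assumes X: "quasi_universal X" and P: "P \<in> probs_Omega" and Q: "Q \<in> probs_Omega" and \<alpha>: "\<alpha> \<in> rvs X"
  shows "distr (hprod P Q) (\<B> X) (\<lambda>m. \<alpha> (hfst m)) = distr P (\<B> X) \<alpha>"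
proof (rule measure_eqI)
  fix A assume "A \<in> sets (distr (hprod P Q) (\<B> X) (\<lambda>m. \<alpha> (hfst m)))"
  then have A: "A \<in> sets (\<B> X)" by simp
  show "emeasure (distr (hprod P Q) (\<B> X) (\<lambda>m. \<alpha> (hfst m))) A = emeasure (distr P (\<B> X) \<alpha>) A"
    using emeasure_hprod_hfst[OF P Q sets_rv_vimage[OF X \<alpha> A]]
    by (simp add: distr_rv(2)[OF X hprod_probs_Omega[OF P Q] rvs_compose[OF X \<alpha> measurable_hfst] A] distr_rv(2)[OF X P \<alpha> A])
qed simp

lemma distr_hprod_hsnd:
  assumes X: "quasi_universal X" and P: "P \<in> probs_Omega" and Q: "Q \<in> probs_Omega" and \<alpha>: "\<alpha> \<in> rvs X"
  shows "distr (hprod P Q) (\<B> X) (\<lambda>m. \<alpha> (hsnd m)) = distr Q (\<B> X) \<alpha>"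
proof (rule measure_eqI)
  fix A assume "A \<in> sets (distr (hprod P Q) (\<B> X) (\<lambda>m. \<alpha> (hsnd m)))"
  then have A: "A \<in> sets (\<B> X)" by simp
  show "emeasure (distr (hprod P Q) (\<B> X) (\<lambda>m. \<alpha> (hsnd m))) A = emeasure (distr Q (\<B> X) \<alpha>) A"
    using emeasure_hprod_hsnd[OF P Q sets_rv_vimage[OF X \<alpha> A]]
    by (simp add: distr_rv(2)[OF X hprod_probs_Omega[OF P Q] rvs_compose[OF X \<alpha> measurable_hsnd] A] distr_rv(2)[OF X Q \<alpha> A])
qed simp

text \<open>Tested against B \<times> {y}, the integrand vanishes unless the second component is y;
  there it is constant, and dividing by the positive mass of y leaves the push-forward of
  \<open>M y\<close>. Thus an elementary conditional law is realised by a conditioned random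
  source.\<close>

lemma conditional_law_eq_disintegration:
  assumes X: "quasi_universal X" and Y: "quasi_universal Y" and d: "discrete_qus Y"
    and P: "P \<in> probs_Omega" and \<gamma>: "\<gamma> \<in> rvs (X \<times>\<^sub>Q Y)"
    and M: "M y \<in> points (qprob Omega)"
    and M_eq: "\<forall>D\<in>sets (\<B> (Omega \<times>\<^sub>Q Y)).
      (\<integral>\<^sup>+ u. emeasure (M (snd (\<gamma> u))) {x. (x, snd (\<gamma> u)) \<in> D} \<partial>P) = emeasure P {u. (u, snd (\<gamma> u)) \<in> D}"
    and y: "y \<in> points Y" and pos: "emeasure P {u. snd (\<gamma> u) = y} \<noteq> 0"
  shows "distr (uniform_measure (distr P (\<B> (X \<times>\<^sub>Q Y)) \<gamma>) {w \<in> points (X \<times>\<^sub>Q Y). snd w = y})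
      (\<B> X) fst = distr (M y) (\<B> X) (\<lambda>u. fst (\<gamma> u))"
    (is "distr (uniform_measure ?\<mu> ?E) _ _ = _")
proof (rule measure_eqI)
  note O = quasi_universal_Omega
  note XY = quasi_universal_qprod[OF X Y]
  note [simp] = probs_OmegaD[OF P]
  interpret P: prob_space P by simp
  have \<alpha>: "(\<lambda>u. fst (\<gamma> u)) \<in> rvs X" and \<beta>: "(\<lambda>u. snd (\<gamma> u)) \<in> rvs Y" using \<gamma> by (simp_all add: rvs_qprod_iff)
  have yY: "{y} \<in> sets (\<B> Y)" using y by (intro discrete_sets_induced[OF Y d]) auto
  have "{w \<in> points (X \<times>\<^sub>Q Y). snd w \<in> {y}} \<in> sets (\<B> (X \<times>\<^sub>Q Y))"
    by (rule sets_induced_algebra_vimage[OF XY Y yY]) (simp add: rvs_qprod_iff)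
  then have E: "?E \<in> sets (\<B> (X \<times>\<^sub>Q Y))" by simp
  have \<gamma>_mem: "\<gamma> u \<in> points (X \<times>\<^sub>Q Y)" for u by (rule quasi_universal_range[OF XY \<gamma>])
  fix B assume "B \<in> sets (distr (uniform_measure ?\<mu> ?E) (\<B> X) fst)"
  then have B: "B \<in> sets (\<B> X)" by simp
  let ?F = "fst -` B \<inter> points (X \<times>\<^sub>Q Y)"
  have F: "?F \<in> sets (\<B> (X \<times>\<^sub>Q Y))"
    using measurable_sets[OF measurable_fst_induced[OF X Y] B] by simp
  have f: "fst \<in> uniform_measure ?\<mu> ?E \<rightarrow>\<^sub>M \<B> X"
    using measurable_fst_induced[OF X Y] by simp
  have BY: "{u. snd (\<gamma> u) = y} \<in> sets B_Omega"
    using sets_rv_vimage[OF Y \<beta> yY] by simp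
  let ?D = "{p \<in> points (Omega \<times>\<^sub>Q Y). (fst (\<gamma> (fst p)), snd p) \<in> B \<times> {y}}"
  have "emeasure (distr (uniform_measure ?\<mu> ?E) (\<B> X) fst) B = emeasure (uniform_measure ?\<mu> ?E) ?F"
    using emeasure_distr[OF f B] by simp
  also have "\<dots> = emeasure ?\<mu> (?E \<inter> ?F) / emeasure ?\<mu> ?E"
    using E F by (intro emeasure_uniform_measure) auto
  also have "emeasure ?\<mu> ?E = emeasure P {u. snd (\<gamma> u) = y}"
    using distr_rv(2)[OF XY P \<gamma> E] \<gamma>_mem by simp
  also have "emeasure ?\<mu> (?E \<inter> ?F) = emeasure P {u. (u, snd (\<gamma> u)) \<in> ?D}"
  proof -
    have "{u. \<gamma> u \<in> ?E \<inter> ?F} = {u. (u, snd (\<gamma> u)) \<in> ?D}"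
      using \<gamma>_mem y by (auto simp: points_qprod points_Omega)
    then show ?thesis using distr_rv(2)[OF XY P \<gamma> sets.Int[OF E F]] by simp
  qed
  also have "\<dots> = (\<integral>\<^sup>+ u. emeasure (M (snd (\<gamma> u))) {x. (x, snd (\<gamma> u)) \<in> ?D} \<partial>P)"
  proof (rule bspec[OF M_eq, symmetric])
    have "?D = {p \<in> points (Omega \<times>\<^sub>Q Y). fst (\<gamma> (fst p)) \<in> B} \<inter> {p \<in> points (Omega \<times>\<^sub>Q Y). snd p \<in> {y}}" by auto
    also have "\<dots> \<in> sets (\<B> (Omega \<times>\<^sub>Q Y))"
      by (intro sets.Int sets_induced_algebra_vimage[OF quasi_universal_qprod[OF O Y] X B]
          sets_induced_algebra_vimage[OF quasi_universal_qprod[OF O Y] Y yY])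
        (auto simp: rvs_qprod_iff rvs_Omega intro: rvs_compose[OF X \<alpha>])
    finally show "?D \<in> sets (\<B> (Omega \<times>\<^sub>Q Y))" .
  qed
  also have "\<dots> = (\<integral>\<^sup>+ u. emeasure (M y) {u. fst (\<gamma> u) \<in> B} * indicator {u. snd (\<gamma> u) = y} u \<partial>P)"
    using y by (intro nn_integral_cong) (auto simp: points_qprod points_Omega indicator_def)
  also have "\<dots> = emeasure (M y) {u. fst (\<gamma> u) \<in> B} * emeasure P {u. snd (\<gamma> u) = y}"
    using BY by (intro nn_integral_cmult_indicator) simp
  also have "\<dots> / emeasure P {u. snd (\<gamma> u) = y} = emeasure (M y) {u. fst (\<gamma> u) \<in> B}"
    using pos by (intro mult_divide_eq_ennreal) (auto simp: P.emeasure_eq_measure)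
  also have "\<dots> = emeasure (distr (M y) (\<B> X) (\<lambda>u. fst (\<gamma> u))) B"
    by (rule emeasure_distr_qprob_Omega[OF X M \<alpha> B, symmetric])
  finally show "emeasure (distr (uniform_measure ?\<mu> ?E) (\<B> X) fst) B =
    emeasure (distr (M y) (\<B> X) (\<lambda>u. fst (\<gamma> u))) B" .
qed simp

text \<open>Z may have no global parametrisation, so L is given by a formula in \<open>K z\<close>
  alone. Representations of K along random variables of Z are chosen afterwards to show
  admissibility: the elementary law is the push-forward of the conditioned randomness, the fallback
  that of the original randomness, both along the same random variable of X.\<close>

lemma disintegration_discrete:
  assumes X: "quasi_universal X" and Y: "quasi_universal Y" and Z: "quasi_universal Z"
    and d: "discrete_qus Y" and K: "K \<in> qmeas Z (qprob (X \<times>\<^sub>Q Y))"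
  shows "\<exists>L\<in>qmeas (Y \<times>\<^sub>Q Z) (qprob X). K = kernel_prod X Y Z (L, kernel_marginal Y Z K)"
proof -
  note O = quasi_universal_Omega
  note XY = quasi_universal_qprod[OF X Y] and YZ = quasi_universal_qprod[OF Y Z]
  note sep = discrete_countably_separated[OF Y d]
  have countY: "countable (points Y)" using d by (simp add: discrete_qus_def)
  have yY: "{y} \<in> sets (\<B> Y)" if "y \<in> points Y" for y
    using that by (intro discrete_sets_induced[OF Y d]) auto
  define E where "E y = {w \<in> points (X \<times>\<^sub>Q Y). snd w = y}" for y
  have E: "E y \<in> sets (\<B> (X \<times>\<^sub>Q Y))" if "y \<in> points Y" for y
  proof -
    have "{w \<in> points (X \<times>\<^sub>Q Y). snd w \<in> {y}} \<in> sets (\<B> (X \<times>\<^sub>Q Y))"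
      by (rule sets_induced_algebra_vimage[OF XY Y yY[OF that]]) (simp add: rvs_qprod_iff)
    then show ?thesis by (simp add: E_def)
  qed
  have emE: "emeasure (distr P (\<B> (X \<times>\<^sub>Q Y)) \<gamma>) (E y) = emeasure P {u. snd (\<gamma> u) = y}"
    if "P \<in> probs_Omega" "\<gamma> \<in> rvs (X \<times>\<^sub>Q Y)" "y \<in> points Y" for P \<gamma> y
    using distr_rv(2)[OF XY that(1,2) E[OF that(3)]] quasi_universal_range[OF XY that(2)]
    by (simp add: E_def)
  define L where "L = (\<lambda>(y, z)\<in>points (Y \<times>\<^sub>Q Z).
    distr (if emeasure (K z) (E y) = 0 then K z else uniform_measure (K z) (E y)) (\<B> X) fst)"
  have L: "L \<in> qmeas (Y \<times>\<^sub>Q Z) (qprob X)"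
  proof (rule qmeasI[OF YZ quasi_universal_qprob[OF X]])
    show "L \<in> extensional (points (Y \<times>\<^sub>Q Z))" by (simp add: L_def)
    fix \<theta> assume \<theta>: "\<theta> \<in> rvs (Y \<times>\<^sub>Q Z)"
    define \<eta> \<zeta> where "\<eta> t = fst (\<theta> t)" and "\<zeta> t = snd (\<theta> t)" for t
    have \<eta>: "\<eta> \<in> rvs Y" and \<zeta>: "\<zeta> \<in> rvs Z"
      using \<theta> by (simp_all add: rvs_qprod_iff \<eta>_def[abs_def] \<zeta>_def[abs_def])
    have \<eta>_mem: "\<eta> t \<in> points Y" for t by (rule quasi_universal_range[OF Y \<eta>])
    from qmeasD[OF K \<zeta>] obtain P \<gamma> where P: "P \<in> probs_Omega" and \<gamma>: "\<gamma> \<in> rvs (X \<times>\<^sub>Q Y)"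
      and K\<zeta>: "(\<lambda>t. K (\<zeta> t)) = (\<lambda>t. distr P (\<B> (X \<times>\<^sub>Q Y)) (\<lambda>u. \<gamma> (hpair t u)))"
      unfolding rvs_qprob_iff[OF XY] by (elim bexE)
    have \<alpha>: "(\<lambda>w. fst (\<gamma> w)) \<in> rvs X" and \<beta>: "(\<lambda>w. snd (\<gamma> w)) \<in> rvs Y"
      using \<gamma> by (simp_all add: rvs_qprod_iff)
    obtain M where M: "M \<in> qmeas (Y \<times>\<^sub>Q Omega) (qprob Omega)"
      and M_eq: "\<forall>t. \<forall>D\<in>sets (\<B> (Omega \<times>\<^sub>Q Y)).
        (\<integral>\<^sup>+ u. emeasure (M (snd (\<gamma> (hpair t u)), t)) {x. (x, snd (\<gamma> (hpair t u))) \<in> D} \<partial>P) =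
          emeasure P {u. (u, snd (\<gamma> (hpair t u))) \<in> D}"
      using randomness_disintegration[OF Y sep P \<beta>] by (elim bexE)
    have "(\<lambda>t. (\<eta> t, t)) \<in> rvs (Y \<times>\<^sub>Q Omega)" using \<eta> by (simp add: rvs_qprod_iff rvs_Omega)
    from qmeasD[OF M this] obtain P' \<phi> where P': "P' \<in> probs_Omega" and \<phi>: "\<phi> \<in> rvs Omega"
      and M': "(\<lambda>t. M (\<eta> t, t)) = (\<lambda>t. distr P' (\<B> Omega) (\<lambda>u. \<phi> (hpair t u)))"
      unfolding rvs_qprob_iff[OF O] by (elim bexE)
    have \<phi>': "\<phi> \<in> B_Omega \<rightarrow>\<^sub>M B_Omega" using \<phi> by (simp add: rvs_Omega)
    \<comment> \<open>With w coding (t, u), the section of S at t is the event that the sampled y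
      equals \<open>\<eta> t\<close>. Countability of Y makes S measurable.\<close>
    define S where "S = {w. snd (\<gamma> w) = \<eta> (hfst w)}"
    have S: "S \<in> sets B_Omega"
    proof -
      have "S = (\<Union>y\<in>points Y. {w. snd (\<gamma> w) \<in> {y}} \<inter> {w. \<eta> (hfst w) \<in> {y}})"
        using quasi_universal_range[OF Y \<beta>] \<eta>_mem by (auto simp: S_def)
      also have "\<dots> \<in> sets B_Omega"
        by (intro sets.countable_UN'[OF countY] sets.Int image_subsetI
            sets_rv_vimage[OF Y \<beta>] sets_rv_vimage[OF Y rvs_compose[OF Y \<eta> measurable_hfst]] yY)
      finally show ?thesis .
    qed
    define N where "N = {t. emeasure P (hpair t -` S) = 0}"
    have N: "N \<in> sets B_Omega"
      using measurable_sets[OF measurable_emeasure_hpair[OF P S], of "{0}"] by (simp add: N_def vimage_def)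
    have KE: "emeasure (K (\<zeta> t)) (E (\<eta> t)) = emeasure P (hpair t -` S)" for t
      using emE[OF P rvs_hpair[OF XY \<gamma>] \<eta>_mem, of t t] fun_cong[OF K\<zeta>, of t]
      by (simp add: S_def vimage_def)
    \<comment> \<open>The gluing along N happens in Omega, where measurable case distinctions are
      allowed; only then is the common random variable of X applied. Here w codes (t, (v, u)), with
      v driving the conditioned source and u the original one.\<close>
    define \<psi> where "\<psi> w = (if w \<in> hfst -` N then hsnd (hsnd w) else \<phi> (hpair (hfst w) (hfst (hsnd w))))" for w
    have \<psi>: "\<psi> \<in> B_Omega \<rightarrow>\<^sub>M B_Omega"
      unfolding \<psi>_def
    proof (rule measurable_If_set)
      show "(\<lambda>w. hsnd (hsnd w)) \<in> B_Omega \<rightarrow>\<^sub>M B_Omega" by (rule measurable_compose[OF measurable_hsnd measurable_hsnd])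
      show "(\<lambda>w. \<phi> (hpair (hfst w) (hfst (hsnd w)))) \<in> B_Omega \<rightarrow>\<^sub>M B_Omega"
        by (intro measurable_compose[OF _ \<phi>'] measurable_hpair measurable_hfst
            measurable_compose[OF measurable_hsnd measurable_hfst])
      show "hfst -` N \<inter> space B_Omega \<in> sets B_Omega" by (rule measurable_sets[OF measurable_hfst N])
    qed
    let ?\<alpha> = "\<lambda>w. fst (\<gamma> (hpair (hfst w) (\<psi> w)))"
    have "L (\<theta> t) = distr (hprod P' P) (\<B> X) (\<lambda>m. ?\<alpha> (hpair t m))" for t
    proof -
      have L\<theta>: "L (\<theta> t) = distr (if emeasure P (hpair t -` S) = 0 then K (\<zeta> t) else uniform_measure (K (\<zeta> t)) (E (\<eta> t)))
          (\<B> X) fst"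
        using quasi_universal_range[OF YZ \<theta>, of t] KE[of t]
        by (simp add: L_def case_prod_beta \<eta>_def \<zeta>_def)
      have Kt: "K (\<zeta> t) = distr P (\<B> (X \<times>\<^sub>Q Y)) (\<lambda>u. \<gamma> (hpair t u))" by (rule fun_cong[OF K\<zeta>])
      show ?thesis
      proof (cases "t \<in> N")
        case True
        then have "L (\<theta> t) = distr (K (\<zeta> t)) (\<B> X) fst" by (simp add: L\<theta> N_def)
        also have "\<dots> = distr P (\<B> X) (\<lambda>u. fst (\<gamma> (hpair t u)))"
          using measurable_rvs[OF XY rvs_hpair[OF XY \<gamma>, of t]] measurable_fst_induced[OF X Y]
          by (simp add: Kt distr_distr measurable_probs_Omega[OF P] o_def)
        also have "\<dots> = distr (hprod P' P) (\<B> X) (\<lambda>m. fst (\<gamma> (hpair t (hsnd m))))"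
          by (rule distr_hprod_hsnd[OF X P' P rvs_hpair[OF X \<alpha>], symmetric])
        finally show ?thesis using True by (simp add: \<psi>_def)
      next
        case False
        then have pos: "emeasure P (hpair t -` S) \<noteq> 0" by (simp add: N_def)
        then have "L (\<theta> t) = distr (uniform_measure (K (\<zeta> t)) (E (\<eta> t))) (\<B> X) fst"
          by (simp add: L\<theta>)
        also have "\<dots> = distr (M (\<eta> t, t)) (\<B> X) (\<lambda>u. fst (\<gamma> (hpair t u)))"
          unfolding Kt E_def
        proof (rule conditional_law_eq_disintegration[where M="\<lambda>y. M (y, t)", OF X Y d P rvs_hpair[OF XY \<gamma>] _ spec[OF M_eq]])
          show "M (\<eta> t, t) \<in> points (qprob Omega)"
            using \<eta>_mem by (intro qmeas_points[OF M]) (simp add: points_qprod points_Omega)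
          show "emeasure P {u. snd (\<gamma> (hpair t u)) = \<eta> t} \<noteq> 0"
            using pos by (simp add: S_def vimage_def)
        qed (rule \<eta>_mem)
        also have "M (\<eta> t, t) = distr P' (\<B> Omega) (\<lambda>u. \<phi> (hpair t u))"
          by (rule fun_cong[OF M'])
        also have "distr \<dots> (\<B> X) (\<lambda>u. fst (\<gamma> (hpair t u))) =
            distr P' (\<B> X) (\<lambda>v. fst (\<gamma> (hpair t (\<phi> (hpair t v)))))"
          by (rule distr_rv_distr[OF X P' rvs_hpair[OF X \<alpha>] measurable_compose[OF measurable_hpair1 \<phi>']])
        also have "\<dots> = distr (hprod P' P) (\<B> X) (\<lambda>m. fst (\<gamma> (hpair t (\<phi> (hpair t (hfst m))))))"
          by (rule distr_hprod_hfst[OF X P' P, symmetric])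
            (intro rvs_compose[OF X rvs_hpair[OF X \<alpha>]] measurable_compose[OF measurable_hpair1 \<phi>'])
        finally show ?thesis using False by (simp add: \<psi>_def)
      qed
    qed
    moreover have "?\<alpha> \<in> rvs X"
      by (intro rvs_compose[OF X \<alpha>] measurable_hpair measurable_hfst \<psi>)
    ultimately show "(\<lambda>t. L (\<theta> t)) \<in> rvs (qprob X)"
      unfolding rvs_qprob_iff[OF X]
      by (intro bexI[OF _ hprod_probs_Omega[OF P' P]] bexI[of _ ?\<alpha>] ext)
  qed
  have "K = kernel_prod X Y Z (L, kernel_marginal Y Z K)"
  proof (rule disintegration_eqI[OF X Y Z K L])
    fix z assume z: "z \<in> points Z"
    obtain P \<gamma> where P: "P \<in> probs_Omega" and \<gamma>: "\<gamma> \<in> rvs (X \<times>\<^sub>Q Y)"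
      and Kz: "K z = distr P (\<B> (X \<times>\<^sub>Q Y)) \<gamma>"
      by (rule points_qprobE[OF qmeas_points[OF K z]])
    note [simp] = probs_OmegaD[OF P]
    have \<alpha>: "(\<lambda>w. fst (\<gamma> w)) \<in> rvs X" and \<beta>: "(\<lambda>w. snd (\<gamma> w)) \<in> rvs Y"
      using \<gamma> by (simp_all add: rvs_qprod_iff)
    have \<beta>_mem: "snd (\<gamma> u) \<in> points Y" for u by (rule quasi_universal_range[OF Y \<beta>])
    \<comment> \<open>For fixed z there is no parameter t; composing with \<open>hsnd\<close>
      introduces a dummy one, set to \<open>undefined\<close> below.\<close>
    obtain M where M: "M \<in> qmeas (Y \<times>\<^sub>Q Omega) (qprob Omega)"
      and M_eq: "\<forall>t. \<forall>D\<in>sets (\<B> (Omega \<times>\<^sub>Q Y)).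
        (\<integral>\<^sup>+ u. emeasure (M (snd (\<gamma> (hsnd (hpair t u))), t)) {x. (x, snd (\<gamma> (hsnd (hpair t u)))) \<in> D} \<partial>P) =
          emeasure P {u. (u, snd (\<gamma> (hsnd (hpair t u)))) \<in> D}"
      using randomness_disintegration[OF Y sep P rvs_compose[OF Y \<beta> measurable_hsnd]] by (elim bexE)
    define m where "m y = M (y, undefined)" for y
    have m: "m y \<in> points (qprob Omega)" if "y \<in> points Y" for y
      using that unfolding m_def by (intro qmeas_points[OF M]) (simp add: points_qprod points_Omega)
    have m_eq: "\<forall>D\<in>sets (\<B> (Omega \<times>\<^sub>Q Y)).
        (\<integral>\<^sup>+ u. emeasure (m (snd (\<gamma> u))) {x. (x, snd (\<gamma> u)) \<in> D} \<partial>P) = emeasure P {u. (u, snd (\<gamma> u)) \<in> D}"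
      using spec[OF M_eq, of undefined] by (simp add: m_def)
    let ?n = "\<lambda>y. {u. snd (\<gamma> u) = y}"
    have n: "?n y \<in> sets P" if "y \<in> points Y" for y
      using sets_rv_vimage[OF Y \<beta> yY[OF that]] by simp
    \<comment> \<open>Countably many values of mass 0 together form a null event, so almost surely
      the fallback is not met.\<close>
    have "(\<Union>y\<in>{y \<in> points Y. emeasure P (?n y) = 0}. ?n y) \<in> null_sets P"
      using countY n by (intro null_sets_UN') (auto intro: countable_subset)
    then have AE: "AE u in P. emeasure P (?n (snd (\<gamma> u))) \<noteq> 0"
      by (rule AE_I') (use \<beta>_mem in auto)
    have "(\<integral>\<^sup>+ u. emeasure (L (snd (\<gamma> u), z)) {x. (x, snd (\<gamma> u)) \<in> D} \<partial>P) = emeasure P {u. \<gamma> u \<in> D}"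
      if D: "D \<in> sets (\<B> (X \<times>\<^sub>Q Y))" for D
    proof -
      let ?D = "{p \<in> points (Omega \<times>\<^sub>Q Y). (fst (\<gamma> (fst p)), snd p) \<in> D}"
      have D': "?D \<in> sets (\<B> (Omega \<times>\<^sub>Q Y))"
        using rvs_compose[OF X \<alpha>]
        by (intro sets_induced_algebra_vimage[OF quasi_universal_qprod[OF O Y] XY D] rvs_PairI)
          (simp_all add: rvs_qprod_iff rvs_Omega)
      have "(\<integral>\<^sup>+ u. emeasure (L (snd (\<gamma> u), z)) {x. (x, snd (\<gamma> u)) \<in> D} \<partial>P) =
          (\<integral>\<^sup>+ u. emeasure (m (snd (\<gamma> u))) {x. (x, snd (\<gamma> u)) \<in> ?D} \<partial>P)"
      proof (rule nn_integral_cong_AE, use AE in eventually_elim)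
        case (elim u)
        let ?y = "snd (\<gamma> u)"
        have "L (?y, z) = distr (uniform_measure (K z) (E ?y)) (\<B> X) fst"
          using elim emE[OF P \<gamma> \<beta>_mem[of u]] \<beta>_mem[of u] z by (simp add: L_def points_qprod Kz)
        also have "\<dots> = distr (m ?y) (\<B> X) (\<lambda>u. fst (\<gamma> u))"
          unfolding Kz E_def
          by (rule conditional_law_eq_disintegration[OF X Y d P \<gamma> m[OF \<beta>_mem] m_eq \<beta>_mem elim])
        finally have "emeasure (L (?y, z)) {x. (x, ?y) \<in> D} = emeasure (m ?y) {v. fst (\<gamma> v) \<in> {x. (x, ?y) \<in> D}}"
          using emeasure_distr_qprob_Omega[OF X m[OF \<beta>_mem] \<alpha> section_fst_sets[OF X Y D \<beta>_mem]] by simp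
        then show ?case using \<beta>_mem[of u] by (simp add: points_qprod points_Omega)
      qed
      also have "\<dots> = emeasure P {u. \<gamma> u \<in> D}"
        using bspec[OF m_eq D'] \<beta>_mem by (simp add: points_qprod points_Omega)
      finally show ?thesis .
    qed
    then show "\<exists>P\<in>probs_Omega. \<exists>\<gamma>\<in>rvs (X \<times>\<^sub>Q Y). K z = distr P (\<B> (X \<times>\<^sub>Q Y)) \<gamma> \<and>
      (\<forall>D\<in>sets (\<B> (X \<times>\<^sub>Q Y)).
        (\<integral>\<^sup>+ u. emeasure (L (snd (\<gamma> u), z)) {x. (x, snd (\<gamma> u)) \<in> D} \<partial>P) = emeasure P {u. \<gamma> u \<in> D})"
      using Kz by (intro bexI[OF _ P] bexI[OF _ \<gamma>] conjI ballI)
  qed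
  with L show ?thesis by blast
qed

section \<open>The quotient property\<close>

text \<open>The alternatives are packaged because they are applied to Z and again to Omega \<times>
  Z.\<close>

definition disintegration_hyp :: "'a qus \<Rightarrow> 'b qus \<Rightarrow> 'c qus \<Rightarrow> bool" where
  "disintegration_hyp X Y Z \<longleftrightarrow>
    (countably_separated Y \<and> standard_qus X) \<or> (countably_separated Y \<and> standard_qus Z) \<or> discrete_qus Y"

lemma disintegration_exists:
  assumes X: "quasi_universal X" and Y: "quasi_universal Y" and Z: "quasi_universal Z"
    and hyp: "disintegration_hyp X Y Z" and K: "K \<in> qmeas Z (qprob (X \<times>\<^sub>Q Y))"
  shows "\<exists>L\<in>qmeas (Y \<times>\<^sub>Q Z) (qprob X). K = kernel_prod X Y Z (L, kernel_marginal Y Z K)"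
proof -
  consider "countably_separated Y" "standard_qus X" | "points Z = {}"
    | "countably_separated Y" "\<exists>i\<in>qmeas Z Omega. \<exists>r\<in>qmeas Omega Z. \<forall>z\<in>points Z. r (i z) = z"
    | "discrete_qus Y"
    using hyp unfolding disintegration_hyp_def standard_qus_def[of Z] by argo
  then show ?thesis
  proof cases
    case 1 then show ?thesis by (rule disintegration_standard_fst[OF X Y Z _ _ K])
  next
    case 2 then show ?thesis by (rule disintegration_empty_parameter[OF X Y Z K])
  next
    case 3
    then obtain i r where "i \<in> qmeas Z Omega" "r \<in> qmeas Omega Z" "\<forall>z\<in>points Z. r (i z) = z"
      by (elim bexE)
    then show ?thesis by (rule disintegration_standard_parameter[OF X Y Z 3(1) _ _ _ K])
  next
    case 4 then show ?thesis by (rule disintegration_discrete[OF X Y Z _ K])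
  qed
qed

text \<open>\<open>hpair\<close> absorbs the extra factor Omega into the retraction of Z.\<close>

lemma standard_Omega_qprod:
  assumes Z: "quasi_universal Z" and st: "standard_qus Z"
  shows "standard_qus (Omega \<times>\<^sub>Q Z)"
proof (cases "points Z = {}")
  case True
  then show ?thesis by (simp add: standard_qus_def points_qprod)
next
  case False
  then obtain i r where i: "i \<in> qmeas Z Omega" and r: "r \<in> qmeas Omega Z" and ri: "\<forall>z\<in>points Z. r (i z) = z"
    using st unfolding standard_qus_def by auto
  note O = quasi_universal_Omega
  note OZ = quasi_universal_qprod[OF O Z]
  let ?i = "\<lambda>(t, z)\<in>points (Omega \<times>\<^sub>Q Z). hpair t (i z)" and ?r = "\<lambda>w. (hfst w, r (hsnd w))"
  have "?i \<in> qmeas (Omega \<times>\<^sub>Q Z) Omega"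
  proof (rule qmeasI[OF OZ O])
    fix \<gamma> assume \<gamma>: "\<gamma> \<in> rvs (Omega \<times>\<^sub>Q Z)"
    then have "(\<lambda>t. fst (\<gamma> t)) \<in> B_Omega \<rightarrow>\<^sub>M B_Omega" "(\<lambda>t. snd (\<gamma> t)) \<in> rvs Z"
      by (simp_all add: rvs_qprod_iff rvs_Omega)
    from measurable_hpair[OF this(1) qmeasD[OF i this(2), unfolded rvs_Omega]]
    show "(\<lambda>t. ?i (\<gamma> t)) \<in> rvs Omega"
      using quasi_universal_range[OF OZ \<gamma>] by (simp add: case_prod_beta rvs_Omega)
  qed simp
  moreover have "?r \<in> qmeas Omega (Omega \<times>\<^sub>Q Z)"
  proof (rule qmeasI[OF O OZ])
    fix \<Phi> assume "\<Phi> \<in> rvs Omega"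
    then have "\<Phi> \<in> B_Omega \<rightarrow>\<^sub>M B_Omega" by (simp add: rvs_Omega)
    then show "(\<lambda>t. ?r (\<Phi> t)) \<in> rvs (Omega \<times>\<^sub>Q Z)"
      using measurable_compose[OF _ measurable_hfst] qmeasD[OF r, of "\<lambda>t. hsnd (\<Phi> t)"]
        measurable_compose[OF _ measurable_hsnd]
      by (simp add: rvs_qprod_iff rvs_Omega)
  qed (simp add: points_Omega)
  moreover have "\<forall>p\<in>points (Omega \<times>\<^sub>Q Z). ?r (?i p) = p"
    using ri by (auto simp: points_qprod)
  ultimately show ?thesis
    unfolding standard_qus_def by (intro disjI2 bexI[of _ ?i] bexI[of _ ?r])
qed

text \<open>Fixing t in kernels over Omega \<times> Z commutes with the product; this passes between
  random kernels and kernels with an enlarged parameter.\<close>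

lemma kernel_prod_uncurry:
  assumes X: "quasi_universal X" and Y: "quasi_universal Y" and Z: "quasi_universal Z"
    and F: "F \<in> qmeas (Y \<times>\<^sub>Q Z) (qprob X)" and G: "G \<in> qmeas Z (qprob Y)"
    and L: "L \<in> qmeas (Y \<times>\<^sub>Q (Omega \<times>\<^sub>Q Z)) (qprob X)" and Q: "Q \<in> qmeas (Omega \<times>\<^sub>Q Z) (qprob Y)"
    and z: "z \<in> points Z"
    and eqL: "\<And>y. y \<in> points Y \<Longrightarrow> L (y, (t, z)) = F (y, z)" and eqQ: "Q (t, z) = G z"
  shows "kernel_prod X Y Z (F, G) z = kernel_prod X Y (Omega \<times>\<^sub>Q Z) (L, Q) (t, z)"
proof (rule kernel_prod_eqI[OF F G z])
  note OZ = quasi_universal_qprod[OF quasi_universal_Omega Z]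
  have tz: "(t, z) \<in> points (Omega \<times>\<^sub>Q Z)" using z by (simp add: points_qprod points_Omega)
  show "sets (kernel_prod X Y (Omega \<times>\<^sub>Q Z) (L, Q) (t, z)) = sets (\<B> (X \<times>\<^sub>Q Y))"
    using qmeas_points[OF kernel_prod_qmeas[OF X Y OZ L Q] tz] by (rule points_qprobE) simp
  have sp: "space (G z) = points Y"
    using qmeas_points[OF G z] by (rule points_qprobE) simp
  fix D assume D: "D \<in> sets (\<B> (X \<times>\<^sub>Q Y))"
  show "(\<integral>\<^sup>+ y. emeasure (F (y, z)) {x. (x, y) \<in> D} \<partial>G z) =
      emeasure (kernel_prod X Y (Omega \<times>\<^sub>Q Z) (L, Q) (t, z)) D"
    unfolding emeasure_kernel_prod[OF X Y OZ L Q tz D] eqQ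
    by (intro nn_integral_cong) (simp add: sp eqL)
qed

text \<open>Reading \<gamma> as two kernels with parameter (t, z) turns admissibility of the random
  product into \<open>kernel_prod_qmeas\<close> over Omega \<times> Z.\<close>

lemma kernel_prod_rvs_markov_kernels:
  assumes X: "quasi_universal X" and Y: "quasi_universal Y" and Z: "quasi_universal Z"
    and \<gamma>: "\<gamma> \<in> rvs (markov_kernels (Y \<times>\<^sub>Q Z) X \<times>\<^sub>Q markov_kernels Z Y)"
  shows "(\<lambda>t. kernel_prod X Y Z (\<gamma> t)) \<in> rvs (markov_kernels Z (X \<times>\<^sub>Q Y))"
proof -
  note O = quasi_universal_Omega
  note YZ = quasi_universal_qprod[OF Y Z] and XY = quasi_universal_qprod[OF X Y] and OZ = quasi_universal_qprod[OF O Z]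
  define F G where "F t = fst (\<gamma> t)" and "G t = snd (\<gamma> t)" for t
  have F: "F \<in> rvs (markov_kernels (Y \<times>\<^sub>Q Z) X)" and G: "G \<in> rvs (markov_kernels Z Y)"
    using \<gamma> by (simp_all add: rvs_qprod_iff F_def[abs_def] G_def[abs_def])
  have Ft: "F t \<in> qmeas (Y \<times>\<^sub>Q Z) (qprob X)" and Gt: "G t \<in> qmeas Z (qprob Y)" for t
    using F G by (simp_all add: qfun_def)
  have F': "(\<lambda>(t, p)\<in>points (Omega \<times>\<^sub>Q (Y \<times>\<^sub>Q Z)). F t p) \<in> qmeas (Omega \<times>\<^sub>Q (Y \<times>\<^sub>Q Z)) (qprob X)"
    and Q: "(\<lambda>(t, z)\<in>points (Omega \<times>\<^sub>Q Z). G t z) \<in> qmeas (Omega \<times>\<^sub>Q Z) (qprob Y)"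
    using F G by (simp_all add: qfun_def)
  define L where "L = (\<lambda>(y, t, z)\<in>points (Y \<times>\<^sub>Q (Omega \<times>\<^sub>Q Z)). F t (y, z))"
  have L: "L \<in> qmeas (Y \<times>\<^sub>Q (Omega \<times>\<^sub>Q Z)) (qprob X)"
  proof (rule qmeasI[OF quasi_universal_qprod[OF Y OZ] quasi_universal_qprob[OF X]])
    show "L \<in> extensional (points (Y \<times>\<^sub>Q (Omega \<times>\<^sub>Q Z)))" by (simp add: L_def)
    fix \<theta> assume \<theta>: "\<theta> \<in> rvs (Y \<times>\<^sub>Q (Omega \<times>\<^sub>Q Z))"
    have mem: "\<theta> t \<in> points (Y \<times>\<^sub>Q (Omega \<times>\<^sub>Q Z))" for t
      by (rule quasi_universal_range[OF quasi_universal_qprod[OF Y OZ] \<theta>])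
    have "(\<lambda>t. (fst (snd (\<theta> t)), fst (\<theta> t), snd (snd (\<theta> t)))) \<in> rvs (Omega \<times>\<^sub>Q (Y \<times>\<^sub>Q Z))"
      using \<theta> by (simp add: rvs_qprod_iff)
    from qmeasD[OF F' this] show "(\<lambda>t. L (\<theta> t)) \<in> rvs (qprob X)"
      using mem by (simp add: L_def case_prod_beta points_qprod points_Omega mem_Times_iff)
  qed
  let ?Q = "\<lambda>(t, z)\<in>points (Omega \<times>\<^sub>Q Z). G t z"
  let ?KP = "kernel_prod X Y (Omega \<times>\<^sub>Q Z) (L, ?Q)"
  have KP: "?KP \<in> qmeas (Omega \<times>\<^sub>Q Z) (qprob (X \<times>\<^sub>Q Y))" by (rule kernel_prod_qmeas[OF X Y OZ L Q])
  have eq: "kernel_prod X Y Z (\<gamma> t) z = ?KP (t, z)" if "z \<in> points Z" for t z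
  proof -
    have "kernel_prod X Y Z (F t, G t) z = ?KP (t, z)"
      by (rule kernel_prod_uncurry[OF X Y Z Ft Gt L Q that])
        (simp_all add: L_def points_qprod points_Omega that)
    then show ?thesis by (simp add: F_def G_def)
  qed
  show ?thesis
    unfolding rvs_markov_kernels_iff[OF Z quasi_universal_qprob[OF XY]]
  proof (intro conjI allI)
    show "kernel_prod X Y Z (\<gamma> t) \<in> extensional (points Z)" for t
      using kernel_prod_qmeas[OF X Y Z Ft[of t] Gt[of t]] by (simp add: qmeas_def PiE_iff F_def G_def)
    have "(\<lambda>(t, z)\<in>points (Omega \<times>\<^sub>Q Z). kernel_prod X Y Z (\<gamma> t) z) = ?KP"
    proof (rule extensionalityI[of _ "points (Omega \<times>\<^sub>Q Z)"])
      show "?KP \<in> extensional (points (Omega \<times>\<^sub>Q Z))" using KP by (simp add: qmeas_def PiE_iff)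
    qed (auto simp: eq points_qprod)
    with KP show "(\<lambda>(t, z)\<in>points (Omega \<times>\<^sub>Q Z). kernel_prod X Y Z (\<gamma> t) z) \<in> qmeas (Omega \<times>\<^sub>Q Z) (qprob (X \<times>\<^sub>Q Y))"
      by simp
  qed
qed

text \<open>A single disintegration over Omega \<times> Z treats all t at once, instead of a choice
  of conditional kernel for each t; currying it gives a lift that is admissible by
  construction.\<close>

lemma kernel_prod_rvs_lift:
  assumes X: "quasi_universal X" and Y: "quasi_universal Y" and Z: "quasi_universal Z"
    and ex: "\<And>K. K \<in> qmeas (Omega \<times>\<^sub>Q Z) (qprob (X \<times>\<^sub>Q Y)) \<Longrightarrow> \<exists>L\<in>qmeas (Y \<times>\<^sub>Q (Omega \<times>\<^sub>Q Z)) (qprob X).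
      K = kernel_prod X Y (Omega \<times>\<^sub>Q Z) (L, kernel_marginal Y (Omega \<times>\<^sub>Q Z) K)"
    and R: "R \<in> rvs (markov_kernels Z (X \<times>\<^sub>Q Y))"
  shows "\<exists>\<gamma>\<in>rvs (markov_kernels (Y \<times>\<^sub>Q Z) X \<times>\<^sub>Q markov_kernels Z Y). R = (\<lambda>t. kernel_prod X Y Z (\<gamma> t))"
proof -
  note O = quasi_universal_Omega
  note YZ = quasi_universal_qprod[OF Y Z] and XY = quasi_universal_qprod[OF X Y] and OZ = quasi_universal_qprod[OF O Z]
  define K where "K = (\<lambda>(t, z)\<in>points (Omega \<times>\<^sub>Q Z). R t z)"
  have K: "K \<in> qmeas (Omega \<times>\<^sub>Q Z) (qprob (X \<times>\<^sub>Q Y))" and Rt: "R t \<in> qmeas Z (qprob (X \<times>\<^sub>Q Y))" for t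
    using R by (simp_all add: qfun_def K_def)
  obtain L where L: "L \<in> qmeas (Y \<times>\<^sub>Q (Omega \<times>\<^sub>Q Z)) (qprob X)"
    and KL: "K = kernel_prod X Y (Omega \<times>\<^sub>Q Z) (L, kernel_marginal Y (Omega \<times>\<^sub>Q Z) K)"
    using ex[OF K] by (elim bexE)
  define Q where "Q = kernel_marginal Y (Omega \<times>\<^sub>Q Z) K"
  have Q: "Q \<in> qmeas (Omega \<times>\<^sub>Q Z) (qprob Y)" unfolding Q_def by (rule kernel_marginal_qmeas[OF X Y OZ K])
  define F where "F t = (\<lambda>(y, z)\<in>points (Y \<times>\<^sub>Q Z). L (y, t, z))" for t
  define G where "G t = (\<lambda>z\<in>points Z. Q (t, z))" for t
  have F: "F \<in> rvs (markov_kernels (Y \<times>\<^sub>Q Z) X)"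
    unfolding rvs_markov_kernels_iff[OF YZ quasi_universal_qprob[OF X]]
  proof (intro conjI allI)
    show "F t \<in> extensional (points (Y \<times>\<^sub>Q Z))" for t by (simp add: F_def)
    note OYZ = quasi_universal_qprod[OF O YZ]
    show "(\<lambda>(t, p)\<in>points (Omega \<times>\<^sub>Q (Y \<times>\<^sub>Q Z)). F t p) \<in> qmeas (Omega \<times>\<^sub>Q (Y \<times>\<^sub>Q Z)) (qprob X)"
    proof (rule qmeasI[OF OYZ quasi_universal_qprob[OF X]])
      fix \<theta> assume \<theta>: "\<theta> \<in> rvs (Omega \<times>\<^sub>Q (Y \<times>\<^sub>Q Z))"
      have mem: "\<theta> t \<in> points (Omega \<times>\<^sub>Q (Y \<times>\<^sub>Q Z))" for t by (rule quasi_universal_range[OF OYZ \<theta>])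
      have "(\<lambda>t. (fst (snd (\<theta> t)), fst (\<theta> t), snd (snd (\<theta> t)))) \<in> rvs (Y \<times>\<^sub>Q (Omega \<times>\<^sub>Q Z))"
        using \<theta> by (simp add: rvs_qprod_iff)
      from qmeasD[OF L this]
      show "(\<lambda>t. (\<lambda>(t, p)\<in>points (Omega \<times>\<^sub>Q (Y \<times>\<^sub>Q Z)). F t p) (\<theta> t)) \<in> rvs (qprob X)"
        using mem by (simp add: F_def case_prod_beta points_qprod points_Omega mem_Times_iff)
    qed simp
  qed
  have G: "G \<in> rvs (markov_kernels Z Y)"
    unfolding rvs_markov_kernels_iff[OF Z quasi_universal_qprob[OF Y]]
  proof (intro conjI allI)
    show "G t \<in> extensional (points Z)" for t by (simp add: G_def)
    have "(\<lambda>(t, z)\<in>points (Omega \<times>\<^sub>Q Z). G t z) = Q"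
    proof (rule extensionalityI[of _ "points (Omega \<times>\<^sub>Q Z)"])
      show "Q \<in> extensional (points (Omega \<times>\<^sub>Q Z))" using Q by (simp add: qmeas_def PiE_iff)
    qed (auto simp: G_def points_qprod)
    with Q show "(\<lambda>(t, z)\<in>points (Omega \<times>\<^sub>Q Z). G t z) \<in> qmeas (Omega \<times>\<^sub>Q Z) (qprob Y)" by simp
  qed
  have Ft: "F t \<in> qmeas (Y \<times>\<^sub>Q Z) (qprob X)" and Gt: "G t \<in> qmeas Z (qprob Y)" for t
    using F G by (simp_all add: qfun_def)
  have "R t = kernel_prod X Y Z (F t, G t)" for t
  proof (rule extensionalityI[of _ "points Z"])
    fix z assume z: "z \<in> points Z"
    have "kernel_prod X Y Z (F t, G t) z = kernel_prod X Y (Omega \<times>\<^sub>Q Z) (L, Q) (t, z)"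
      by (rule kernel_prod_uncurry[OF X Y Z Ft Gt L Q z]) (simp_all add: F_def G_def points_qprod z)
    also have "\<dots> = K (t, z)" using KL by (simp add: Q_def)
    also have "\<dots> = R t z" using z by (simp add: K_def points_qprod points_Omega)
    finally show "R t z = kernel_prod X Y Z (F t, G t) z" by (rule sym)
  qed (use Rt kernel_prod_qmeas[OF X Y Z Ft Gt] in \<open>auto simp: qmeas_def PiE_iff\<close>)
  with rvs_PairI[OF F G] show ?thesis by (intro bexI[of _ "\<lambda>t. (F t, G t)"]) auto
qed

theorem theorem7p24:
  fixes X :: "'a qus" and Y :: "'b qus" and Z :: "'c qus"
  assumes "quasi_universal X" and "quasi_universal Y" and "quasi_universal Z"
    and "(countably_separated Y \<and> standard_qus X) \<or>
         (countably_separated Y \<and> standard_qus Z) \<or>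
         discrete_qus Y"
  shows "disintegration_triple X Y Z \<and>
         kernel_prod X Y Z ` points (markov_kernels (Y \<times>\<^sub>Q Z) X \<times>\<^sub>Q markov_kernels Z Y) =
           points (markov_kernels Z (X \<times>\<^sub>Q Y)) \<and>
         qus_quotient_map (markov_kernels (Y \<times>\<^sub>Q Z) X \<times>\<^sub>Q markov_kernels Z Y)
           (markov_kernels Z (X \<times>\<^sub>Q Y)) (kernel_prod X Y Z)"
proof -
  note X = assms(1) and Y = assms(2) and Z = assms(3)
  note XY = quasi_universal_qprod[OF X Y] and OZ = quasi_universal_qprod[OF quasi_universal_Omega Z]
  let ?S = "markov_kernels (Y \<times>\<^sub>Q Z) X \<times>\<^sub>Q markov_kernels Z Y" and ?T = "markov_kernels Z (X \<times>\<^sub>Q Y)"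
  have S: "quasi_universal ?S"
    by (intro quasi_universal_qprod quasi_universal_qfun quasi_universal_qprob X Y Z)
  have T: "quasi_universal ?T" by (intro quasi_universal_qfun quasi_universal_qprob XY Z)
  have hyp: "disintegration_hyp X Y Z" using assms(4) by (simp add: disintegration_hyp_def)
  then have hyp': "disintegration_hyp X Y (Omega \<times>\<^sub>Q Z)"
    using standard_Omega_qprod[OF Z] by (auto simp: disintegration_hyp_def)
  have triple: "disintegration_triple X Y Z"
    unfolding disintegration_triple_def points_markov_kernels
    by (intro ballI disintegration_exists[OF X Y Z hyp])
  have image: "kernel_prod X Y Z ` points ?S = points ?T"
  proof
    show "kernel_prod X Y Z ` points ?S \<subseteq> points ?T"
      using kernel_prod_qmeas[OF X Y Z] by (auto simp: points_qprod[of "_ \<Rightarrow>\<^sub>Q _"] points_markov_kernels)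
    show "points ?T \<subseteq> kernel_prod X Y Z ` points ?S"
    proof
      fix K assume "K \<in> points ?T"
      then have K: "K \<in> qmeas Z (qprob (X \<times>\<^sub>Q Y))" by (simp add: points_markov_kernels)
      obtain L where L: "L \<in> qmeas (Y \<times>\<^sub>Q Z) (qprob X)"
        and KL: "K = kernel_prod X Y Z (L, kernel_marginal Y Z K)"
        using disintegration_exists[OF X Y Z hyp K] by (elim bexE)
      show "K \<in> kernel_prod X Y Z ` points ?S"
        using L kernel_marginal_qmeas[OF X Y Z K]
        by (intro image_eqI[where x="(L, kernel_marginal Y Z K)"] KL)
          (simp add: points_qprod[of "_ \<Rightarrow>\<^sub>Q _"] points_markov_kernels)
    qed
  qed
  have qm: "kernel_prod X Y Z \<in> qmeas ?S ?T"
    by (rule qmeasI[OF S T _ kernel_prod_rvs_markov_kernels[OF X Y Z]])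
      (unfold kernel_prod_def, rule restrict_extensional)
  have "rvs ?T = (\<lambda>\<alpha>. kernel_prod X Y Z \<circ> \<alpha>) ` rvs ?S"
  proof
    show "(\<lambda>\<alpha>. kernel_prod X Y Z \<circ> \<alpha>) ` rvs ?S \<subseteq> rvs ?T"
      using kernel_prod_rvs_markov_kernels[OF X Y Z] by (auto simp: o_def)
    show "rvs ?T \<subseteq> (\<lambda>\<alpha>. kernel_prod X Y Z \<circ> \<alpha>) ` rvs ?S"
    proof
      fix R assume "R \<in> rvs ?T"
      from kernel_prod_rvs_lift[OF X Y Z disintegration_exists[OF X Y OZ hyp'] this]
      show "R \<in> (\<lambda>\<alpha>. kernel_prod X Y Z \<circ> \<alpha>) ` rvs ?S" by (auto simp: o_def)
    qed
  qed
  with triple image qm show ?thesis by (simp add: qus_quotient_map_def)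
qed

end
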